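(* Suppose $V$ is convex and $\beta$-smooth ($\beta>0$), let $\hat\pi=\mathcal N(\hat m,\hat\Sigma)$ be a minimizer of $\mathcal F$ over $\mathsf{BW}(\mathbb R^d)$, and let $0<\eta\le 1/\beta$. Then the iterates $(p_k)$ of (deterministic) FB--GVI satisfy, for every $N\ge 1$, $$\mathcal F(p_N)-\mathcal F(\hat\pi)\le \frac{W_2^2(p_0,\hat\pi)}{2N\eta}.$$ In particular, with $\eta=1/\beta$ and $N\ge \beta W_2^2(p_0,\hat\pi)/(2\varepsilon^2)$ one has $\mathcal F(p_N)-\mathcal F(\hat\pi)\le\varepsilon^2$.
   Context: $\mathsf{BW}(\mathbb R^d)$ is the set of Gaussian distributions $\mathcal N(m,\Sigma)$ on $\mathbb R^d$ with $m\in\mathbb R^d$ and $\Sigma$ symmetric positive definite, endowed with the 2-Wasserstein distance $W_2$. $V:\mathbb R^d\to\mathbb R$ is twice continuously differentiable; it is $\beta$-smooth if $-\beta I\preceq\nabla^2V(x)\preceq\beta I$ for all $x$, and convex if $\nabla^2 V(x)\succeq 0$ for all $x$. For $\mu\in\mathsf{BW}(\mathbb R^d)$: potential $\mathcal V(\mu)=\int V\,d\mu$, entropy $\mathcal H(\mu)=\int\log\mu(x)\,d\mu(x)$ (identifying $\mu$ with its Lebesgue density), and $\mathcal F=\mathcal V+\mathcal H$ (so $\mathcal F(\mu)$ equals $\mathrm{KL}(\mu\|\pi)$ up to an additive constant, where $\pi\propto e^{-V}$). FB--GVI with step size $\eta>0$ and initialization $p_0=\mathcal N(m_0,\Sigma_0)\in\mathsf{BW}(\mathbb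 R^d)$: given $p_k=\mathcal N(m_k,\Sigma_k)$, set $b_k=\mathbb E_{p_k}\nabla V$, $S_k=\mathbb E_{p_k}\nabla^2V$, $m_{k+1}=m_k-\eta b_k$, $\Sigma_{k+1/2}=(I-\eta S_k)\Sigma_k(I-\eta S_k)$, $\Sigma_{k+1}=\tfrac12\big(\Sigma_{k+1/2}+2\eta I+[\Sigma_{k+1/2}(\Sigma_{k+1/2}+4\eta I)]^{1/2}\big)$ (principal PSD square root; the two factors commute), and $p_{k+1}=\mathcal N(m_{k+1},\Sigma_{k+1})$. *)

theory Defs
  imports "HOL-Probability.Probability"
begin

definition sym_mat :: "real^'n^'n \<Rightarrow> bool" where
  "sym_mat A \<longleftrightarrow> transpose A = A"

definition pd_mat :: "real^'n^'n \<Rightarrow> bool" where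
  "pd_mat A \<longleftrightarrow> sym_mat A \<and> (\<forall>v. v \<noteq> 0 \<longrightarrow> v \<bullet> (A *v v) > 0)"

definition psd_mat :: "real^'n^'n \<Rightarrow> bool" where
  "psd_mat A \<longleftrightarrow> sym_mat A \<and> (\<forall>v. v \<bullet> (A *v v) \<ge> 0)"

definition psd_sqrt :: "real^'n^'n \<Rightarrow> real^'n^'n" where
  "psd_sqrt A = (THE S. psd_mat S \<and> S ** S = A)"

definition gauss_pdf :: "real^'n \<Rightarrow> real^'n^'n \<Rightarrow> real^'n \<Rightarrow> real" where
  "gauss_pdf m \<Sigma> x =
     exp (- ((x - m) \<bullet> (matrix_inv \<Sigma> *v (x - m))) / 2)
       / sqrt ((2 * pi) ^ CARD('n) * det \<Sigma>)"

definition gaussian :: "real^'n \<Rightarrow> real^'n^'n \<Rightarrow> (real^'n) measure" where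
  "gaussian m \<Sigma> = density lborel (\<lambda>x. ennreal (gauss_pdf m \<Sigma> x))"

definition couplings :: "'a::euclidean_space measure \<Rightarrow> 'a measure \<Rightarrow> ('a \<times> 'a) measure set" where
  "couplings \<mu> \<nu> = {\<gamma>. prob_space \<gamma> \<and> sets \<gamma> = sets (borel \<Otimes>\<^sub>M borel)
                      \<and> distr \<gamma> borel fst = \<mu> \<and> distr \<gamma> borel snd = \<nu>}"

text \<open>Squared 2-Wasserstein distance (finite for Gaussians).\<close>
definition W2sq :: "'a::euclidean_space measure \<Rightarrow> 'a measure \<Rightarrow> real" where
  "W2sq \<mu> \<nu> = enn2real (INF \<gamma>\<in>couplings \<mu> \<nu>. \<integral>\<^sup>+ z. ennreal ((norm (fst z - snd z))\<^sup>2) \<partial>\<gamma>)"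

definition potential :: "(real^'n \<Rightarrow> real) \<Rightarrow> (real^'n) measure \<Rightarrow> real" where
  "potential V \<mu> = (\<integral>x. V x \<partial>\<mu>)"

definition gauss_entropy :: "real^'n \<Rightarrow> real^'n^'n \<Rightarrow> real" where
  "gauss_entropy m \<Sigma> = (\<integral>x. ln (gauss_pdf m \<Sigma> x) \<partial>gaussian m \<Sigma>)"

definition FF :: "(real^'n \<Rightarrow> real) \<Rightarrow> real^'n \<Rightarrow> real^'n^'n \<Rightarrow> real" where
  "FF V m \<Sigma> = potential V (gaussian m \<Sigma>) + gauss_entropy m \<Sigma>"

definition fbgvi_step ::
  "(real^'n \<Rightarrow> real^'n) \<Rightarrow> (real^'n \<Rightarrow> real^'n^'n) \<Rightarrow> real
    \<Rightarrow> (real^'n) \<times> (real^'n^'n) \<Rightarrow> (real^'n) \<times> (real^'n^'n)" where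
  "fbgvi_step gradV HV \<eta> p =
     (let m = fst p; \<Sigma> = snd p;
          b = (\<integral>x. gradV x \<partial>gaussian m \<Sigma>);
          S = (\<integral>x. HV x \<partial>gaussian m \<Sigma>);
          M = mat 1 - \<eta> *\<^sub>R S;
          \<Sigma>h = M ** \<Sigma> ** M
      in (m - \<eta> *\<^sub>R b,
          (1/2) *\<^sub>R (\<Sigma>h + (2 * \<eta>) *\<^sub>R mat 1 + psd_sqrt (\<Sigma>h ** (\<Sigma>h + (4 * \<eta>) *\<^sub>R mat 1)))))"

primrec fbgvi ::
  "(real^'n \<Rightarrow> real^'n) \<Rightarrow> (real^'n \<Rightarrow> real^'n^'n) \<Rightarrow> real
    \<Rightarrow> real^'n \<Rightarrow> real^'n^'n \<Rightarrow> nat \<Rightarrow> (real^'n) \<times> (real^'n^'n)" where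
  "fbgvi gradV HV \<eta> m0 \<Sigma>0 0 = (m0, \<Sigma>0)"
| "fbgvi gradV HV \<eta> m0 \<Sigma>0 (Suc k) = fbgvi_step gradV HV \<eta> (fbgvi gradV HV \<eta> m0 \<Sigma>0 k)"

end

theory Submission
  imports Defs
begin

text \<open>
  Write \<open>M = I - \<eta> S\<close>, and let \<open>\<Sigma>'\<close> be the covariance after the step. The backward step solves
  \<open>G \<Sigma>' G = M \<Sigma> M\<close> with \<open>G = I - \<eta> \<Sigma>'\<^sup>-\<^sup>1\<close> positive semidefinite. One step satisfies
  \<open>2 \<eta> (F(p') - F(\<nu>)) \<le> d(p, \<nu>) - d(p', \<nu>)\<close> for every Gaussian \<open>\<nu>\<close>, where \<open>d\<close> is the squared
  Bures-Wasserstein distance. This is the sum of three estimates: smoothness of \<open>V\<close> along the linear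
  coupling of \<open>p\<close> and \<open>p'\<close> through the intermediate Gaussian, convexity of \<open>V\<close> along the
  optimal coupling of \<open>p\<close> and \<open>\<nu>\<close>, and convexity of the entropy along the generalised geodesic
  from \<open>p'\<close> to \<open>\<nu>\<close> based at the intermediate Gaussian, which reduces to
  \<open>tr (A B) \<ge> n + ln det A + ln det B\<close>. Stein's identity turns the gradient terms of the first two
  into traces with \<open>S\<close>. Taking \<open>\<nu> = p\<close> shows that \<open>F\<close> decreases, and telescoping gives
  the rate. Only the bound of \<open>W\<^sub>2\<^sup>2\<close> from below by the Bures-Wasserstein formula is needed, and it
  follows from \<open>2 u \<bullet> w \<le> u \<bullet> T u + w \<bullet> T\<^sup>-\<^sup>1 w\<close>.
\<close>


section \<open>Spectral theorem for symmetric matrices\<close>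

text \<open>The admissible value \<eta> = 1/\<beta> shapes the matrix part: \<open>S\<close> may
  then have the eigenvalue \<beta>, so \<open>M\<close> is only positive semidefinite and the
  intermediate covariance \<open>M ** \<Sigma> ** M\<close> may be singular. No invertible transport
  matrix leaves a singular covariance, so both estimates that pass through it replace
  \<open>M\<close> or \<open>G\<close> by an invertible perturbation and let the perturbation
  vanish. What survives this is \<open>trace_young\<close>, a bound on cross-covariances by
  quadratic dual potentials; it plays the part of optimality of transport maps throughout, and its
  pointwise version \<open>pd_mat_young\<close> gives the lower bound on the Wasserstein cost. The
  condition \<eta> \<beta> \<le> 1 enters in two places: it makes \<open>M\<close> positive
  semidefinite, and it absorbs the quadratic remainder of the smoothness bound. Along the iteration
  all distances are the explicit expression \<open>gauss_cost\<close>, evaluated at one transport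
  matrix fixed per iterate; only the initial one is compared with \<open>W2sq\<close>.\<close>

lemma matrix_diff_ldistrib: "A ** (B - C) = A ** B - A ** (C :: 'a::ring_1^'p^'n)"
  for A :: "'a::ring_1^'n^'m"
  by (simp add: matrix_matrix_mult_def vec_eq_iff right_diff_distrib sum_subtractf)

lemma matrix_diff_rdistrib: "(A - B) ** C = A ** C - B ** (C :: 'a::ring_1^'p^'n)"
  for A :: "'a::ring_1^'n^'m"
  by (simp add: matrix_matrix_mult_def vec_eq_iff left_diff_distrib sum_subtractf)

lemma matrix_add_rdistrib: "(A + B) ** C = A ** C + B ** (C :: 'a::ring_1^'p^'n)"
  for A :: "'a::ring_1^'n^'m"
  by (simp add: matrix_matrix_mult_def vec_eq_iff distrib_right sum.distrib)

lemma transpose_add: "transpose (A + B) = transpose A + transpose B"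
  by (simp add: transpose_def vec_eq_iff)

lemma transpose_diff: "transpose (A - B) = transpose A - transpose B"
  by (simp add: transpose_def vec_eq_iff)

lemma trace_scaleR: "trace (c *\<^sub>R A) = c * trace (A :: real^'n^'n)"
  by (simp add: trace_def sum_distrib_left)

lemma trace_transpose: "trace (transpose A) = trace (A :: 'a::semiring_1^'n^'n)"
  by (simp add: trace_def transpose_def)

lemmas matrix_ring_simps =
  matrix_diff_ldistrib matrix_diff_rdistrib matrix_add_ldistrib matrix_add_rdistrib
  scalar_matrix_assoc[symmetric] matrix_scalar_ac matrix_mul_assoc[symmetric]

lemma inner_matrix_transpose: "x \<bullet> (A *v y) = (transpose A *v x) \<bullet> (y :: real^'n)"
  by (simp add: dot_lmul_matrix)

lemma sym_mat_inner: "sym_mat A \<Longrightarrow> x \<bullet> (A *v y) = (A *v x) \<bullet> y"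
  by (metis inner_matrix_transpose sym_mat_def)

text \<open>First-variation principle: a nonzero \<open>b\<close> is refuted at t = -b/s with s >
  |c|, where the linear term dominates.\<close>

lemma nonneg_parabola_linear_coeff:
  fixes b c :: real
  assumes "\<And>t. 0 \<le> 2 * t * b + t\<^sup>2 * c"
  shows "b = 0"
proof (rule ccontr)
  assume b: "b \<noteq> 0"
  define s where "s = \<bar>c\<bar> + 1"
  have s: "s > 0" "c < s" by (auto simp: s_def)
  have "0 \<le> 2 * (- b / s) * b + (- b / s)\<^sup>2 * c" by (rule assms)
  also have "\<dots> = b\<^sup>2 / s * (c / s - 2)"
    by (simp add: power2_eq_square algebra_simps)
  finally have "0 \<le> b\<^sup>2 / s * (c / s - 2)" .
  moreover have "b\<^sup>2 / s > 0" using b s by simp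
  ultimately have "0 \<le> c / s - 2" by (metis linorder_not_le mult_pos_neg)
  with s show False by (simp add: field_simps)
qed

text \<open>A zero of the form is a minimum of it, so the first variation at \<open>v\<close>
  vanishes in every direction \<open>w\<close>; the choice w = A v concludes.\<close>

lemma psd_mat_kernel:
  assumes "psd_mat A" "v \<bullet> (A *v v) = 0"
  shows "A *v v = 0"
proof -
  have sym: "sym_mat A" using assms by (simp add: psd_mat_def)
  have "0 \<le> 2 * t * (w \<bullet> (A *v v)) + t\<^sup>2 * (w \<bullet> (A *v w))" for t w
  proof -
    have "0 \<le> (v + t *\<^sub>R w) \<bullet> (A *v (v + t *\<^sub>R w))"
      using assms(1) by (simp add: psd_mat_def)
    also have "\<dots> = 2 * t * (w \<bullet> (A *v v)) + t\<^sup>2 * (w \<bullet> (A *v w))"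
      using assms(2) sym_mat_inner[OF sym, of v w]
      by (simp add: matrix_vector_right_distrib matrix_vector_mult_scaleR inner_add_left inner_add_right
          power2_eq_square inner_commute algebra_simps)
    finally show ?thesis .
  qed
  then have "(A *v v) \<bullet> (A *v v) = 0"
    using nonneg_parabola_linear_coeff by blast
  then show ?thesis by simp
qed

text \<open>The vector maximises the Rayleigh quotient over the unit sphere of the orthogonal
  complement \<open>W\<close> of \<open>E\<close>, which is nontrivial by the cardinality bound and
  invariant under \<open>A\<close>. The first-order condition makes c v - A v orthogonal to
  \<open>W\<close>, while it also lies in \<open>W\<close>.\<close>

lemma sym_mat_eigenvector:
  fixes A :: "real^'n^'n" and E :: "(real^'n) set"
  assumes sym: "sym_mat A" and fin: "finite E" and card: "card E < CARD('n)"
    and E: "\<And>e. e \<in> E \<Longrightarrow> \<exists>c. A *v e = c *\<^sub>R e"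
  obtains v c where "norm v = 1" "\<And>e. e \<in> E \<Longrightarrow> v \<bullet> e = 0" "A *v v = c *\<^sub>R v"
proof -
  define W where "W = {x. \<forall>e\<in>E. x \<bullet> e = 0}"
  have subW: "x + y \<in> W" "t *\<^sub>R x \<in> W" "x - y \<in> W" if "x \<in> W" "y \<in> W" for x y t
    using that by (auto simp: W_def inner_add_left inner_diff_left)
  have AW: "A *v x \<in> W" if "x \<in> W" for x
  proof -
    have "(A *v x) \<bullet> e = 0" if "e \<in> E" for e
    proof -
      obtain c where "A *v e = c *\<^sub>R e" using E[OF \<open>e \<in> E\<close>] by blast
      then show ?thesis
        using sym_mat_inner[OF sym, of x e] \<open>x \<in> W\<close> \<open>e \<in> E\<close> by (auto simp: W_def)
    qed
    then show ?thesis by (simp add: W_def)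
  qed
  have "dim E < DIM(real^'n)"
    using dim_le_card'[OF fin] card by simp
  then obtain w where w: "w \<noteq> 0" "\<And>y. y \<in> span E \<Longrightarrow> orthogonal w y"
    using orthogonal_to_subspace_exists by blast
  then have wW: "w \<in> W" by (auto simp: W_def orthogonal_def span_base)
  define K where "K = sphere 0 1 \<inter> W"
  have "closed W"
  proof -
    have "W = (\<Inter>e\<in>E. {x. e \<bullet> x = 0})" by (auto simp: W_def inner_commute)
    then show ?thesis by (auto intro: closed_hyperplane)
  qed
  then have "compact K" by (simp add: K_def compact_Int_closed)
  moreover have "(1 / norm w) *\<^sub>R w \<in> K"
    using w subW(2)[OF wW wW] by (simp add: K_def)
  moreover have "continuous_on K (\<lambda>x. x \<bullet> (A *v x))"
    by (intro continuous_intros linear_continuous_on) auto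
  ultimately obtain v where v: "v \<in> K" and vmax: "\<And>y. y \<in> K \<Longrightarrow> y \<bullet> (A *v y) \<le> v \<bullet> (A *v v)"
    using continuous_attains_sup[of K "\<lambda>x. x \<bullet> (A *v x)"] by blast
  define c where "c = v \<bullet> (A *v v)"
  have v1: "norm v = 1" "v \<in> W" "v \<bullet> v = 1"
    using v by (auto simp: K_def norm_eq_1)
  have le: "y \<bullet> (A *v y) \<le> c * (y \<bullet> y)" if "y \<in> W" for y
  proof (cases "y = 0")
    case False
    have "(1 / norm y) *\<^sub>R y \<in> K" using False subW(2)[OF that that] by (simp add: K_def)
    from vmax[OF this] have "(y \<bullet> (A *v y)) / (norm y)\<^sup>2 \<le> c"
      by (simp add: c_def matrix_vector_mult_scaleR power2_eq_square)
    then show ?thesis using False by (simp add: field_simps power2_norm_eq_inner)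
  qed simp
  have "(c *\<^sub>R v - A *v v) \<bullet> u = 0" if u: "u \<in> W" for u
  proof (rule nonneg_parabola_linear_coeff)
    fix t
    have "v + t *\<^sub>R u \<in> W" using subW v1 u by blast
    from le[OF this] show "0 \<le> 2 * t * ((c *\<^sub>R v - A *v v) \<bullet> u) + t\<^sup>2 * (c * (u \<bullet> u) - u \<bullet> (A *v u))"
      using v1 sym_mat_inner[OF sym, of v u]
      by (simp add: matrix_vector_right_distrib matrix_vector_mult_scaleR inner_add_left inner_add_right
          power2_eq_square inner_commute inner_diff_left c_def algebra_simps)
  qed
  moreover have "c *\<^sub>R v - A *v v \<in> W" using subW AW v1 by blast
  ultimately have "c *\<^sub>R v - A *v v = 0" using inner_eq_zero_iff by blast
  then show thesis using that[of v c] v1 by (auto simp: W_def)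
qed

definition diag_mat :: "('n \<Rightarrow> real) \<Rightarrow> real^'n^'n" where
  "diag_mat d = (\<chi> i j. if i = j then d i else 0)"

text \<open>For orthogonal \<open>Q\<close> this is functional calculus in the eigenbasis given by
  the columns of \<open>Q\<close>: products, sums, inverses and roots of such matrices are computed
  entrywise on \<open>d\<close>.\<close>

definition conj_diag :: "real^'n^'n \<Rightarrow> ('n \<Rightarrow> real) \<Rightarrow> real^'n^'n" where
  "conj_diag Q d = Q ** diag_mat d ** transpose Q"

text \<open>A set instead of an indexed family lets the induction run over its size; an indexing by
  the type 'n is chosen only at full size.\<close>

lemma sym_mat_orthonormal_eigenset:
  fixes A :: "real^'n^'n"
  assumes "sym_mat A" "k \<le> CARD('n)"
  shows "\<exists>E. finite E \<and> card E = k \<and> (\<forall>e\<in>E. norm e = 1 \<and> (\<exists>c. A *v e = c *\<^sub>R e)) \<and>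
    (\<forall>e\<in>E. \<forall>f\<in>E. e \<noteq> f \<longrightarrow> e \<bullet> f = 0)"
  using assms(2)
proof (induction k)
  case (Suc k)
  then obtain E where E: "finite E" "card E = k" "\<forall>e\<in>E. norm e = 1 \<and> (\<exists>c. A *v e = c *\<^sub>R e)"
    "\<forall>e\<in>E. \<forall>f\<in>E. e \<noteq> f \<longrightarrow> e \<bullet> f = 0" by auto
  obtain v c where v: "norm v = 1" "\<And>e. e \<in> E \<Longrightarrow> v \<bullet> e = 0" "A *v v = c *\<^sub>R v"
    using sym_mat_eigenvector[of A E] assms(1) E Suc.prems by auto
  have "v \<notin> E" using v by (metis inner_eq_zero_iff norm_zero zero_neq_one)
  then have "card (insert v E) = Suc k" using E by simp
  then show ?case
    using E v by (intro exI[of _ "insert v E"]) (auto simp: inner_commute)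
qed (intro exI[of _ "{}"], simp)

theorem sym_mat_spectral:
  fixes A :: "real^'n^'n"
  assumes "sym_mat A"
  obtains Q d where "orthogonal_matrix Q" "A = conj_diag Q d"
proof -
  obtain E where E: "finite E" "card E = CARD('n)" "\<forall>e\<in>E. norm e = 1 \<and> (\<exists>c. A *v e = c *\<^sub>R e)"
    "\<forall>e\<in>E. \<forall>f\<in>E. e \<noteq> f \<longrightarrow> e \<bullet> f = 0"
    using sym_mat_orthonormal_eigenset[OF assms order_refl] by blast
  obtain q where q: "bij_betw q (UNIV :: 'n set) E"
    using finite_same_card_bij[of "UNIV :: 'n set" E] E by auto
  have qE: "q i \<in> E" for i using q by (auto simp: bij_betw_def)
  then have "\<forall>i. \<exists>c. A *v q i = c *\<^sub>R q i" using E by blast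
  then obtain d where d: "\<And>i. A *v q i = d i *\<^sub>R q i" by metis
  have inj: "q i \<noteq> q j" if "i \<noteq> j" for i j
    using q that by (auto simp: bij_betw_def inj_on_def)
  define Q where "Q = (\<chi> i j. q j $ i)"
  have col: "column j Q = q j" for j by (simp add: Q_def column_def vec_eq_iff)
  have Q: "orthogonal_matrix Q"
    using E qE inj by (auto simp: orthogonal_matrix_orthonormal_columns col orthogonal_def)
  have "(A ** Q) $ i $ j = (Q ** diag_mat d) $ i $ j" for i j
  proof -
    have "(A ** Q) $ i $ j = (A *v q j) $ i"
      by (simp add: matrix_matrix_mult_def matrix_vector_mult_def Q_def)
    also have "\<dots> = (Q ** diag_mat d) $ i $ j"
      by (simp add: d matrix_matrix_mult_def diag_mat_def Q_def if_distrib cong: if_cong)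
    finally show ?thesis .
  qed
  then have "A ** Q = Q ** diag_mat d" by (simp add: vec_eq_iff)
  then have "A ** Q ** transpose Q = conj_diag Q d" by (simp add: conj_diag_def)
  then have "A = conj_diag Q d"
    using Q by (simp add: matrix_mul_assoc[symmetric] orthogonal_matrix_def)
  with Q show thesis by (rule that)
qed

section \<open>Functional calculus in a fixed orthonormal eigenbasis\<close>

lemma diag_mat_matrix: "(diag_mat d ** A) $ i $ j = d i * A $ i $ j"
  by (simp add: diag_mat_def matrix_matrix_mult_def if_distrib[of "\<lambda>x. x * _"] cong: if_cong)

lemma diag_mat_vector: "(diag_mat d *v x) $ i = d i * x $ i"
  by (simp add: diag_mat_def matrix_vector_mult_def if_distrib[of "\<lambda>x. x * _"] cong: if_cong)

lemma diag_mat_mult: "diag_mat d ** diag_mat e = diag_mat (\<lambda>i. d i * e i)"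
  by (simp add: vec_eq_iff diag_mat_matrix) (simp add: diag_mat_def)

lemma conj_diag_mult:
  assumes "orthogonal_matrix Q"
  shows "conj_diag Q d ** conj_diag Q e = conj_diag Q (\<lambda>i. d i * e i)"
proof -
  have "conj_diag Q d ** conj_diag Q e = Q ** (diag_mat d ** ((transpose Q ** Q) ** (diag_mat e ** transpose Q)))"
    by (simp add: conj_diag_def matrix_mul_assoc)
  also have "\<dots> = Q ** (diag_mat d ** diag_mat e) ** transpose Q"
    using assms by (simp add: orthogonal_matrix matrix_mul_assoc)
  finally show ?thesis by (simp add: diag_mat_mult conj_diag_def)
qed

lemma conj_diag_add: "conj_diag Q d + conj_diag Q e = conj_diag Q (\<lambda>i. d i + e i)"
proof -
  have "diag_mat d + diag_mat e = diag_mat (\<lambda>i. d i + e i)"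
    by (simp add: diag_mat_def vec_eq_iff)
  then show ?thesis
    unfolding conj_diag_def by (metis matrix_add_ldistrib matrix_add_rdistrib)
qed

lemma conj_diag_diff: "conj_diag Q d - conj_diag Q e = conj_diag Q (\<lambda>i. d i - e i)"
proof -
  have "diag_mat d - diag_mat e = diag_mat (\<lambda>i. d i - e i)"
    by (simp add: diag_mat_def vec_eq_iff)
  then show ?thesis
    unfolding conj_diag_def by (metis matrix_diff_ldistrib matrix_diff_rdistrib)
qed

lemma conj_diag_scaleR: "c *\<^sub>R conj_diag Q d = conj_diag Q (\<lambda>i. c * d i)"
proof -
  have "diag_mat (\<lambda>i. c * d i) = c *\<^sub>R diag_mat d"
    by (simp add: diag_mat_def vec_eq_iff)
  then show ?thesis
    unfolding conj_diag_def by (simp add: matrix_scalar_ac scalar_matrix_assoc)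
qed

lemma conj_diag_mat:
  fixes Q :: "real^'n^'n"
  assumes "orthogonal_matrix Q"
  shows "mat c = conj_diag Q (\<lambda>i. c)"
proof -
  have "diag_mat (\<lambda>i. c) = c *\<^sub>R (mat 1 :: real^'n^'n)" by (simp add: diag_mat_def mat_def vec_eq_iff)
  moreover have "mat c = c *\<^sub>R (mat 1 :: real^'n^'n)" by (simp add: mat_def vec_eq_iff)
  ultimately show ?thesis
    using assms
    by (simp only: conj_diag_def matrix_scalar_ac scalar_matrix_assoc[symmetric] orthogonal_matrix_def matrix_mul_rid)
qed

lemma conj_diag_trace:
  assumes "orthogonal_matrix Q"
  shows "trace (conj_diag Q d) = (\<Sum>i\<in>UNIV. d i)"
proof -
  have "trace (conj_diag Q d) = trace (diag_mat d ** (transpose Q ** Q))"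
    unfolding conj_diag_def by (metis matrix_mul_assoc trace_mul_sym)
  also have "\<dots> = trace (diag_mat d)" using assms by (simp add: orthogonal_matrix)
  finally show ?thesis by (simp add: trace_def diag_mat_def)
qed

lemma conj_diag_det:
  assumes "orthogonal_matrix Q"
  shows "det (conj_diag Q d) = (\<Prod>i\<in>UNIV. d i)"
proof -
  have "det Q * det Q = 1"
    using assms by (metis det_I det_mul det_transpose orthogonal_matrix)
  moreover have "det (diag_mat d) = (\<Prod>i\<in>UNIV. d i)"
    by (subst det_diagonal) (auto simp: diag_mat_def)
  ultimately show ?thesis by (simp add: conj_diag_def det_mul)
qed

lemma conj_diag_sym [simp]: "sym_mat (conj_diag Q d)"
proof -
  have "transpose (diag_mat d) = diag_mat d" by (auto simp: diag_mat_def transpose_def vec_eq_iff)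
  then show ?thesis by (simp add: conj_diag_def sym_mat_def matrix_transpose_mul matrix_mul_assoc)
qed

lemma conj_diag_quadratic_form:
  "x \<bullet> (conj_diag Q d *v x) = (\<Sum>i\<in>UNIV. d i * ((transpose Q *v x) $ i)\<^sup>2)"
proof -
  have "x \<bullet> (conj_diag Q d *v x) = (transpose Q *v x) \<bullet> (diag_mat d *v (transpose Q *v x))"
    unfolding conj_diag_def by (simp only: matrix_vector_mul_assoc[symmetric] inner_matrix_transpose)
  also have "\<dots> = (\<Sum>i\<in>UNIV. d i * ((transpose Q *v x) $ i)\<^sup>2)"
    by (simp del: transpose_matrix_vector add: inner_vec_def diag_mat_vector power2_eq_square mult_ac)
  finally show ?thesis .
qed

text \<open>The columns of \<open>Q\<close> serve as test vectors: they read off single entries of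
  \<open>d\<close> from the quadratic form.\<close>

lemma conj_diag_eigenvalue:
  assumes "orthogonal_matrix Q"
  shows "(Q *v axis i 1) \<bullet> (conj_diag Q d *v (Q *v axis i 1)) = d i"
    and "Q *v axis i 1 \<noteq> 0" and "conj_diag Q d *v (Q *v axis i 1) = d i *\<^sub>R (Q *v axis i 1)"
proof -
  have *: "transpose Q *v (Q *v axis i 1) = axis i (1::real)"
    using assms by (simp only: matrix_vector_mul_assoc orthogonal_matrix) simp
  show "(Q *v axis i 1) \<bullet> (conj_diag Q d *v (Q *v axis i 1)) = d i"
    unfolding conj_diag_quadratic_form *
    by (simp add: axis_def if_distrib[of "\<lambda>x. x ^ 2"] if_distrib[of "\<lambda>x. _ * x"] cong: if_cong)
  show "Q *v axis i 1 \<noteq> 0"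
  proof
    assume "Q *v axis i 1 = 0"
    with * show False by (simp add: axis_eq_0_iff)
  qed
  have "diag_mat d *v axis i 1 = d i *\<^sub>R axis i 1"
    by (simp add: vec_eq_iff diag_mat_vector axis_def)
  then show "conj_diag Q d *v (Q *v axis i 1) = d i *\<^sub>R (Q *v axis i 1)"
    using * unfolding conj_diag_def by (simp only: matrix_vector_mul_assoc[symmetric] matrix_vector_mult_scaleR)
qed

lemma conj_diag_psd_iff:
  assumes "orthogonal_matrix Q"
  shows "psd_mat (conj_diag Q d) \<longleftrightarrow> (\<forall>i. 0 \<le> d i)"
  using conj_diag_eigenvalue(1)[OF assms, where d = d]
  by (auto simp: psd_mat_def conj_diag_quadratic_form intro!: sum_nonneg) metis

lemma conj_diag_pd_iff:
  assumes "orthogonal_matrix Q"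
  shows "pd_mat (conj_diag Q d) \<longleftrightarrow> (\<forall>i. 0 < d i)"
proof
  assume "pd_mat (conj_diag Q d)"
  then show "\<forall>i. 0 < d i"
    using conj_diag_eigenvalue(1)[OF assms, where d = d] conj_diag_eigenvalue(2)[OF assms]
    by (metis pd_mat_def)
next
  assume d: "\<forall>i. 0 < d i"
  have "0 < x \<bullet> (conj_diag Q d *v x)" if "x \<noteq> 0" for x
  proof -
    have "transpose Q *v x \<noteq> 0"
    proof
      assume "transpose Q *v x = 0"
      then have "Q *v (transpose Q *v x) = 0" by simp
      then show False using that assms by (simp only: matrix_vector_mul_assoc orthogonal_matrix_def) simp
    qed
    then obtain i where "(transpose Q *v x) $ i \<noteq> 0" by (metis vec_eq_iff zero_index)
    then show ?thesis
      unfolding conj_diag_quadratic_form using d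
      by (intro sum_pos2[of _ i]) (auto simp: less_imp_le simp del: transpose_matrix_vector)
  qed
  then show "pd_mat (conj_diag Q d)" by (simp add: pd_mat_def)
qed


section \<open>Positive definite matrices and trace inequalities\<close>

lemma matrix_inv_eqI:
  fixes A B :: "real^'n^'n"
  assumes "A ** B = mat 1"
  shows "matrix_inv A = B"
proof -
  have BA: "B ** A = mat 1" using assms matrix_left_right_inverse by blast
  then have "\<exists>X. A ** X = mat 1 \<and> X ** A = mat 1" using assms by blast
  then have "A ** matrix_inv A = mat 1"
    unfolding matrix_inv_def by (rule someI2_ex) simp
  then have "B ** (A ** matrix_inv A) = B" by simp
  then show ?thesis using BA by (simp add: matrix_mul_assoc)
qed

lemma pd_mat_psd: "pd_mat A \<Longrightarrow> psd_mat A"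
  unfolding pd_mat_def psd_mat_def by (metis inner_zero_left less_imp_le order_refl)

lemma pd_mat_sym: "pd_mat A \<Longrightarrow> transpose A = A"
  by (simp add: pd_mat_def sym_mat_def)

lemma psd_mat_sym: "psd_mat A \<Longrightarrow> transpose A = A"
  by (simp add: psd_mat_def sym_mat_def)

lemma pd_mat_spectral:
  assumes "pd_mat A"
  obtains Q d where "orthogonal_matrix Q" "A = conj_diag Q d" "\<And>i. 0 < d i"
  using assms sym_mat_spectral[of A] by (metis conj_diag_pd_iff pd_mat_def)

lemma psd_mat_spectral:
  assumes "psd_mat A"
  obtains Q d where "orthogonal_matrix Q" "A = conj_diag Q d" "\<And>i. 0 \<le> d i"
  using assms sym_mat_spectral[of A] by (metis conj_diag_psd_iff psd_mat_def)

lemma pd_mat_inverse: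
  fixes A :: "real^'n^'n"
  assumes "pd_mat A"
  shows "pd_mat (matrix_inv A)" "A ** matrix_inv A = mat 1" "matrix_inv A ** A = mat 1"
proof -
  obtain Q d where Q: "orthogonal_matrix Q" "A = conj_diag Q d" and d: "\<And>i. 0 < d i"
    using pd_mat_spectral[OF assms] by blast
  have "d i * inverse (d i) = 1" for i using d[of i] by simp
  then have "A ** conj_diag Q (\<lambda>i. inverse (d i)) = mat 1"
    using Q conj_diag_mat[of Q 1] by (simp add: conj_diag_mult)
  moreover from this have "matrix_inv A = conj_diag Q (\<lambda>i. inverse (d i))"
    by (rule matrix_inv_eqI)
  ultimately show "pd_mat (matrix_inv A)" "A ** matrix_inv A = mat 1"
    using Q d by (simp_all add: conj_diag_pd_iff)
  then show "matrix_inv A ** A = mat 1" using matrix_left_right_inverse by blast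
qed

lemma pd_mat_inverse_cancel:
  fixes A :: "real^'n^'n"
  assumes "pd_mat A"
  shows "A ** (matrix_inv A ** B) = B" "matrix_inv A ** (A ** B) = B"
  using pd_mat_inverse[OF assms] by (simp_all add: matrix_mul_assoc)

section \<open>Square roots, congruences and transport matrices\<close>

lemma pd_mat_sqrt:
  assumes "pd_mat A"
  obtains S where "pd_mat S" "S ** S = A"
proof -
  obtain Q d where Q: "orthogonal_matrix Q" "A = conj_diag Q d" and d: "\<And>i. 0 < d i"
    using pd_mat_spectral[OF assms] by blast
  have "sqrt (d i) * sqrt (d i) = d i" for i using d[of i] by simp
  then show thesis
    using that[of "conj_diag Q (\<lambda>i. sqrt (d i))"] Q d by (simp add: conj_diag_mult conj_diag_pd_iff)
qed

lemma psd_mat_sqrt: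
  assumes "psd_mat A"
  obtains S where "psd_mat S" "S ** S = A"
proof -
  obtain Q d where Q: "orthogonal_matrix Q" "A = conj_diag Q d" and d: "\<And>i. 0 \<le> d i"
    using psd_mat_spectral[OF assms] by blast
  have "sqrt (d i) * sqrt (d i) = d i" for i using d[of i] by simp
  then show thesis
    using that[of "conj_diag Q (\<lambda>i. sqrt (d i))"] Q d by (simp add: conj_diag_mult conj_diag_psd_iff)
qed

text \<open>With D = S - R the hypothesis becomes S D + D R = 0. For an eigenvector \<open>v\<close>
  of \<open>D\<close> with nonzero eigenvalue this gives v . S v + v . R v = 0, so \<open>S\<close>
  and \<open>R\<close> both annihilate \<open>v\<close>, and then so does \<open>D\<close>.
  Uniqueness is what gives meaning to the definite description in \<open>psd_sqrt\<close>.\<close>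

lemma psd_sqrt_unique:
  assumes S: "psd_mat S" and R: "psd_mat R" and eq: "S ** S = R ** R"
  shows "S = R"
proof -
  define D where "D = S - R"
  have "sym_mat D"
    using S R by (simp add: D_def psd_mat_def sym_mat_def transpose_diff)
  then obtain Q d where Q: "orthogonal_matrix Q" "D = conj_diag Q d"
    using sym_mat_spectral by blast
  have DS: "S ** D + D ** R = 0"
    by (simp add: D_def eq matrix_diff_ldistrib matrix_diff_rdistrib)
  have "d i = 0" for i
  proof (rule ccontr)
    assume di: "d i \<noteq> 0"
    define v where "v = Q *v axis i 1"
    have v: "D *v v = d i *\<^sub>R v" "v \<noteq> 0"
      using conj_diag_eigenvalue[OF Q(1)] Q(2) by (auto simp: v_def)
    have "0 = v \<bullet> ((S ** D + D ** R) *v v)" by (simp add: DS)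
    also have "\<dots> = v \<bullet> (S *v (D *v v)) + v \<bullet> (D *v (R *v v))"
      by (simp add: matrix_vector_mult_add_rdistrib inner_add_right matrix_vector_mul_assoc)
    also have "v \<bullet> (D *v (R *v v)) = d i * (v \<bullet> (R *v v))"
      using sym_mat_inner[OF \<open>sym_mat D\<close>, of v "R *v v"] v by simp
    also have "v \<bullet> (S *v (D *v v)) = d i * (v \<bullet> (S *v v))"
      by (simp add: v matrix_vector_mult_scaleR)
    finally have "v \<bullet> (S *v v) + v \<bullet> (R *v v) = 0"
      using di by (simp flip: distrib_left)
    moreover have "0 \<le> v \<bullet> (S *v v)" "0 \<le> v \<bullet> (R *v v)" using S R by (auto simp: psd_mat_def)
    ultimately have "v \<bullet> (S *v v) = 0" "v \<bullet> (R *v v) = 0" by auto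
    then have "S *v v = 0" "R *v v = 0" using S R by (auto intro: psd_mat_kernel)
    then have "D *v v = 0" by (simp add: D_def matrix_vector_mult_diff_rdistrib)
    then show False using v di by simp
  qed
  then have "d = (\<lambda>i. 0)" by (simp add: fun_eq_iff)
  then have "D = mat 0" using Q conj_diag_mat[of Q 0] by simp
  then show ?thesis by (simp add: D_def)
qed

lemma psd_sqrt_eqI: "psd_mat S \<Longrightarrow> S ** S = A \<Longrightarrow> psd_sqrt A = S"
  unfolding psd_sqrt_def by (rule the_equality) (auto intro: psd_sqrt_unique)

lemma psd_mat_congruence:
  assumes "psd_mat A"
  shows "psd_mat (C ** A ** transpose C)"
proof -
  have "x \<bullet> ((C ** A ** transpose C) *v x) = (transpose C *v x) \<bullet> (A *v (transpose C *v x))" for x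
    by (simp only: matrix_vector_mul_assoc[symmetric] inner_matrix_transpose)
  then show ?thesis
    using assms by (simp add: psd_mat_def sym_mat_def matrix_transpose_mul matrix_mul_assoc del: transpose_matrix_vector)
qed

text \<open>The left inverse \<open>B\<close> only witnesses that \<open>transpose C\<close> is
  injective.\<close>

lemma pd_mat_congruence:
  fixes A C :: "real^'n^'n"
  assumes "pd_mat A" "B ** transpose C = mat 1"
  shows "pd_mat (C ** A ** transpose C)"
proof -
  have *: "x \<bullet> ((C ** A ** transpose C) *v x) = (transpose C *v x) \<bullet> (A *v (transpose C *v x))" for x
    by (simp only: matrix_vector_mul_assoc[symmetric] inner_matrix_transpose)
  have "transpose C *v x \<noteq> 0" if "x \<noteq> 0" for x
  proof
    assume "transpose C *v x = 0"
    then have "B *v (transpose C *v x) = 0" by simp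
    then show False using that assms(2) by (simp only: matrix_vector_mul_assoc) simp
  qed
  then show ?thesis
    using assms unfolding pd_mat_def *
    by (simp add: sym_mat_def matrix_transpose_mul matrix_mul_assoc del: transpose_matrix_vector)
qed

lemma pd_mat_sandwich:
  assumes "pd_mat A" "pd_mat C"
  shows "pd_mat (C ** A ** C)"
  using pd_mat_congruence[OF assms(1), of "matrix_inv C" C] pd_mat_inverse[OF assms(2)] pd_mat_sym[OF assms(2)]
  by simp

lemma psd_mat_add: "psd_mat A \<Longrightarrow> psd_mat B \<Longrightarrow> psd_mat (A + B)"
  by (auto simp: psd_mat_def sym_mat_def transpose_add matrix_vector_mult_add_rdistrib inner_add_right)

lemma psd_mat_scaleR: "psd_mat A \<Longrightarrow> 0 \<le> c \<Longrightarrow> psd_mat (c *\<^sub>R A)"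
  by (auto simp: psd_mat_def sym_mat_def transpose_scalar scaleR_matrix_vector_assoc[symmetric])

lemma psd_pd_mat_add:
  assumes "psd_mat A" "pd_mat B" "0 < c"
  shows "pd_mat (A + c *\<^sub>R B)"
  using assms unfolding psd_mat_def pd_mat_def sym_mat_def
  by (auto simp: transpose_add transpose_scalar matrix_vector_mult_add_rdistrib inner_add_right
      scaleR_matrix_vector_assoc[symmetric] intro!: add_nonneg_pos)

text \<open>The witness is S^-1 (S B S)^(1/2) S^-1 with S = A^(1/2), the matrix of the optimal
  transport map between centred Gaussians of covariances \<open>A\<close> and
  \<open>B\<close>.\<close>

lemma pd_mat_transport_exists:
  assumes A: "pd_mat A" and B: "pd_mat B"
  obtains T where "pd_mat T" "T ** A ** T = B"
proof -
  obtain S where S: "pd_mat S" "S ** S = A" using pd_mat_sqrt[OF A] by blast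
  obtain R where R: "pd_mat R" "R ** R = S ** B ** S"
    using pd_mat_sqrt[OF pd_mat_sandwich[OF B S(1)]] by blast
  let ?I = "matrix_inv S"
  have "?I ** R ** ?I ** A ** (?I ** R ** ?I) = ?I ** (R ** R) ** ?I"
    using S(1) by (simp add: S(2)[symmetric] matrix_mul_assoc[symmetric] pd_mat_inverse_cancel)
  also have "\<dots> = B"
    using S(1) by (simp add: R matrix_mul_assoc[symmetric] pd_mat_inverse_cancel pd_mat_inverse)
  finally show thesis
    using that[of "?I ** R ** ?I"] R S pd_mat_sandwich pd_mat_inverse by blast
qed

section \<open>Trace and log-determinant inequalities\<close>

lemma psd_mat_trace_nonneg:
  assumes "psd_mat A"
  shows "0 \<le> trace A"
proof -
  obtain Q d where "orthogonal_matrix Q" "A = conj_diag Q d" "\<And>i. 0 \<le> d i"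
    using psd_mat_spectral[OF assms] by blast
  then show ?thesis by (simp add: conj_diag_trace sum_nonneg)
qed

lemma psd_mat_trace_mult_nonneg:
  assumes "psd_mat A" "psd_mat B"
  shows "0 \<le> trace (A ** B)"
proof -
  obtain S where S: "psd_mat S" "S ** S = A" using psd_mat_sqrt[OF assms(1)] by blast
  have "trace (A ** B) = trace (S ** B ** transpose S)"
    unfolding S(2)[symmetric] psd_mat_sym[OF S(1)] by (metis matrix_mul_assoc trace_mul_sym)
  then show ?thesis using psd_mat_congruence[OF assms(2)] psd_mat_trace_nonneg by metis
qed

text \<open>Probabilistically, for z of covariance \<Sigma>, X = K z and Y = L z this reads 2 E X.Y
  \<le> E X.A X + E Y.A^-1 Y: every coupling obeys the dual bound given by the quadratic potential
  of \<open>A\<close>. The difference of the two sides is the trace of A^-1 against the covariance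
  of A X - Y.\<close>

lemma trace_young:
  fixes A \<Sigma> K L :: "real^'n^'n"
  assumes A: "pd_mat A" and \<Sigma>: "psd_mat \<Sigma>"
  shows "2 * trace (L ** \<Sigma> ** transpose K)
    \<le> trace (A ** (K ** \<Sigma> ** transpose K)) + trace (matrix_inv A ** (L ** \<Sigma> ** transpose L))"
proof -
  let ?I = "matrix_inv A" and ?X = "A ** K - L"
  have sym: "transpose A = A" "transpose \<Sigma> = \<Sigma>"
    using A \<Sigma> by (auto simp: pd_mat_sym psd_mat_sym)
  have "0 \<le> trace (?I ** (?X ** \<Sigma> ** transpose ?X))"
    using A \<Sigma> by (intro psd_mat_trace_mult_nonneg psd_mat_congruence) (auto intro: pd_mat_psd pd_mat_inverse)
  also have "?I ** (?X ** \<Sigma> ** transpose ?X) =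
     K ** \<Sigma> ** transpose K ** A - K ** \<Sigma> ** transpose L
       - ?I ** (L ** \<Sigma> ** transpose K ** A) + ?I ** (L ** \<Sigma> ** transpose L)"
    using A by (simp add: transpose_diff matrix_transpose_mul sym matrix_ring_simps pd_mat_inverse_cancel)
  also have "trace \<dots> = trace (K ** \<Sigma> ** transpose K ** A) - trace (K ** \<Sigma> ** transpose L)
       - trace (?I ** (L ** \<Sigma> ** transpose K ** A)) + trace (?I ** (L ** \<Sigma> ** transpose L))"
    by (simp add: trace_add trace_sub)
  also have "trace (K ** \<Sigma> ** transpose K ** A) = trace (A ** (K ** \<Sigma> ** transpose K))"
    by (rule trace_mul_sym)
  also have "trace (K ** \<Sigma> ** transpose L) = trace (L ** \<Sigma> ** transpose K)"
    by (subst trace_transpose[symmetric]) (simp add: matrix_transpose_mul sym matrix_mul_assoc)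
  also have "trace (?I ** (L ** \<Sigma> ** transpose K ** A)) = trace (L ** \<Sigma> ** transpose K)"
    using A by (subst trace_mul_sym) (simp add: matrix_mul_assoc[symmetric] pd_mat_inverse)
  finally show ?thesis by simp
qed

lemma pd_mat_det_pos:
  assumes "pd_mat A"
  shows "0 < det A"
proof -
  obtain Q d where "orthogonal_matrix Q" "A = conj_diag Q d" "\<And>i. 0 < d i"
    using pd_mat_spectral[OF assms] by blast
  then show ?thesis by (simp add: conj_diag_det prod_pos)
qed

text \<open>Sum of ln x \<le> x - 1 over the eigenvalues.\<close>

lemma trace_ge_ln_det:
  fixes A :: "real^'n^'n"
  assumes "pd_mat A"
  shows "real CARD('n) + ln (det A) \<le> trace A"
proof -
  obtain Q d where Q: "orthogonal_matrix Q" "A = conj_diag Q d" and d: "\<And>i. 0 < d i"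
    using pd_mat_spectral[OF assms] by blast
  have "real CARD('n) + ln (det A) = (\<Sum>i\<in>UNIV. 1 + ln (d i))"
    using Q d by (simp add: conj_diag_det ln_prod less_imp_neq[symmetric] sum.distrib)
  also have "\<dots> \<le> (\<Sum>i\<in>UNIV. d i)"
    using ln_le_minus_one[OF d] by (intro sum_mono) (simp add: le_diff_eq add.commute)
  finally show ?thesis using Q by (simp add: conj_diag_trace)
qed

text \<open>\<open>A ** B\<close> need not be symmetric, but it has the trace and determinant of the
  positive definite S B S with S = A^(1/2).\<close>

lemma trace_mult_ge_ln_det:
  fixes A B :: "real^'n^'n"
  assumes A: "pd_mat A" and B: "pd_mat B"
  shows "real CARD('n) + ln (det A) + ln (det B) \<le> trace (A ** B)"
proof -
  obtain S where S: "pd_mat S" "S ** S = A" using pd_mat_sqrt[OF A] by blast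
  have "trace (A ** B) = trace (S ** B ** S)"
    unfolding S(2)[symmetric] by (metis matrix_mul_assoc trace_mul_sym)
  moreover have "det (S ** B ** S) = det A * det B"
    by (simp add: S(2)[symmetric] det_mul)
  ultimately show ?thesis
    using trace_ge_ln_det[OF pd_mat_sandwich[OF B S(1)]] pd_mat_det_pos[OF A] pd_mat_det_pos[OF B]
    by (simp add: ln_mult)
qed


section \<open>Matrix estimates for one step\<close>

lemma trace_mono:
  assumes "psd_mat A" "psd_mat (C - B)"
  shows "trace (A ** B) \<le> trace (A ** C)"
  using psd_mat_trace_mult_nonneg[OF assms] by (simp add: matrix_diff_ldistrib trace_sub)

lemma pd_mat_id: "pd_mat (mat 1)"
  by (simp add: pd_mat_def sym_mat_def)

text \<open>The perturbation \<open>M + d \<Sigma>\<^sup>-\<^sup>1\<close> makes the possibly singular \<open>M \<Sigma> M\<close> invertible.\<close>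

lemma sandwich_perturbation:
  fixes M \<Sigma> :: "real^'n^'n"
  assumes M: "psd_mat M" and \<Sigma>: "pd_mat \<Sigma>" and d: "0 < d"
  defines "N \<equiv> M + d *\<^sub>R matrix_inv \<Sigma>"
  shows "pd_mat N" "pd_mat (N ** \<Sigma> ** N)" "psd_mat (N ** \<Sigma> ** N - M ** \<Sigma> ** M)"
proof -
  show N: "pd_mat N"
    using psd_pd_mat_add[OF M pd_mat_inverse(1)[OF \<Sigma>] d] by (simp add: N_def)
  show "pd_mat (N ** \<Sigma> ** N)" using \<Sigma> N by (rule pd_mat_sandwich)
  \<comment> \<open>Perturbing by a multiple of \<open>matrix_inv \<Sigma>\<close> instead of the
    identity cancels \<Sigma> in the cross terms, which become multiples of \<open>M\<close> and
    hence positive semidefinite.\<close>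
  have "N ** \<Sigma> ** N - M ** \<Sigma> ** M = d *\<^sub>R M + (d *\<^sub>R M + (d * d) *\<^sub>R matrix_inv \<Sigma>)"
    using \<Sigma> by (simp add: N_def matrix_ring_simps pd_mat_inverse_cancel pd_mat_inverse scaleR_right_distrib)
  moreover have "psd_mat (d *\<^sub>R M + (d *\<^sub>R M + (d * d) *\<^sub>R matrix_inv \<Sigma>))"
    using d M \<Sigma> by (intro psd_mat_add psd_mat_scaleR pd_mat_psd[OF pd_mat_inverse(1)]) auto
  ultimately show "psd_mat (N ** \<Sigma> ** N - M ** \<Sigma> ** M)" by simp
qed

text \<open>If \<open>G\<close> and \<open>M\<close> were invertible, J = G^-1 M would push \<Sigma>
  to \<Sigma>' with M \<Sigma> J^T = G \<Sigma>', giving equality at d = 0. In general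
  \<open>J\<close> is built from the perturbed \<open>N\<close> and the transport from N \<Sigma> N
  to \<Sigma>'; the price is of order \<open>d\<close> with a factor depending only on \<Sigma> and
  \<Sigma>'.\<close>

lemma forward_coupling_exists:
  fixes M \<Sigma> \<Sigma>' G :: "real^'n^'n"
  assumes M: "psd_mat M" and \<Sigma>: "pd_mat \<Sigma>" and \<Sigma>': "pd_mat \<Sigma>'" and G: "psd_mat G"
    and eq: "G ** \<Sigma>' ** G = M ** \<Sigma> ** M" and d: "0 < d"
  obtains J where "J ** \<Sigma> ** transpose J = \<Sigma>'"
    "2 * trace (G ** \<Sigma>') - d * (trace \<Sigma>' + trace (matrix_inv \<Sigma>)) \<le> 2 * trace (M ** \<Sigma> ** transpose J)"
proof -
  define N where "N = M + d *\<^sub>R matrix_inv \<Sigma>"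
  define H where "H = N ** \<Sigma> ** N"
  have N: "pd_mat N" and H: "pd_mat H" and HM: "psd_mat (H - M ** \<Sigma> ** M)"
    unfolding N_def H_def using sandwich_perturbation[OF M \<Sigma> d] by auto
  obtain T where T: "pd_mat T" "T ** H ** T = \<Sigma>'"
    using pd_mat_transport_exists[OF H \<Sigma>'] by blast
  define J where "J = T ** N"
  have JT: "transpose J = N ** T"
    using T N by (simp add: J_def matrix_transpose_mul pd_mat_sym)
  have J: "J ** \<Sigma> ** transpose J = \<Sigma>'"
    unfolding JT T(2)[symmetric] by (simp add: J_def H_def matrix_mul_assoc)
  \<comment> \<open>\<open>G\<close> maps \<Sigma>' to M \<Sigma> M, so Young's inequality with
    \<open>matrix_inv T\<close> bounds its cross term. Since M \<Sigma> M lies below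
    \<open>H\<close>, the bound is at most the value attained by the coupling \<open>T\<close> of
    \<open>H\<close> and \<Sigma>'.\<close>
  have "2 * trace (G ** \<Sigma>') \<le> trace (matrix_inv T ** \<Sigma>') + trace (T ** (M ** \<Sigma> ** M))"
    using trace_young[OF pd_mat_inverse(1)[OF T(1)] pd_mat_psd[OF \<Sigma>'], of G "mat 1"]
      matrix_inv_eqI[OF pd_mat_inverse(3)[OF T(1)]] G eq by (simp add: psd_mat_sym)
  also have "trace (T ** (M ** \<Sigma> ** M)) \<le> trace (T ** H)"
    using T HM by (intro trace_mono) (auto intro: pd_mat_psd)
  also have "matrix_inv T ** \<Sigma>' = H ** T"
    using T(1) by (simp add: T(2)[symmetric] matrix_mul_assoc[symmetric] pd_mat_inverse_cancel)
  also have "trace (H ** T) = trace (N ** \<Sigma> ** transpose J)"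
    by (simp add: H_def JT matrix_mul_assoc)
  also have "trace (T ** H) = trace (N ** \<Sigma> ** transpose J)"
    unfolding JT H_def by (metis matrix_mul_assoc trace_mul_sym)
  also have "N ** \<Sigma> ** transpose J = M ** \<Sigma> ** transpose J + d *\<^sub>R transpose J"
    using \<Sigma> by (simp add: N_def matrix_ring_simps pd_mat_inverse_cancel)
  finally have 1: "2 * trace (G ** \<Sigma>') \<le> 2 * trace (M ** \<Sigma> ** transpose J) + d * (2 * trace J)"
    by (simp add: trace_add trace_scaleR trace_transpose)
  \<comment> \<open>\<open>J\<close> depends on \<open>d\<close>, so its trace needs a bound uniform
    in \<open>d\<close>: Young's inequality with A = 1 gives one from J \<Sigma> J^T =
    \<Sigma>'.\<close>
  have "2 * trace (J ** \<Sigma> ** transpose (matrix_inv \<Sigma>)) \<le>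
      trace (matrix_inv \<Sigma> ** \<Sigma> ** transpose (matrix_inv \<Sigma>)) + trace (J ** \<Sigma> ** transpose J)"
    using trace_young[OF pd_mat_id pd_mat_psd[OF \<Sigma>], of J "matrix_inv \<Sigma>"]
      matrix_inv_eqI[of "mat 1 :: real^'n^'n" "mat 1"] by simp
  then have "2 * trace J \<le> trace (matrix_inv \<Sigma>) + trace \<Sigma>'"
    unfolding J using \<Sigma> pd_mat_sym[OF pd_mat_inverse(1)[OF \<Sigma>]]
    by (simp add: matrix_mul_assoc[symmetric] pd_mat_inverse)
  then have "d * (2 * trace J) \<le> d * (trace \<Sigma>' + trace (matrix_inv \<Sigma>))"
    using d by (intro mult_left_mono) auto
  with 1 have "2 * trace (G ** \<Sigma>') - d * (trace \<Sigma>' + trace (matrix_inv \<Sigma>)) \<le> 2 * trace (M ** \<Sigma> ** transpose J)"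
    by linarith
  with J show thesis by (rule that)
qed

text \<open>The map \<open>R ** N\<close> carries \<Sigma>' to \<Sigma>h through a nearby
  nonsingular intermediate covariance \<open>H\<close>. Comparing it with the transports
  \<open>T\<close> and \<open>T'\<close> leaves the single term (\<eta> - e) tr (R N), and the
  log-determinant bound for this trace is the entropy difference.\<close>

lemma backward_step_entropy:
  fixes M \<Sigma> \<Sigma>' \<Sigma>h G T T' :: "real^'n^'n"
  assumes M: "sym_mat M" and \<Sigma>: "pd_mat \<Sigma>" and \<Sigma>': "pd_mat \<Sigma>'" and \<Sigma>h: "pd_mat \<Sigma>h"
    and G: "psd_mat G" and Gdef: "G = mat 1 - \<eta> *\<^sub>R matrix_inv \<Sigma>'"
    and eq: "G ** \<Sigma>' ** G = M ** \<Sigma> ** M" and \<eta>: "0 < \<eta>"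
    and T: "pd_mat T" "T ** \<Sigma> ** T = \<Sigma>h" and T': "pd_mat T'" "T' ** \<Sigma>' ** T' = \<Sigma>h"
  shows "\<eta> * (ln (det \<Sigma>h) - ln (det \<Sigma>'))
    \<le> 2 * trace (T' ** \<Sigma>') - 2 * trace (M ** \<Sigma> ** T) - 2 * \<eta> * real CARD('n)"
proof -
  \<comment> \<open>For every perturbation below, \<open>c\<close> equals 2 (n + ln det R + ln det
    N), because \<open>R ** N\<close> maps \<Sigma>' to \<Sigma>h; it is therefore independent of
    \<open>e\<close>.\<close>
  define c where "c = 2 * real CARD('n) + (ln (det \<Sigma>h) - ln (det \<Sigma>'))"
  have step: "(\<eta> - e) * c \<le> 2 * trace (T' ** \<Sigma>') - 2 * trace (M ** \<Sigma> ** T)"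
    if e: "0 < e" "e < \<eta>" for e
  proof -
    define N where "N = G + e *\<^sub>R matrix_inv \<Sigma>'"
    define H where "H = N ** \<Sigma>' ** N"
    have N: "pd_mat N" and H: "pd_mat H" and HG: "psd_mat (H - G ** \<Sigma>' ** G)"
      unfolding N_def H_def using sandwich_perturbation[OF G \<Sigma>' e(1)] by auto
    obtain R where R: "pd_mat R" "R ** H ** R = \<Sigma>h"
      using pd_mat_transport_exists[OF H \<Sigma>h] by blast
    \<comment> \<open>The pair (M z, T z), with z of covariance \<Sigma>, couples M \<Sigma> M with
      \<Sigma>h. Young's inequality with \<open>R\<close>, together with M \<Sigma> M below
      \<open>H\<close>, bounds its correlation by the one that \<open>R\<close> achieves between
      \<open>H\<close> and \<Sigma>h.\<close>
    have "2 * trace (T ** \<Sigma> ** M) \<le> trace (R ** (M ** \<Sigma> ** M)) + trace (matrix_inv R ** \<Sigma>h)"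
      using trace_young[OF R(1) pd_mat_psd[OF \<Sigma>], of T M] M T by (simp add: sym_mat_def pd_mat_sym)
    also have "trace (R ** (M ** \<Sigma> ** M)) \<le> trace (R ** H)"
      using R HG eq by (intro trace_mono) (auto intro: pd_mat_psd)
    also have "matrix_inv R ** \<Sigma>h = H ** R"
      using R(1) by (simp add: R(2)[symmetric] matrix_mul_assoc[symmetric] pd_mat_inverse_cancel)
    also have "trace (H ** R) = trace (R ** H)" by (rule trace_mul_sym)
    also have "trace (T ** \<Sigma> ** M) = trace (M ** \<Sigma> ** T)"
      using M T \<Sigma>
      by (subst trace_transpose[symmetric])
        (simp add: matrix_transpose_mul pd_mat_sym sym_mat_def matrix_mul_assoc)
    finally have 1: "trace (M ** \<Sigma> ** T) \<le> trace (R ** H)" by simp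
    have "transpose (R ** N) = N ** R" using R N by (simp add: matrix_transpose_mul pd_mat_sym)
    then have RN: "R ** N ** \<Sigma>' ** transpose (R ** N) = \<Sigma>h"
      by (simp add: R(2)[symmetric] H_def matrix_mul_assoc)
    \<comment> \<open>\<open>R ** N\<close> is in general not symmetric, so it is one coupling among
      others of \<Sigma>' and \<Sigma>h; \<open>T'\<close> has the largest correlation.\<close>
    have "2 * trace (R ** N ** \<Sigma>') \<le> trace (T' ** \<Sigma>') + trace (matrix_inv T' ** \<Sigma>h)"
      using trace_young[OF T'(1) pd_mat_psd[OF \<Sigma>'], of "R ** N" "mat 1"] unfolding RN by simp
    also have "matrix_inv T' ** \<Sigma>h = \<Sigma>' ** T'"
      using T'(1) by (simp add: T'(2)[symmetric] matrix_mul_assoc[symmetric] pd_mat_inverse_cancel)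
    also have "trace (\<Sigma>' ** T') = trace (T' ** \<Sigma>')" by (rule trace_mul_sym)
    finally have 2: "trace (R ** N ** \<Sigma>') \<le> trace (T' ** \<Sigma>')" by simp
    have "N = mat 1 - (\<eta> - e) *\<^sub>R matrix_inv \<Sigma>'"
      by (simp add: N_def Gdef algebra_simps)
    then have "\<Sigma>' ** N = \<Sigma>' - (\<eta> - e) *\<^sub>R mat 1"
      using \<Sigma>' by (simp add: matrix_ring_simps pd_mat_inverse)
    then have "R ** H = R ** N ** \<Sigma>' - (\<eta> - e) *\<^sub>R (R ** N)"
      by (simp add: H_def matrix_ring_simps)
    then have 3: "trace (R ** H) = trace (R ** N ** \<Sigma>') - (\<eta> - e) * trace (R ** N)"
      by (simp add: trace_sub trace_scaleR)
    have "det \<Sigma>h = det R * det N * det \<Sigma>' * (det R * det N)"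
      by (subst RN[symmetric]) (simp add: det_mul matrix_transpose_mul)
    moreover have pos: "0 < det R" "0 < det N" "0 < det \<Sigma>'"
      using R N \<Sigma>' by (auto intro: pd_mat_det_pos)
    ultimately have "ln (det \<Sigma>h) = 2 * (ln (det R) + ln (det N)) + ln (det \<Sigma>')"
      by (simp add: ln_mult)
    then have "c \<le> 2 * trace (R ** N)"
      using trace_mult_ge_ln_det[OF R(1) N] by (simp add: c_def)
    then have "(\<eta> - e) * c \<le> (\<eta> - e) * (2 * trace (R ** N))"
      using e by (intro mult_left_mono) auto
    with 1 2 3 show ?thesis by simp
  qed
  \<comment> \<open>The right-hand side of \<open>step\<close> does not involve \<open>e\<close>, so
    the limit e \<rightarrow> 0 from the right restores the full step size.\<close>
  have "((\<lambda>e. (\<eta> - e) * c) \<longlongrightarrow> (\<eta> - 0) * c) (at_right 0)"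
    by (intro tendsto_intros)
  moreover have "eventually (\<lambda>e. (\<eta> - e) * c \<le> 2 * trace (T' ** \<Sigma>') - 2 * trace (M ** \<Sigma> ** T)) (at_right 0)"
    using eventually_at_right_less[of 0] eventually_at_rightI[of 0 \<eta> "\<lambda>e. e < \<eta>"] \<eta>
    by (auto elim!: eventually_mono intro!: step intro: eventually_conj simp: eventually_at_right_field)
  ultimately have "(\<eta> - 0) * c \<le> 2 * trace (T' ** \<Sigma>') - 2 * trace (M ** \<Sigma> ** T)"
    by (rule tendsto_upperbound) simp
  then show ?thesis by (simp add: c_def algebra_simps)
qed

text \<open>All matrices involved are diagonal in the eigenbasis of \<open>H\<close>, so the claims
  are scalar ones about its eigenvalues.\<close>

lemma backward_step_covariance:
  fixes H :: "real^'n^'n"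
  assumes H: "psd_mat H" and \<eta>: "0 < \<eta>"
  defines "\<Sigma> \<equiv> (1/2) *\<^sub>R (H + (2 * \<eta>) *\<^sub>R mat 1 + psd_sqrt (H ** (H + (4 * \<eta>) *\<^sub>R mat 1)))"
  defines "G \<equiv> mat 1 - \<eta> *\<^sub>R matrix_inv \<Sigma>"
  shows "pd_mat \<Sigma>" "psd_mat G" "G ** \<Sigma> ** G = H"
proof -
  obtain Q d where Q: "orthogonal_matrix Q" "H = conj_diag Q d" and d: "\<And>i. 0 \<le> d i"
    using psd_mat_spectral[OF H] by blast
  have one: "mat 1 = conj_diag Q (\<lambda>i. 1)" by (rule conj_diag_mat[OF Q(1)])
  define r where "r i = sqrt (d i * (d i + 4 * \<eta>))" for i
  \<comment> \<open>The larger root of (s - \<eta>)^2 = d s. Being at least \<eta>, it makes the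
    eigenvalue 1 - \<eta>/s of \<open>G\<close> nonnegative.\<close>
  define s where "s i = (d i + 2 * \<eta> + r i) / 2" for i
  have rr: "r i * r i = d i * (d i + 4 * \<eta>)" "0 \<le> r i" for i
    using d[of i] \<eta> by (auto simp: r_def)
  have "psd_sqrt (H ** (H + (4 * \<eta>) *\<^sub>R mat 1)) = conj_diag Q r"
    using Q(1) rr
    by (intro psd_sqrt_eqI) (simp_all add: Q(2) one conj_diag_add conj_diag_scaleR conj_diag_mult conj_diag_psd_iff)
  then have \<Sigma>: "\<Sigma> = conj_diag Q s"
    by (simp add: \<Sigma>_def Q(2) one conj_diag_add conj_diag_scaleR s_def[abs_def] add_divide_distrib)
  have s: "\<eta> \<le> s i" "0 < s i" for i
    using rr(2)[of i] d[of i] \<eta> by (auto simp: s_def)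
  show "pd_mat \<Sigma>" unfolding \<Sigma> conj_diag_pd_iff[OF Q(1)] using s by blast
  have "s i * inverse (s i) = 1" for i using s(2)[of i] by simp
  then have "\<Sigma> ** conj_diag Q (\<lambda>i. inverse (s i)) = mat 1"
    unfolding \<Sigma> one by (simp add: conj_diag_mult Q(1))
  then have "matrix_inv \<Sigma> = conj_diag Q (\<lambda>i. inverse (s i))" by (rule matrix_inv_eqI)
  then have G: "G = conj_diag Q (\<lambda>i. 1 - \<eta> * inverse (s i))"
    by (simp add: G_def one conj_diag_scaleR conj_diag_diff)
  have "0 \<le> 1 - \<eta> * inverse (s i)" for i using s[of i] by (simp add: field_simps)
  then show "psd_mat G" unfolding G conj_diag_psd_iff[OF Q(1)] by blast
  have "(1 - \<eta> * inverse (s i)) * s i * (1 - \<eta> * inverse (s i)) = d i" for i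
  proof -
    have "(s i - \<eta>) * (s i - \<eta>) = d i * s i"
      using rr(1)[of i] unfolding s_def by (simp add: algebra_simps)
    moreover have "(1 - \<eta> * inverse (s i)) * s i = s i - \<eta>"
      using s(2)[of i] by (simp add: field_simps)
    moreover have "1 - \<eta> * inverse (s i) = (s i - \<eta>) / s i"
      using s(2)[of i] by (simp add: field_simps)
    ultimately show ?thesis using s(2)[of i] by simp
  qed
  then show "G ** \<Sigma> ** G = H" unfolding G \<Sigma> Q(2) by (simp add: conj_diag_mult Q(1))
qed


section \<open>Gaussian measures as affine images\<close>

lemma borel_measurable_matrix_vector [measurable (raw)]:
  fixes A :: "real^'n^'m"
  assumes "f \<in> borel_measurable M"
  shows "(\<lambda>x. A *v f x) \<in> borel_measurable M"
proof -
  have "(*v) A \<in> borel_measurable borel"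
    by (intro borel_measurable_continuous_onI linear_continuous_on matrix_vector_mul_bounded_linear)
  then show ?thesis using assms by measurable
qed

section \<open>Change of variables for invertible affine maps\<close>

lemma nn_integral_lborel_translate:
  fixes f :: "'a::euclidean_space \<Rightarrow> ennreal"
  assumes [measurable]: "f \<in> borel_measurable borel"
  shows "(\<integral>\<^sup>+x. f (a + x) \<partial>lborel) = (\<integral>\<^sup>+x. f x \<partial>lborel)"
    and "(\<integral>\<^sup>+x. f (a - x) \<partial>lborel) = (\<integral>\<^sup>+x. f x \<partial>lborel)"
proof -
  show "(\<integral>\<^sup>+x. f (a + x) \<partial>lborel) = (\<integral>\<^sup>+x. f x \<partial>lborel)"
    by (subst (2) lborel_affine[of 1 a])
      (simp_all add: nn_integral_density nn_integral_distr)
  show "(\<integral>\<^sup>+x. f (a - x) \<partial>lborel) = (\<integral>\<^sup>+x. f x \<partial>lborel)"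
    by (subst (2) lborel_affine[of "-1" a])
      (simp_all add: nn_integral_density nn_integral_distr)
qed

text \<open>Uniqueness of the translation-invariant measure, in integral form: the integral
  \<open>\<integral>\<integral> f(x + U y) g(U y) dx dy\<close> is evaluated in two ways.\<close>

lemma nn_integral_linear_image_ratio:
  fixes U W :: "real^'n^'n" and f g :: "real^'n \<Rightarrow> ennreal"
  assumes UW: "U ** W = mat 1"
    and f [measurable]: "f \<in> borel_measurable borel" and g [measurable]: "g \<in> borel_measurable borel"
  shows "(\<integral>\<^sup>+x. f x \<partial>lborel) * (\<integral>\<^sup>+y. g (U *v y) \<partial>lborel)
    = (\<integral>\<^sup>+y. f (U *v y) \<partial>lborel) * (\<integral>\<^sup>+x. g x \<partial>lborel)"
proof -
  have "(\<integral>\<^sup>+x. f x \<partial>lborel) * (\<integral>\<^sup>+y. g (U *v y) \<partial>lborel)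
      = (\<integral>\<^sup>+y. (\<integral>\<^sup>+x. f x \<partial>lborel) * g (U *v y) \<partial>lborel)"
    by (simp add: nn_integral_cmult)
  also have "\<dots> = (\<integral>\<^sup>+y. (\<integral>\<^sup>+x. f (U *v y + x) \<partial>lborel) * g (U *v y) \<partial>lborel)"
    by (simp add: nn_integral_lborel_translate)
  also have "\<dots> = (\<integral>\<^sup>+y. (\<integral>\<^sup>+x. f (U *v y + x) * g (U *v y) \<partial>lborel) \<partial>lborel)"
    by (simp add: nn_integral_multc)
  also have "\<dots> = (\<integral>\<^sup>+x. (\<integral>\<^sup>+y. f (U *v y + x) * g (U *v y) \<partial>lborel) \<partial>lborel)"
    by (rule lborel_pair.Fubini') measurable
  also have "\<dots> = (\<integral>\<^sup>+x. (\<integral>\<^sup>+y. f (U *v y) * g (U *v y - x) \<partial>lborel) \<partial>lborel)"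
  proof (rule nn_integral_cong)
    fix x
    \<comment> \<open>Translating \<open>y\<close> by - W x turns U y into U y - x, which moves the
      variable \<open>x\<close> from \<open>f\<close> to \<open>g\<close>.\<close>
    have "U *v (- (W *v x)) = - x"
      using UW by (metis matrix_vector_mul_assoc matrix_vector_mul_lid mult_minus_right
          matrix_vector_mult_diff_distrib matrix_vector_mult_0_right diff_0)
    then have "U *v (- (W *v x) + y) = U *v y - x" for y
      by (simp only: matrix_vector_right_distrib) simp
    then show "(\<integral>\<^sup>+y. f (U *v y + x) * g (U *v y) \<partial>lborel) = (\<integral>\<^sup>+y. f (U *v y) * g (U *v y - x) \<partial>lborel)"
      using nn_integral_lborel_translate(1)[of "\<lambda>y. f (U *v y + x) * g (U *v y)" "- (W *v x)"]
      by simp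
  qed
  also have "\<dots> = (\<integral>\<^sup>+y. (\<integral>\<^sup>+x. f (U *v y) * g (U *v y - x) \<partial>lborel) \<partial>lborel)"
    by (rule lborel_pair.Fubini'[symmetric]) measurable
  also have "\<dots> = (\<integral>\<^sup>+y. f (U *v y) * (\<integral>\<^sup>+x. g x \<partial>lborel) \<partial>lborel)"
    by (simp add: nn_integral_cmult nn_integral_lborel_translate)
  also have "\<dots> = (\<integral>\<^sup>+y. f (U *v y) \<partial>lborel) * (\<integral>\<^sup>+x. g x \<partial>lborel)"
    by (simp add: nn_integral_multc)
  finally show ?thesis .
qed

lemma orthogonal_matrix_norm:
  assumes "orthogonal_matrix U"
  shows "norm (U *v x) = norm (x :: real^'n)"
proof -
  have "(U *v x) \<bullet> (U *v x) = (transpose U *v (U *v x)) \<bullet> x"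
    by (rule inner_matrix_transpose)
  also have "\<dots> = x \<bullet> x"
    using assms by (simp only: matrix_vector_mul_assoc orthogonal_matrix matrix_vector_mul_lid)
  finally show ?thesis by (simp add: norm_eq_sqrt_inner)
qed

text \<open>In \<open>nn_integral_linear_image_ratio\<close> the function \<open>g\<close> is the
  indicator of the unit ball: it is rotation invariant and its integral is positive and finite, so
  it can be cancelled.\<close>

lemma nn_integral_orthogonal_image:
  fixes U :: "real^'n^'n"
  assumes U: "orthogonal_matrix U" and f: "f \<in> borel_measurable borel"
  shows "(\<integral>\<^sup>+x. f (U *v x) \<partial>lborel) = (\<integral>\<^sup>+x. f x \<partial>lborel)"
proof -
  let ?g = "indicator (ball 0 1) :: real^'n \<Rightarrow> ennreal" and ?b = "emeasure lborel (ball (0 :: real^'n) 1)"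
  have g: "?g (U *v y) = ?g y" for y
    using U by (simp add: indicator_def orthogonal_matrix_norm)
  have "U ** transpose U = mat 1" using U by (simp add: orthogonal_matrix_def)
  moreover have "?g \<in> borel_measurable borel"
    by (rule borel_measurable_indicator) simp
  ultimately have "(\<integral>\<^sup>+x. f x \<partial>lborel) * (\<integral>\<^sup>+y. ?g (U *v y) \<partial>lborel)
      = (\<integral>\<^sup>+y. f (U *v y) \<partial>lborel) * (\<integral>\<^sup>+x. ?g x \<partial>lborel)"
    using f by (intro nn_integral_linear_image_ratio)
  then
  have "(\<integral>\<^sup>+x. f x \<partial>lborel) * ?b = (\<integral>\<^sup>+x. f (U *v x) \<partial>lborel) * ?b"
    unfolding g by simp
  moreover have "?b \<noteq> 0"
    using content_ball_pos[of 1 "0 :: real^'n"] by (auto simp: measure_def)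
  moreover have "?b \<noteq> \<top>"
    using emeasure_lborel_ball_finite[of "0 :: real^'n" 1] by simp
  ultimately show ?thesis
    by (metis ennreal_mult_cancel_left mult.commute)
qed

lemma nn_integral_diag_image:
  fixes s :: "'n::finite \<Rightarrow> real"
  assumes s: "\<And>i. s i \<noteq> 0" and [measurable]: "f \<in> borel_measurable borel"
  shows "(\<integral>\<^sup>+x. f x \<partial>lborel) = ennreal \<bar>\<Prod>i\<in>UNIV. s i\<bar> * (\<integral>\<^sup>+x. f (diag_mat s *v x) \<partial>lborel)"
proof -
  \<comment> \<open>The affine rule for \<open>lborel\<close> wants scaling factors indexed by basis
    vectors; the inner product with the vector of all \<open>s i\<close> recovers \<open>s i\<close>
    at the i-th axis.\<close>
  define c where "c = (\<lambda>b :: real^'n. b \<bullet> (\<chi> i. s i))"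
  have c: "c (axis i 1) = s i" for i by (simp add: c_def inner_axis')
  have inj: "inj (\<lambda>i::'n. axis i (1::real))" by (auto simp: inj_on_def axis_eq_axis)
  have Basis: "(Basis :: (real^'n) set) = (\<lambda>i. axis i 1) ` UNIV" by (auto simp: Basis_vec_def)
  have T: "(\<Sum>j\<in>Basis. (c j * (x \<bullet> j)) *\<^sub>R j) = diag_mat s *v x" for x
  proof -
    have "(\<Sum>j\<in>Basis. (c j * (x \<bullet> j)) *\<^sub>R j) = (\<Sum>i\<in>UNIV. (s i * x $ i) *\<^sub>R axis i 1)"
      unfolding Basis by (subst sum.reindex[OF inj]) (simp add: c inner_axis)
    then show ?thesis
      by (simp add: vec_eq_iff diag_mat_vector axis_def if_distrib[of "\<lambda>x. _ * x"] cong: if_cong)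
  qed
  have P: "(\<Prod>j\<in>Basis. \<bar>c j\<bar>) = \<bar>\<Prod>i\<in>UNIV. s i\<bar>"
    unfolding Basis by (simp add: prod.reindex[OF inj] c abs_prod)
  have "c j \<noteq> 0" if "j \<in> Basis" for j
    using that s unfolding Basis by (auto simp: c)
  from lborel_affine_euclidean[of c 0, OF this]
  have "lborel = density (distr lborel borel (\<lambda>x. diag_mat s *v x)) (\<lambda>_. ennreal \<bar>\<Prod>i\<in>UNIV. s i\<bar>)"
    by (simp add: T P)
  then have "(\<integral>\<^sup>+x. f x \<partial>lborel) = (\<integral>\<^sup>+x. f x \<partial>density (distr lborel borel (\<lambda>x. diag_mat s *v x)) (\<lambda>_. ennreal \<bar>\<Prod>i\<in>UNIV. s i\<bar>))"
    by (rule arg_cong)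
  also have "\<dots> = ennreal \<bar>\<Prod>i\<in>UNIV. s i\<bar> * (\<integral>\<^sup>+x. f (diag_mat s *v x) \<partial>lborel)"
    by (simp add: nn_integral_density nn_integral_distr nn_integral_cmult)
  finally show ?thesis .
qed

text \<open>Diagonalising C C^T gives \<open>Q\<close> and the squared singular values; W = s^-1 Q^T
  C is then orthogonal. This reduces the change of variables for \<open>C\<close> to rotations and a
  coordinate scaling.\<close>

lemma invertible_singular_value_decomposition:
  fixes C B :: "real^'n^'n"
  assumes CB: "C ** B = mat 1"
  obtains Q s W where "orthogonal_matrix Q" "orthogonal_matrix W" "\<And>i. 0 < s i"
    "C = Q ** diag_mat s ** W"
proof -
  have BC: "B ** C = mat 1" using CB matrix_left_right_inverse by blast
  have "transpose B ** transpose C = mat 1"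
    using CB by (metis matrix_transpose_mul transpose_mat)
  then have "pd_mat (C ** mat 1 ** transpose C)"
    by (intro pd_mat_congruence) (simp_all add: pd_mat_def sym_mat_def)
  then obtain Q d where Q: "orthogonal_matrix Q" "C ** transpose C = conj_diag Q d" and d: "\<And>i. 0 < d i"
    using pd_mat_spectral by (metis matrix_mul_rid)
  define s where "s i = sqrt (d i)" for i
  have s: "0 < s i" "s i * s i = d i" for i using d[of i] by (auto simp: s_def)
  define I where "I = diag_mat (\<lambda>i. inverse (s i))"
  have one: "diag_mat (\<lambda>i. 1) = mat 1" by (simp add: diag_mat_def mat_def vec_eq_iff)
  have "s i * inverse (s i) = 1" "inverse (s i) * d i * inverse (s i) = 1" for i
    using s(1)[of i] by (simp_all add: s(2)[symmetric] field_simps)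
  then have I: "diag_mat s ** I = mat 1" "I ** diag_mat d ** I = mat 1"
    by (simp_all add: I_def diag_mat_mult one)
  have IT: "transpose I = I" by (auto simp: I_def diag_mat_def transpose_def vec_eq_iff)
  define W where "W = I ** transpose Q ** C"
  have QQ: "transpose Q ** Q = mat 1" "Q ** transpose Q = mat 1" using Q by (auto simp: orthogonal_matrix_def)
  have "W ** transpose W = I ** (transpose Q ** (C ** transpose C) ** Q) ** I"
    by (simp add: W_def matrix_transpose_mul IT matrix_mul_assoc)
  also have "transpose Q ** (C ** transpose C) ** Q = (transpose Q ** Q) ** diag_mat d ** (transpose Q ** Q)"
    unfolding Q(2) conj_diag_def by (simp only: matrix_mul_assoc)
  finally have "W ** transpose W = mat 1" by (simp add: QQ I)
  then have W: "orthogonal_matrix W"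
    by (simp add: orthogonal_matrix_def) (simp add: matrix_left_right_inverse)
  have "Q ** diag_mat s ** W = Q ** (diag_mat s ** I) ** transpose Q ** C"
    by (simp add: W_def matrix_mul_assoc)
  then have "Q ** diag_mat s ** W = C" by (simp add: I QQ)
  then show thesis using that[of Q W s] Q W s by simp
qed

lemma nn_integral_affine_image:
  fixes C B :: "real^'n^'n"
  assumes CB: "C ** B = mat 1" and f [measurable]: "f \<in> borel_measurable borel"
  shows "(\<integral>\<^sup>+x. f x \<partial>lborel) = ennreal \<bar>det C\<bar> * (\<integral>\<^sup>+x. f (m + C *v x) \<partial>lborel)"
proof -
  obtain Q s W where Q: "orthogonal_matrix Q" and W: "orthogonal_matrix W" and s: "\<And>i. 0 < s i"
    and C: "C = Q ** diag_mat s ** W"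
    using invertible_singular_value_decomposition[OF CB] by blast
  have "\<bar>det Q\<bar> = 1" "\<bar>det W\<bar> = 1"
    using det_orthogonal_matrix[OF Q] det_orthogonal_matrix[OF W] by auto
  moreover have "det (diag_mat s) = (\<Prod>i\<in>UNIV. s i)"
    by (subst det_diagonal) (auto simp: diag_mat_def)
  ultimately have det: "\<bar>det C\<bar> = \<bar>\<Prod>i\<in>UNIV. s i\<bar>"
    by (simp add: C det_mul abs_mult)
  have "(\<integral>\<^sup>+x. f x \<partial>lborel) = (\<integral>\<^sup>+x. f (m + x) \<partial>lborel)"
    by (simp add: nn_integral_lborel_translate)
  also have "\<dots> = (\<integral>\<^sup>+x. f (m + Q *v x) \<partial>lborel)"
    using nn_integral_orthogonal_image[OF Q, of "\<lambda>x. f (m + x)"] by simp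
  also have "\<dots> = ennreal \<bar>det C\<bar> * (\<integral>\<^sup>+x. f (m + Q *v (diag_mat s *v x)) \<partial>lborel)"
    unfolding det using s
    by (intro nn_integral_diag_image[where f = "\<lambda>x. f (m + Q *v x)"]) (auto simp: less_imp_neq[symmetric])
  also have "(\<integral>\<^sup>+x. f (m + Q *v (diag_mat s *v x)) \<partial>lborel) = (\<integral>\<^sup>+x. f (m + Q *v (diag_mat s *v (W *v x))) \<partial>lborel)"
    using nn_integral_orthogonal_image[OF W, of "\<lambda>x. f (m + Q *v (diag_mat s *v x))"] by simp
  finally show ?thesis by (simp add: C matrix_vector_mul_assoc matrix_mul_assoc)
qed

section \<open>Gaussians as images of the standard Gaussian\<close>

lemma borel_measurable_gauss_pdf [measurable]: "gauss_pdf m \<Sigma> \<in> borel_measurable borel"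
  unfolding gauss_pdf_def by measurable

lemma gauss_pdf_nonneg: "0 \<le> gauss_pdf m \<Sigma> x" if "0 \<le> det \<Sigma>"
  using that by (simp add: gauss_pdf_def)

abbreviation std_gaussian :: "(real^'n) measure" where
  "std_gaussian \<equiv> gaussian 0 (mat 1)"

lemma sets_gaussian [simp, measurable_cong]: "sets (gaussian m \<Sigma>) = sets borel"
  by (simp add: gaussian_def)

lemma space_gaussian [simp]: "space (gaussian m \<Sigma>) = UNIV"
  by (simp add: gaussian_def)

lemma matrix_inv_id: "matrix_inv (mat 1 :: real^'n^'n) = mat 1"
  by (rule matrix_inv_eqI) simp

lemma std_gauss_pdf:
  "gauss_pdf 0 (mat 1) (x :: real^'n) = exp (- (x \<bullet> x) / 2) / sqrt ((2 * pi) ^ CARD('n))"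
  by (simp add: gauss_pdf_def matrix_inv_id)

text \<open>\<open>C\<close> is an arbitrary invertible factor of the covariance rather than its
  symmetric root, because linear couplings produce non-symmetric factors such as
  \<open>J ** C\<close>.\<close>

lemma gaussian_eq_distr:
  fixes C B :: "real^'n^'n"
  assumes CB: "C ** B = mat 1"
  shows "gaussian m (C ** transpose C) = distr std_gaussian borel (\<lambda>z. m + C *v z)"
proof (rule measure_eqI)
  fix A assume "A \<in> sets (gaussian m (C ** transpose C))"
  then have [measurable]: "A \<in> sets borel" by simp
  have BC: "B ** C = mat 1" using CB matrix_left_right_inverse by blast
  have "det C \<noteq> 0" using CB by (metis det_I det_mul mult_zero_left zero_neq_one)
  have BCT: "transpose C ** transpose B = mat 1"
    using BC by (metis matrix_transpose_mul transpose_mat)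
  have "C ** transpose C ** (transpose B ** B) = C ** (transpose C ** transpose B) ** B"
    by (simp only: matrix_mul_assoc)
  then have inv: "matrix_inv (C ** transpose C) = transpose B ** B"
    by (intro matrix_inv_eqI) (simp add: BCT CB)
  have quad: "(C *v z) \<bullet> ((transpose B ** B) *v (C *v z)) = z \<bullet> z" for z
  proof -
    have "(C *v z) \<bullet> ((transpose B ** B) *v (C *v z)) = (B *v (C *v z)) \<bullet> (B *v (C *v z))"
      by (metis inner_matrix_transpose matrix_vector_mul_assoc transpose_transpose)
    then show ?thesis by (simp only: matrix_vector_mul_assoc BC matrix_vector_mul_lid)
  qed
  \<comment> \<open>The Jacobian cancels the normalisation, since the square root of det (C C^T) is
    |det C|.\<close>
  have pdf: "\<bar>det C\<bar> * gauss_pdf m (C ** transpose C) (m + C *v z) = gauss_pdf 0 (mat 1) z" for z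
    using \<open>det C \<noteq> 0\<close>
    unfolding std_gauss_pdf by (simp add: gauss_pdf_def inv quad det_mul real_sqrt_mult real_sqrt_abs2)
  have "emeasure (gaussian m (C ** transpose C)) A
      = (\<integral>\<^sup>+x. ennreal (gauss_pdf m (C ** transpose C) x) * indicator A x \<partial>lborel)"
    by (simp add: gaussian_def emeasure_density)
  also have "\<dots> = ennreal \<bar>det C\<bar> * (\<integral>\<^sup>+z. ennreal (gauss_pdf m (C ** transpose C) (m + C *v z)) * indicator A (m + C *v z) \<partial>lborel)"
    by (rule nn_integral_affine_image[OF CB]) measurable
  also have "\<dots> = (\<integral>\<^sup>+z. ennreal \<bar>det C\<bar> * (ennreal (gauss_pdf m (C ** transpose C) (m + C *v z)) * indicator A (m + C *v z)) \<partial>lborel)"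
    by (rule nn_integral_cmult[symmetric]) measurable
  also have "\<dots> = (\<integral>\<^sup>+z. ennreal (gauss_pdf 0 (mat 1) z) * indicator A (m + C *v z) \<partial>lborel)"
    by (simp only: pdf mult.assoc[symmetric] ennreal_mult'[symmetric] abs_ge_zero)
  also have "\<dots> = (\<integral>\<^sup>+z. ennreal (gauss_pdf 0 (mat 1) z) * indicator ((\<lambda>z. m + C *v z) -` A) z \<partial>lborel)"
    by (intro nn_integral_cong) (simp add: indicator_def)
  also have "\<dots> = emeasure (distr std_gaussian borel (\<lambda>z. m + C *v z)) A"
    by (subst emeasure_distr) (simp_all add: gaussian_def emeasure_density measurable_sets_borel[of "\<lambda>z. m + C *v z" borel])
  finally show "emeasure (gaussian m (C ** transpose C)) A = emeasure (distr std_gaussian borel (\<lambda>z. m + C *v z)) A" .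
qed simp

text \<open>The density factors into one-dimensional standard normal densities, and the integral of
  the product splits.\<close>

lemma prob_space_std_gaussian: "prob_space (std_gaussian :: (real^'n) measure)"
proof
  have inj: "inj (\<lambda>i::'n. axis i (1::real))" by (auto simp: inj_on_def axis_eq_axis)
  have Basis: "(Basis :: (real^'n) set) = (\<lambda>i. axis i 1) ` UNIV" by (auto simp: Basis_vec_def)
  have "gauss_pdf 0 (mat 1) x = (\<Prod>b\<in>Basis. std_normal_density (x \<bullet> b))" for x :: "real^'n"
  proof -
    have "(\<Prod>b\<in>Basis. std_normal_density (x \<bullet> b)) = (\<Prod>i\<in>UNIV. std_normal_density (x $ i))"
      unfolding Basis by (subst prod.reindex[OF inj]) (simp add: inner_axis)
    moreover have "x \<bullet> x = (\<Sum>i\<in>UNIV. (x $ i)\<^sup>2)"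
      by (simp add: inner_vec_def power2_eq_square)
    ultimately show ?thesis
      unfolding std_gauss_pdf real_sqrt_power
      by (simp add: std_normal_density_def prod_dividef exp_sum[symmetric] sum_negf sum_divide_distrib)
  qed
  then have "emeasure (std_gaussian :: (real^'n) measure) UNIV
      = (\<integral>\<^sup>+x. (\<Prod>b\<in>Basis. ennreal (std_normal_density (x \<bullet> b))) \<partial>(lborel :: (real^'n) measure))"
    by (simp add: gaussian_def emeasure_density prod_ennreal)
  also have "\<dots> = (\<Prod>b\<in>(Basis::(real^'n) set). \<integral>\<^sup>+x. ennreal (std_normal_density x) \<partial>lborel)"
    by (rule nn_integral_lborel_prod) auto
  also have "(\<integral>\<^sup>+x. ennreal (std_normal_density x) \<partial>lborel) = 1"
    using prob_space.emeasure_space_1[OF prob_space_normal_density[of 1 0]] by (simp add: emeasure_density)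
  finally show "emeasure (std_gaussian :: (real^'n) measure) (space std_gaussian) = 1" by simp
qed


section \<open>Stein identity for the standard Gaussian\<close>

lemma prob_space_gaussian:
  fixes \<Sigma> :: "real^'n^'n"
  assumes "pd_mat \<Sigma>"
  shows "prob_space (gaussian m \<Sigma>)"
proof -
  obtain S where S: "pd_mat S" "S ** S = \<Sigma>" using pd_mat_sqrt[OF assms] by blast
  have "gaussian m \<Sigma> = distr std_gaussian borel (\<lambda>z. m + S *v z)"
    using gaussian_eq_distr[OF pd_mat_inverse(2)[OF S(1)], of m] S by (simp add: pd_mat_sym)
  moreover have "prob_space (distr std_gaussian borel (\<lambda>z. m + S *v z))"
    by (intro prob_space.prob_space_distr prob_space_std_gaussian) measurable
  ultimately show ?thesis by simp
qed

section \<open>Integrability under Gaussian tails\<close>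

lemma integrable_std_gaussian_exp_quadratic:
  "integrable (std_gaussian :: (real^'n) measure) (\<lambda>x. exp ((norm x)\<^sup>2 / 4))"
proof -
  let ?D = "2 *\<^sub>R (mat 1 :: real^'n^'n)"
  define c where "c = sqrt ((2 * pi) ^ CARD('n) * det ?D) / sqrt ((2 * pi) ^ CARD('n))"
  have D: "pd_mat ?D"
    by (auto simp: pd_mat_def sym_mat_def transpose_scalar scaleR_matrix_vector_assoc[symmetric])
  have inv: "matrix_inv ?D = (1/2) *\<^sub>R mat 1"
    by (rule matrix_inv_eqI) (simp add: matrix_ring_simps)
  have pos: "0 < (2 * pi) ^ CARD('n) * det ?D" using pd_mat_det_pos[OF D] by simp
  \<comment> \<open>Half of the Gaussian exponent is used up; what remains is, up to a constant, the
    density of covariance 2 I.\<close>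
  have eq: "gauss_pdf 0 (mat 1) x * exp ((norm x)\<^sup>2 / 4) = c * gauss_pdf 0 ?D x" for x :: "real^'n"
  proof -
    have "exp (- (x \<bullet> x) / 2) * exp ((norm x)\<^sup>2 / 4) = exp (- (x \<bullet> x) / 4)"
      by (simp add: exp_add[symmetric] power2_norm_eq_inner)
    moreover have "gauss_pdf 0 ?D x = exp (- (x \<bullet> x) / 4) / sqrt ((2 * pi) ^ CARD('n) * det ?D)"
      by (simp add: gauss_pdf_def inv scaleR_matrix_vector_assoc[symmetric])
    ultimately show ?thesis
      using pos pd_mat_det_pos[OF D] unfolding std_gauss_pdf c_def by (simp add: field_simps)
  qed
  interpret prob_space "gaussian 0 ?D" by (rule prob_space_gaussian[OF D])
  have nn: "0 \<le> gauss_pdf 0 ?D x" for x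
    using pd_mat_det_pos[OF D] by (intro gauss_pdf_nonneg) simp
  have "integrable (gaussian 0 ?D) (\<lambda>x. 1 :: real)" by simp
  then have "integrable lborel (gauss_pdf 0 ?D)"
    using nn by (simp add: gaussian_def integrable_density)
  then have "integrable lborel (\<lambda>x::real^'n. gauss_pdf 0 (mat 1) x *\<^sub>R exp ((norm x)\<^sup>2 / 4))"
    by (simp add: eq)
  then show ?thesis
    unfolding gaussian_def by (subst integrable_density) (auto intro!: gauss_pdf_nonneg)
qed

text \<open>The rate 3 is enough for the weighted functions in Stein's identity: two polynomial
  factors (1 + s)^2 cost exp (2 s), and the exponential weight costs a further exp s.\<close>

lemma integrable_std_gaussian_exp_growth:
  fixes f :: "real^'n \<Rightarrow> 'b::{banach, second_countable_topology}"
  assumes [measurable]: "f \<in> borel_measurable borel" and le: "\<And>x. norm (f x) \<le> K * exp (3 * norm x)"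
  shows "integrable std_gaussian f"
proof (rule Bochner_Integration.integrable_bound)
  show "integrable std_gaussian (\<lambda>x::real^'n. K * exp 9 * exp ((norm x)\<^sup>2 / 4))"
    by (intro integrable_mult_right integrable_std_gaussian_exp_quadratic)
  show "f \<in> borel_measurable std_gaussian" by measurable
  have "norm (f x) \<le> K * exp 9 * exp ((norm x)\<^sup>2 / 4)" for x
  proof -
    have "0 \<le> (norm x / 2 - 3)\<^sup>2" by simp
    then have "3 * norm x \<le> 9 + (norm x)\<^sup>2 / 4" by (simp add: power2_eq_square algebra_simps)
    then have "exp (3 * norm x) \<le> exp 9 * exp ((norm x)\<^sup>2 / 4)" by (simp flip: exp_add)
    moreover have "0 \<le> K * exp (3 * norm x)" using le[of x] norm_ge_zero order_trans by blast
    then have "0 \<le> K" by (simp add: zero_le_mult_iff)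
    ultimately have "K * exp (3 * norm x) \<le> K * exp 9 * exp ((norm x)\<^sup>2 / 4)"
      by (simp add: mult.assoc mult_left_mono)
    with le[of x] show ?thesis by linarith
  qed
  then show "AE x in std_gaussian. norm (f x) \<le> norm (K * exp 9 * exp ((norm x)\<^sup>2 / 4))"
    by (intro AE_I2) (metis abs_ge_self order_trans real_norm_def)
qed

lemma exp_growth_bounds:
  fixes s :: real
  assumes "0 \<le> s"
  shows "1 \<le> exp (3 * s)" "1 + s \<le> exp (3 * s)" "(1 + s)\<^sup>2 \<le> exp (3 * s)"
    "(1 + s)\<^sup>2 * exp (s + 1) \<le> exp 1 * exp (3 * s)"
proof -
  have 1: "1 + s \<le> exp s" by (rule exp_ge_add_one_self)
  have sq: "(1 + s)\<^sup>2 \<le> exp (2 * s)"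
    using power_mono[OF 1, of 2] assms by (simp add: exp_double)
  show "1 \<le> exp (3 * s)" using assms by simp
  have "exp s \<le> exp (3 * s)" using assms by simp
  with 1 show "1 + s \<le> exp (3 * s)" by linarith
  have "exp (2 * s) \<le> exp (3 * s)" using assms by simp
  with sq show "(1 + s)\<^sup>2 \<le> exp (3 * s)" by linarith
  have "(1 + s)\<^sup>2 * exp (s + 1) \<le> exp (2 * s) * exp (s + 1)"
    using sq by (intro mult_right_mono) auto
  also have "\<dots> = exp 1 * exp (3 * s)" by (simp flip: exp_add)
  finally show "(1 + s)\<^sup>2 * exp (s + 1) \<le> exp 1 * exp (3 * s)" .
qed

lemma integrable_std_gaussian_quadratic_growth:
  fixes f :: "real^'n \<Rightarrow> 'b::{banach, second_countable_topology}"
  assumes "f \<in> borel_measurable borel" and le: "\<And>x. norm (f x) \<le> K * (1 + norm x)\<^sup>2"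
  shows "integrable std_gaussian f"
proof (rule integrable_std_gaussian_exp_growth)
  have "0 \<le> K" using order_trans[OF norm_ge_zero le[of 0]] by simp
  then show "norm (f x) \<le> K * exp (3 * norm x)" for x
    using exp_growth_bounds(3)[of "norm x"] le[of x] by (meson mult_left_mono norm_ge_zero order_trans)
qed (use assms in simp)

text \<open>The Cameron-Martin formula, by expanding the square |x - a|^2 in the shifted
  density.\<close>

lemma std_gaussian_shift:
  fixes f :: "real^'n \<Rightarrow> real"
  assumes [measurable]: "f \<in> borel_measurable borel"
  shows "(\<integral>x. f (a + x) \<partial>std_gaussian) = (\<integral>x. f x * exp (a \<bullet> x - (a \<bullet> a) / 2) \<partial>std_gaussian)"
proof -
  have pdf: "gauss_pdf a (mat 1) x = gauss_pdf 0 (mat 1) x * exp (a \<bullet> x - (a \<bullet> a) / 2)" for x :: "real^'n"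
    unfolding std_gauss_pdf
    by (simp add: gauss_pdf_def matrix_inv_id exp_add[symmetric] exp_diff[symmetric] inner_diff_left inner_diff_right
        inner_commute diff_divide_distrib add_divide_distrib)
  have nn: "0 \<le> gauss_pdf a (mat 1) x" for a x :: "real^'n" by (rule gauss_pdf_nonneg) simp
  have "(\<integral>x. f (a + x) \<partial>std_gaussian) = (\<integral>x. f x \<partial>distr std_gaussian borel (\<lambda>z. a + mat 1 *v z))"
    by (subst integral_distr) simp_all
  also have "\<dots> = (\<integral>x. f x \<partial>gaussian a (mat 1))"
    using gaussian_eq_distr[of "mat 1" "mat 1" a] by simp
  also have "\<dots> = (\<integral>x. gauss_pdf a (mat 1) x *\<^sub>R f x \<partial>lborel)"
    unfolding gaussian_def using nn by (intro integral_density) auto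
  also have "\<dots> = (\<integral>x. gauss_pdf 0 (mat 1) x *\<^sub>R (f x * exp (a \<bullet> x - (a \<bullet> a) / 2)) \<partial>lborel)"
    by (simp add: pdf mult_ac)
  also have "\<dots> = (\<integral>x. f x * exp (a \<bullet> x - (a \<bullet> a) / 2) \<partial>std_gaussian)"
    unfolding gaussian_def using nn by (intro integral_density[symmetric]) auto
  finally show ?thesis .
qed

lemma abs_exp_minus_one_le: "\<bar>exp u - 1\<bar> \<le> \<bar>u\<bar> * exp \<bar>u\<bar>" for u :: real
proof (cases "0 \<le> u")
  case True
  have "1 - u \<le> exp (- u)" using exp_ge_add_one_self[of "- u"] by simp
  then have "(1 - u) * exp u \<le> exp (- u) * exp u" by (intro mult_right_mono) auto
  then have "exp u - 1 \<le> u * exp u" by (simp add: exp_minus algebra_simps)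
  then show ?thesis using True by simp
next
  case False
  have "1 - exp u \<le> - u" using exp_ge_add_one_self[of u] by linarith
  also have "\<dots> \<le> - u * exp (- u)" using False by (simp add: mult_le_cancel_left1)
  finally show ?thesis using False by simp
qed

lemma lipschitz_growth:
  fixes f :: "'a::real_normed_vector \<Rightarrow> 'b::real_normed_vector"
  assumes "\<And>x y. norm (f x - f y) \<le> L * norm (x - y)" "0 \<le> L"
  shows "norm (f x) \<le> (norm (f 0) + L) * (1 + norm x)"
proof -
  have "norm (f x) \<le> norm (f 0) + L * norm x"
    using assms(1)[of x 0] norm_triangle_ineq2[of "f x" "f 0"] by simp
  also have "\<dots> \<le> (norm (f 0) + L) * (1 + norm x)"
    using assms(2) by (simp add: algebra_simps)
  finally show ?thesis .
qed

text \<open>Stein's identity: differentiate \<open>std_gaussian_shift\<close> in the direction of a coordinate axis.\<close>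

lemma std_gaussian_stein:
  fixes f g :: "real^'n \<Rightarrow> real"
  assumes lip: "\<And>x y. \<bar>f x - f y\<bar> \<le> L * norm (x - y)"
    and g [measurable]: "g \<in> borel_measurable borel"
    and deriv: "\<And>x. ((\<lambda>t. f (x + t *\<^sub>R axis j 1)) has_real_derivative g x) (at 0)"
  shows "(\<integral>x. f x * x $ j \<partial>std_gaussian) = (\<integral>x. g x \<partial>std_gaussian)"
proof -
  let ?e = "axis j 1 :: real^'n"
  have e: "norm ?e = 1" "?e \<bullet> ?e = 1" by (simp_all add: norm_axis_1 inner_axis_axis)
  have L: "0 \<le> L" using order_trans[OF abs_ge_zero lip[of ?e 0]] e by simp
  have "L-lipschitz_on UNIV f"
    using lip L by (intro lipschitz_onI) (auto simp: dist_norm)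
  then have f [measurable]: "f \<in> borel_measurable borel"
    by (intro borel_measurable_continuous_onI lipschitz_on_continuous_on)
  define K where "K = \<bar>f 0\<bar> + L"
  have K: "0 \<le> K" "\<bar>f x\<bar> \<le> K * (1 + norm x)" for x
    using lipschitz_growth[of f L x] lip L by (auto simp: K_def)
  define t where "t n = 1 / real (Suc n)" for n
  have t: "0 < t n" "t n \<le> 1" for n by (auto simp: t_def)
  have t0: "t \<longlonglongrightarrow> 0" unfolding t_def using LIMSEQ_inverse_real_of_nat by (simp add: inverse_eq_divide)
  have at: "filterlim t (at 0) sequentially"
    using t0 t by (auto simp: filterlim_at less_imp_neq[symmetric])
  have quot: "(\<lambda>n. (h (t n) - h 0) / t n) \<longlonglongrightarrow> D"
    if "(h has_real_derivative D) (at 0)" for h D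
    using filterlim_compose[OF _ at, of "\<lambda>u. (h u - h 0) / u" "nhds D"] that
    by (simp add: DERIV_def)
  \<comment> \<open>\<open>w n\<close> is the Cameron-Martin weight of a shift by \<open>t n\<close>
    along the j-th axis. Its difference quotient at 0 tends to the coordinate \<open>x $ j\<close>,
    which is how the factor in the identity arises.\<close>
  define w where "w n x = exp ((t n *\<^sub>R ?e) \<bullet> x - ((t n *\<^sub>R ?e) \<bullet> (t n *\<^sub>R ?e)) / 2)" for n x
  have w_eq: "w n x = exp (t n * x $ j - (t n)\<^sup>2 / 2)" for n x
    by (simp add: w_def e inner_axis' power2_eq_square)
  have w [measurable]: "w n \<in> borel_measurable borel" for n unfolding w_def by measurable
  have w1: "\<bar>w n x - 1\<bar> \<le> t n * ((1 + norm x) * exp (norm x + 1))" for n x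
  proof -
    let ?u = "t n * x $ j - (t n)\<^sup>2 / 2"
    have "(t n)\<^sup>2 / 2 \<le> t n * 1"
      using t[of n] by (simp add: power2_eq_square mult_le_cancel_left1)
    moreover have "\<bar>t n * x $ j\<bar> \<le> t n * norm x"
      using t[of n] component_le_norm_cart[of x j] by (simp add: abs_mult)
    moreover have "t n * (1 + norm x) = t n * 1 + t n * norm x" by (rule distrib_left)
    ultimately have u: "\<bar>?u\<bar> \<le> t n * (1 + norm x)"
      using zero_le_power2[of "t n"] unfolding abs_le_iff by linarith
    also have "\<dots> \<le> norm x + 1" using t[of n] mult_right_mono[of "t n" 1 "1 + norm x"] by simp
    finally have "exp \<bar>?u\<bar> \<le> exp (norm x + 1)" by simp
    with u have "\<bar>?u\<bar> * exp \<bar>?u\<bar> \<le> t n * (1 + norm x) * exp (norm x + 1)"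
      using t[of n] by (intro mult_mono) auto
    with abs_exp_minus_one_le[of ?u] show ?thesis by (simp add: w_eq mult.assoc)
  qed
  have fw: "\<bar>f x * (w n x - 1)\<bar> \<le> t n * (K * exp 1 * exp (3 * norm x))" for n x
  proof -
    have "\<bar>f x * (w n x - 1)\<bar> \<le> K * (1 + norm x) * (t n * ((1 + norm x) * exp (norm x + 1)))"
      unfolding abs_mult using K t[of n] w1 by (intro mult_mono) auto
    also have "\<dots> = t n * K * ((1 + norm x)\<^sup>2 * exp (norm x + 1))"
      by (simp add: power2_eq_square mult_ac)
    also have "\<dots> \<le> t n * K * (exp 1 * exp (3 * norm x))"
      using K t[of n] exp_growth_bounds(4)[of "norm x"] by (intro mult_left_mono) auto
    finally show ?thesis by (simp add: mult.assoc)
  qed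
  have int_f: "integrable std_gaussian f"
  proof (rule integrable_std_gaussian_exp_growth)
    show "norm (f x) \<le> K * exp (3 * norm x)" for x
      using K(2)[of x] mult_left_mono[OF exp_growth_bounds(2) K(1), of "norm x"] by simp
  qed measurable
  have int_fw: "integrable std_gaussian (\<lambda>x. f x * (w n x - 1))" for n
    using fw[of _ n] by (intro integrable_std_gaussian_exp_growth[where K = "t n * K * exp 1"]) (auto simp: mult_ac)
  have shift: "\<bar>f (t n *\<^sub>R ?e + x) - f x\<bar> \<le> L * t n" for n x
    using lip[of "t n *\<^sub>R ?e + x" x] t[of n] e by simp
  have int_shift: "integrable std_gaussian (\<lambda>x. f (t n *\<^sub>R ?e + x) - f x)" for n
  proof (rule integrable_std_gaussian_exp_growth)
    have "0 \<le> L * t n" using L t[of n] by simp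
    then show "norm (f (t n *\<^sub>R ?e + x) - f x) \<le> L * t n * exp (3 * norm x)" for x
      using shift[of n x] mult_left_mono[OF exp_growth_bounds(1)[OF norm_ge_zero], of "L * t n" x] by simp
  qed measurable
  have step: "(\<integral>x. (f (t n *\<^sub>R ?e + x) - f x) / t n \<partial>std_gaussian) = (\<integral>x. f x * (w n x - 1) / t n \<partial>std_gaussian)" for n
  proof -
    have "integrable std_gaussian (\<lambda>x. f (t n *\<^sub>R ?e + x))"
      using Bochner_Integration.integrable_add[OF int_shift int_f] by simp
    moreover have "integrable std_gaussian (\<lambda>x. f x * w n x)"
      using Bochner_Integration.integrable_add[OF int_fw[of n] int_f] by (simp add: algebra_simps)
    moreover have "(\<integral>x. f (t n *\<^sub>R ?e + x) \<partial>std_gaussian) = (\<integral>x. f x * w n x \<partial>std_gaussian)"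
      unfolding w_def by (rule std_gaussian_shift) measurable
    ultimately have "(\<integral>x. f (t n *\<^sub>R ?e + x) - f x \<partial>std_gaussian) = (\<integral>x. f x * w n x - f x \<partial>std_gaussian)"
      using int_f by simp
    then show ?thesis by (simp add: right_diff_distrib)
  qed
  \<comment> \<open>The shifted side: difference quotients of \<open>f\<close> converge to
    \<open>g\<close> and are dominated by the Lipschitz constant.\<close>
  have A: "(\<lambda>n. \<integral>x. (f (t n *\<^sub>R ?e + x) - f x) / t n \<partial>std_gaussian) \<longlonglongrightarrow> (\<integral>x. g x \<partial>std_gaussian)"
  proof (rule integral_dominated_convergence[where w = "\<lambda>x. L"])
    show "AE x in std_gaussian. (\<lambda>n. (f (t n *\<^sub>R ?e + x) - f x) / t n) \<longlonglongrightarrow> g x"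
      using quot[OF deriv] by (intro AE_I2) (simp add: add.commute)
    show "AE x in std_gaussian. norm ((f (t n *\<^sub>R ?e + x) - f x) / t n) \<le> L" for n
      using shift[of n] t[of n] by (intro AE_I2) (simp add: field_simps)
    show "integrable std_gaussian (\<lambda>x::real^'n. L)"
      by (rule finite_measure.integrable_const) (simp add: prob_space.finite_measure[OF prob_space_std_gaussian])
  qed measurable
  \<comment> \<open>The weighted side: the bound \<open>fw\<close>, divided by \<open>t n\<close>,
    is an integrable majorant independent of \<open>n\<close>.\<close>
  have B: "(\<lambda>n. \<integral>x. f x * (w n x - 1) / t n \<partial>std_gaussian) \<longlonglongrightarrow> (\<integral>x. f x * x $ j \<partial>std_gaussian)"
  proof (rule integral_dominated_convergence[where w = "\<lambda>x. K * exp 1 * exp (3 * norm x)"])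
    show "AE x in std_gaussian. (\<lambda>n. f x * (w n x - 1) / t n) \<longlonglongrightarrow> f x * x $ j"
    proof (intro AE_I2)
      fix x :: "real^'n"
      have "((\<lambda>t. exp (t * x $ j - t\<^sup>2 / 2)) has_real_derivative x $ j) (at 0)"
        by (auto intro!: derivative_eq_intros)
      from tendsto_mult_left[OF quot[OF this], of "f x"]
      show "(\<lambda>n. f x * (w n x - 1) / t n) \<longlonglongrightarrow> f x * x $ j" by (simp add: w_eq)
    qed
    show "AE x in std_gaussian. norm (f x * (w n x - 1) / t n) \<le> K * exp 1 * exp (3 * norm x)" for n
      using fw[of _ n] t[of n] by (intro AE_I2) (simp add: field_simps)
    show "integrable std_gaussian (\<lambda>x::real^'n. K * exp 1 * exp (3 * norm x))"
      using K(1) by (intro integrable_std_gaussian_exp_growth[where K = "K * exp 1"]) auto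
  qed measurable
  show ?thesis using LIMSEQ_unique[OF A[unfolded step] B] by simp
qed


section \<open>Moments and entropy of Gaussian measures\<close>

lemma borel_measurable_vec_nth [measurable (raw)]:
  fixes f :: "'a \<Rightarrow> 'b::euclidean_space^'n"
  assumes "f \<in> borel_measurable M"
  shows "(\<lambda>x. f x $ i) \<in> borel_measurable M"
proof -
  have "(\<lambda>y :: 'b^'n. y $ i) \<in> borel_measurable borel"
    by (intro borel_measurable_continuous_onI linear_continuous_on bounded_linear_vec_nth)
  then show ?thesis using assms by measurable
qed

lemma integral_matrix_entry:
  fixes f :: "'a \<Rightarrow> real^'n^'m"
  assumes "integrable M f"
  shows "(\<integral>x. f x \<partial>M) $ i $ j = (\<integral>x. f x $ i $ j \<partial>M)"
proof -
  have bl: "bounded_linear (\<lambda>A :: real^'n^'m. A $ i $ j)"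
    using bounded_linear_compose[OF bounded_linear_vec_nth[of j] bounded_linear_vec_nth[of i]] by simp
  show "(\<integral>x. f x \<partial>M) $ i $ j = (\<integral>x. f x $ i $ j \<partial>M)"
    by (rule integral_bounded_linear[OF bl assms, symmetric])
qed

lemma integrable_std_gaussian_const: "integrable (std_gaussian :: (real^'n) measure) (\<lambda>x. c :: 'b::{banach, second_countable_topology})"
  by (rule finite_measure.integrable_const) (simp add: prob_space.finite_measure[OF prob_space_std_gaussian])

lemma integral_std_gaussian_const: "(\<integral>x. c \<partial>(std_gaussian :: (real^'n) measure)) = (c :: real)"
  using prob_space.prob_space[OF prob_space_std_gaussian, where 'n1 = 'n] by simp

lemma integrable_std_gaussian_coord: "integrable std_gaussian (\<lambda>z :: real^'n. z $ i)"
proof (rule integrable_std_gaussian_quadratic_growth)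
  fix z :: "real^'n"
  have "(1 + norm z)\<^sup>2 = 1 + 2 * norm z + norm z * norm z" by (simp add: power2_eq_square algebra_simps)
  moreover have "0 \<le> norm z" "0 \<le> norm z * norm z" by simp_all
  ultimately show "norm (z $ i) \<le> 1 * (1 + norm z)\<^sup>2"
    using component_le_norm_cart[of z i] unfolding real_norm_def mult_1 by linarith
qed measurable

lemma integrable_std_gaussian_coord_mult: "integrable std_gaussian (\<lambda>z :: real^'n. z $ i * z $ j)"
proof (rule integrable_std_gaussian_quadratic_growth)
  fix z :: "real^'n"
  have "norm (z $ i * z $ j) \<le> norm z * norm z"
    unfolding norm_mult using component_le_norm_cart[of z] by (intro mult_mono) auto
  moreover have "(1 + norm z)\<^sup>2 = 1 + 2 * norm z + norm z * norm z" by (simp add: power2_eq_square algebra_simps)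
  moreover have "0 \<le> norm z" by simp
  ultimately show "norm (z $ i * z $ j) \<le> 1 * (1 + norm z)\<^sup>2"
    unfolding mult_1 by linarith
qed measurable

text \<open>Stein's identity for the constant function 1.\<close>

lemma std_gaussian_mean: "(\<integral>z. z $ i \<partial>(std_gaussian :: (real^'n) measure)) = 0"
  using std_gaussian_stein[of "\<lambda>_. 1" 0 "\<lambda>_. 0" i] by simp

text \<open>Stein's identity for the i-th coordinate function, whose derivative along the j-th axis
  is the Kronecker delta.\<close>

lemma std_gaussian_covariance:
  "(\<integral>z. z $ i * z $ j \<partial>(std_gaussian :: (real^'n) measure)) = (if i = j then 1 else 0)"
proof -
  have "(\<integral>z. z $ i * z $ j \<partial>(std_gaussian :: (real^'n) measure)) = (\<integral>z. axis j 1 $ i \<partial>(std_gaussian :: (real^'n) measure))"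
  proof (rule std_gaussian_stein[where L = 1])
    show "\<bar>x $ i - y $ i\<bar> \<le> 1 * norm (x - y)" for x y :: "real^'n"
      using component_le_norm_cart[of "x - y" i] by simp
    show "((\<lambda>t. (x + t *\<^sub>R axis j 1) $ i) has_real_derivative axis j 1 $ i) (at 0)" for x :: "real^'n"
      by (auto intro!: derivative_eq_intros)
  qed simp
  then show ?thesis unfolding integral_std_gaussian_const by (simp add: axis_def)
qed

lemma inner_matrix_vector_expand:
  fixes x z :: "real^'n" and A :: "real^'n^'n"
  shows "x \<bullet> (A *v z) = (\<Sum>i\<in>UNIV. \<Sum>j\<in>UNIV. A $ i $ j * (x $ i * z $ j))"
  by (simp add: inner_vec_def matrix_vector_mult_def sum_distrib_left mult_ac)

text \<open>Second moments of affine images of one standard Gaussian vector. The trace is the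
  cross-covariance term; these formulas evaluate every quadratic coupling cost below.\<close>

lemma
  fixes A B :: "real^'n^'n" and a b :: "real^'n"
  shows integrable_std_gaussian_affine_inner:
      "integrable std_gaussian (\<lambda>z. (a + A *v z) \<bullet> (b + B *v z))" (is ?I)
    and integral_std_gaussian_affine_inner:
      "(\<integral>z. (a + A *v z) \<bullet> (b + B *v z) \<partial>std_gaussian) = a \<bullet> b + trace (A ** transpose B)" (is ?E)
proof -
  let ?v = "transpose A *v b + transpose B *v a" and ?M = "transpose A ** B"
  have eq: "(a + A *v z) \<bullet> (b + B *v z) = a \<bullet> b + ((\<Sum>i\<in>UNIV. ?v $ i * z $ i) +
      (\<Sum>i\<in>UNIV. \<Sum>j\<in>UNIV. ?M $ i $ j * (z $ i * z $ j)))" for z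
  proof -
    have "(A *v z) \<bullet> b = (transpose A *v b) \<bullet> z"
      by (subst inner_commute, rule inner_matrix_transpose)
    moreover have "a \<bullet> (B *v z) = (transpose B *v a) \<bullet> z" by (rule inner_matrix_transpose)
    moreover have "(A *v z) \<bullet> (B *v z) = z \<bullet> (?M *v z)"
      by (metis inner_matrix_transpose matrix_vector_mul_assoc transpose_transpose)
    moreover have "(\<Sum>i\<in>UNIV. ?v $ i * z $ i) = ?v \<bullet> z" by (simp add: inner_vec_def)
    ultimately show ?thesis
      unfolding inner_matrix_vector_expand[symmetric]
      by (simp only: inner_add_left inner_add_right)
  qed
  have hb_const: "has_bochner_integral std_gaussian (\<lambda>z::real^'n. a \<bullet> b) (a \<bullet> b)"
    unfolding has_bochner_integral_iff
    by (intro conjI integrable_std_gaussian_const integral_std_gaussian_const)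
  have hb_coord: "has_bochner_integral std_gaussian (\<lambda>z::real^'n. z $ i) 0" for i
    unfolding has_bochner_integral_iff
    by (intro conjI integrable_std_gaussian_coord std_gaussian_mean)
  have hb_mult: "has_bochner_integral std_gaussian (\<lambda>z::real^'n. z $ i * z $ j) (if i = j then 1 else 0)" for i j
    unfolding has_bochner_integral_iff
    by (intro conjI integrable_std_gaussian_coord_mult std_gaussian_covariance)
  have "has_bochner_integral std_gaussian (\<lambda>z. (a + A *v z) \<bullet> (b + B *v z))
     (a \<bullet> b + ((\<Sum>i\<in>UNIV. ?v $ i * 0) + (\<Sum>i\<in>UNIV. \<Sum>j\<in>UNIV. ?M $ i $ j * (if i = j then 1 else 0))))"
    unfolding eq by (intro has_bochner_integral_add has_bochner_integral_sum has_bochner_integral_mult_right hb_const hb_coord hb_mult)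
  then have int: ?I and val: "(\<integral>z. (a + A *v z) \<bullet> (b + B *v z) \<partial>std_gaussian) =
     a \<bullet> b + ((\<Sum>i\<in>UNIV. ?v $ i * 0) + (\<Sum>i\<in>UNIV. \<Sum>j\<in>UNIV. ?M $ i $ j * (if i = j then 1 else 0)))"
    by (simp_all only: has_bochner_integral_iff)
  note val
  also have "\<dots> = a \<bullet> b + trace ?M"
    by (simp add: trace_def if_distrib[of "\<lambda>x. _ * x"] cong: if_cong)
  also have "trace ?M = trace (A ** transpose B)"
    by (metis matrix_transpose_mul trace_mul_sym trace_transpose transpose_transpose)
  finally show ?E .
  show ?I by (rule int)
qed

text \<open>The scalar identity applied to each component of \<open>F\<close> and each coordinate of
  \<open>z\<close>, then summed against the entries of \<open>A\<close>.\<close>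

lemma std_gaussian_stein_field:
  fixes F :: "real^'n \<Rightarrow> real^'n" and DF :: "real^'n \<Rightarrow> real^'n^'n" and A :: "real^'n^'n"
  assumes lip: "\<And>x y. norm (F x - F y) \<le> L * norm (x - y)"
    and deriv: "\<And>x. (F has_derivative (\<lambda>h. DF x *v h)) (at x)"
    and int: "integrable std_gaussian DF"
  shows "integrable std_gaussian (\<lambda>z. F z \<bullet> (A *v z))"
    and "(\<integral>z. F z \<bullet> (A *v z) \<partial>std_gaussian) = trace ((\<integral>z. DF z \<partial>std_gaussian) ** transpose A)"
proof -
  have L: "0 \<le> L" using order_trans[OF norm_ge_zero lip[of "axis undefined 1" 0]]
    by (simp add: norm_axis_1)
  have "L-lipschitz_on UNIV F"
    using lip L by (intro lipschitz_onI) (auto simp: dist_norm)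
  then have F [measurable]: "F \<in> borel_measurable borel"
    by (intro borel_measurable_continuous_onI lipschitz_on_continuous_on)
  have [measurable]: "DF \<in> borel_measurable borel"
    using borel_measurable_integrable[OF int] by (simp cong: measurable_cong_sets)
  have comp: "\<bar>F x $ i - F y $ i\<bar> \<le> L * norm (x - y)" for x y i
    using component_le_norm_cart[of "F x - F y" i] lip[of x y] by simp
  have int_Fz: "integrable std_gaussian (\<lambda>z. F z $ i * z $ j)" for i j
  proof (rule integrable_std_gaussian_quadratic_growth)
    fix z
    have "norm (F z $ i * z $ j) \<le> (norm (F 0) + L) * (1 + norm z) * (1 + norm z)"
      unfolding norm_mult using L component_le_norm_cart[of "F z" i] component_le_norm_cart[of z j]
        lipschitz_growth[of F L z] lip by (intro mult_mono) auto
    then show "norm (F z $ i * z $ j) \<le> (norm (F 0) + L) * (1 + norm z)\<^sup>2"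
      by (simp add: power2_eq_square mult.assoc)
  qed measurable
  have stein: "(\<integral>z. F z $ i * z $ j \<partial>std_gaussian) = (\<integral>z. DF z \<partial>std_gaussian) $ i $ j" for i j
    unfolding integral_matrix_entry[OF int]
  proof (rule std_gaussian_stein[OF comp])
    show "((\<lambda>t. F (x + t *\<^sub>R axis j 1) $ i) has_real_derivative DF x $ i $ j) (at 0)" for x
    proof -
      have "((\<lambda>t. F (x + t *\<^sub>R axis j 1)) has_derivative (\<lambda>t. DF x *v (t *\<^sub>R axis j 1))) (at 0)"
        by (rule has_derivative_compose[of "\<lambda>t. x + t *\<^sub>R axis j 1" "\<lambda>t. t *\<^sub>R axis j 1" 0 UNIV F, simplified])
           (auto intro!: derivative_eq_intros deriv)
      from bounded_linear.has_derivative[OF bounded_linear_vec_nth[of i] this]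
      have "((\<lambda>t. F (x + t *\<^sub>R axis j 1) $ i) has_derivative (\<lambda>t. (DF x *v (t *\<^sub>R axis j 1)) $ i)) (at 0)" .
      moreover have "(DF x *v (t *\<^sub>R axis j 1)) $ i = DF x $ i $ j * t" for t
        by (simp add: matrix_vector_mult_scaleR matrix_vector_mult_basis column_def)
      ultimately show ?thesis by (simp add: has_field_derivative_def)
    qed
  qed measurable
  show "integrable std_gaussian (\<lambda>z. F z \<bullet> (A *v z))"
    unfolding inner_matrix_vector_expand
    by (intro Bochner_Integration.integrable_sum integrable_mult_right int_Fz)
  have "(\<integral>z. F z \<bullet> (A *v z) \<partial>std_gaussian) = (\<Sum>i\<in>UNIV. \<Sum>j\<in>UNIV. A $ i $ j * (\<integral>z. DF z \<partial>std_gaussian) $ i $ j)"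
    unfolding inner_matrix_vector_expand stein[symmetric]
    by (simp add: Bochner_Integration.integral_sum int_Fz)
  also have "\<dots> = trace ((\<integral>z. DF z \<partial>std_gaussian) ** transpose A)"
    by (simp add: trace_def matrix_matrix_mult_def transpose_def mult.commute)
  finally show "(\<integral>z. F z \<bullet> (A *v z) \<partial>std_gaussian) = trace ((\<integral>z. DF z \<partial>std_gaussian) ** transpose A)" .
qed

lemma
  fixes C B :: "real^'n^'n" and f :: "real^'n \<Rightarrow> 'b::{banach, second_countable_topology}"
  assumes CB: "C ** B = mat 1" and [measurable]: "f \<in> borel_measurable borel"
  shows integral_gaussian: "(\<integral>x. f x \<partial>gaussian m (C ** transpose C)) = (\<integral>z. f (m + C *v z) \<partial>std_gaussian)"
    and integrable_gaussian: "integrable (gaussian m (C ** transpose C)) f \<longleftrightarrow> integrable std_gaussian (\<lambda>z. f (m + C *v z))"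
  unfolding gaussian_eq_distr[OF CB] by (simp_all add: integral_distr integrable_distr_eq)

lemma pd_mat_factor:
  assumes "pd_mat \<Sigma>"
  obtains C where "pd_mat C" "C ** transpose C = \<Sigma>" "C ** matrix_inv C = mat 1"
  using pd_mat_sqrt[OF assms] by (metis pd_mat_inverse(2) pd_mat_sym)

lemma
  fixes \<Sigma> P :: "real^'n^'n"
  assumes "pd_mat \<Sigma>"
  shows integrable_gaussian_quadratic: "integrable (gaussian m \<Sigma>) (\<lambda>x. (x - m) \<bullet> (P *v (x - m)))"
    and integral_gaussian_quadratic: "(\<integral>x. (x - m) \<bullet> (P *v (x - m)) \<partial>gaussian m \<Sigma>) = trace (P ** \<Sigma>)"
    and integrable_gaussian_linear: "integrable (gaussian m \<Sigma>) (\<lambda>x. v \<bullet> (x - m))"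
    and integral_gaussian_linear: "(\<integral>x. v \<bullet> (x - m) \<partial>gaussian m \<Sigma>) = 0"
proof -
  obtain C where C: "pd_mat C" "C ** transpose C = \<Sigma>" "C ** matrix_inv C = mat 1"
    using pd_mat_factor[OF assms] by blast
  note I = integral_gaussian[OF C(3), of _ m, unfolded C(2)] integrable_gaussian[OF C(3), of _ m, unfolded C(2)]
  have q: "(C *v z) \<bullet> (P *v (C *v z)) = (0 + C *v z) \<bullet> (0 + (P ** C) *v z)" for z
    by (simp add: matrix_vector_mul_assoc)
  have l: "v \<bullet> (C *v z) = (v + 0 *v z) \<bullet> (0 + C *v z)" for z by simp
  show "integrable (gaussian m \<Sigma>) (\<lambda>x. (x - m) \<bullet> (P *v (x - m)))"
    using integrable_std_gaussian_affine_inner[of 0 C 0 "P ** C"] by (subst I) (simp_all add: q)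
  show "integrable (gaussian m \<Sigma>) (\<lambda>x. v \<bullet> (x - m))"
    using integrable_std_gaussian_affine_inner[of v 0 0 C] by (subst I) simp_all
  show "(\<integral>x. v \<bullet> (x - m) \<partial>gaussian m \<Sigma>) = 0"
    using integral_std_gaussian_affine_inner[of v 0 0 C] by (subst I) (simp_all add: trace_def)
  have "C ** transpose (P ** C) = transpose (P ** \<Sigma>)"
    by (simp add: C(2)[symmetric] matrix_transpose_mul matrix_mul_assoc)
  then have "trace (C ** transpose (P ** C)) = trace (P ** \<Sigma>)"
    by (simp add: trace_transpose)
  then show "(\<integral>x. (x - m) \<bullet> (P *v (x - m)) \<partial>gaussian m \<Sigma>) = trace (P ** \<Sigma>)"
    using integral_std_gaussian_affine_inner[of 0 C 0 "P ** C"] by (subst I) (simp_all add: q)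
qed

text \<open>The exponent of the density has mean - tr (\<Sigma>^-1 \<Sigma>) / 2 = - n/2, so only
  the log-determinant of the normalisation varies.\<close>

lemma gauss_entropy_eq:
  fixes \<Sigma> :: "real^'n^'n"
  assumes "pd_mat \<Sigma>"
  shows "gauss_entropy m \<Sigma> = - real CARD('n) / 2 - ln ((2 * pi) ^ CARD('n)) / 2 - ln (det \<Sigma>) / 2"
proof -
  interpret prob_space "gaussian m \<Sigma>" by (rule prob_space_gaussian[OF assms])
  let ?c = "ln ((2 * pi) ^ CARD('n)) / 2 + ln (det \<Sigma>) / 2"
  have pos: "0 < (2 * pi) ^ CARD('n)" "0 < det \<Sigma>" by (simp_all add: pd_mat_det_pos[OF assms])
  have "ln (gauss_pdf m \<Sigma> x) = (- 1 / 2) * ((x - m) \<bullet> (matrix_inv \<Sigma> *v (x - m))) - ?c" for x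
  proof -
    have "ln (sqrt ((2 * pi) ^ CARD('n) * det \<Sigma>)) = ?c"
      using pos by (subst ln_sqrt) (auto simp: ln_mult)
    then show ?thesis
      using pos unfolding gauss_pdf_def by (subst ln_div) (auto simp: real_sqrt_gt_zero)
  qed
  then have "gauss_entropy m \<Sigma> = (\<integral>x. (- 1 / 2) * ((x - m) \<bullet> (matrix_inv \<Sigma> *v (x - m))) - ?c \<partial>gaussian m \<Sigma>)"
    by (simp only: gauss_entropy_def)
  also have "\<dots> = (- 1 / 2) * trace (matrix_inv \<Sigma> ** \<Sigma>) - ?c"
    using integrable_gaussian_quadratic[OF assms, of m "matrix_inv \<Sigma>"] prob_space
    by (subst Bochner_Integration.integral_diff)
       (auto simp: integral_gaussian_quadratic[OF assms])
  finally show ?thesis by (simp add: pd_mat_inverse[OF assms] trace_I)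
qed


section \<open>Convex smooth potentials\<close>

text \<open>The mixed second difference of \<open>V\<close> approximates t^2 times the second
  derivative. The mean value theorem is applied to \<phi>, the first difference of \<open>V\<close>
  in direction \<open>k\<close> moved along \<open>h\<close>; then \<open>g\<close> is linearised at
  \<open>x\<close>, at the two points x + s h + t k and x + s h. The factor 2 |h| + |k| adds their
  distances from \<open>x\<close>.\<close>

lemma second_difference_estimate:
  fixes V :: "'a::real_inner \<Rightarrow> real" and g :: "'a \<Rightarrow> 'a"
  assumes grad: "\<And>x. (V has_derivative (\<lambda>h. g x \<bullet> h)) (at x)"
    and hess: "(g has_derivative H) (at x)" and e: "0 < e"
  obtains d where "0 < d" "\<And>t. 0 < t \<Longrightarrow> t < d \<Longrightarrow>
    \<bar>V (x + t *\<^sub>R h + t *\<^sub>R k) - V (x + t *\<^sub>R h) - V (x + t *\<^sub>R k) + V x - t\<^sup>2 * (H k \<bullet> h)\<bar>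
      \<le> e * t\<^sup>2 * ((2 * norm h + norm k) * norm h)"
proof -
  obtain r where r: "0 < r" and gr: "\<And>y. norm (y - x) < r \<Longrightarrow> norm (g y - g x - H (y - x)) \<le> e * norm (y - x)"
    using hess e by (auto simp: has_derivative_at_alt)
  have lin: "linear H" using hess has_derivative_linear by blast
  define d where "d = r / (norm h + norm k + 1)"
  have pos: "0 < norm h + norm k + 1" by (simp add: add_nonneg_pos)
  have d: "0 < d" using r pos by (simp add: d_def)
  show thesis
  proof (rule that[OF d])
    fix t :: real assume t: "0 < t" "t < d"
    have td: "t * (norm h + norm k + 1) < r" using t pos by (simp add: d_def field_simps)
    define \<phi> where "\<phi> s = V (x + s *\<^sub>R h + t *\<^sub>R k) - V (x + s *\<^sub>R h)" for s
    define \<phi>' where "\<phi>' s = (g (x + s *\<^sub>R h + t *\<^sub>R k) - g (x + s *\<^sub>R h)) \<bullet> h" for s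
    have DV: "((\<lambda>s. V (a + s *\<^sub>R h)) has_real_derivative g (a + s *\<^sub>R h) \<bullet> h) (at s)" for a s
    proof -
      have "((\<lambda>s. a + s *\<^sub>R h) has_derivative (\<lambda>s. s *\<^sub>R h)) (at s)"
        by (auto intro!: derivative_eq_intros)
      from has_derivative_compose[OF this grad]
      show ?thesis by (simp add: has_field_derivative_def mult_commute_abs)
    qed
    have D: "(\<phi> has_real_derivative \<phi>' s) (at s)" for s
      using DERIV_diff[OF DV[of "x + t *\<^sub>R k" s] DV[of x s]]
      by (simp add: \<phi>_def[abs_def] \<phi>'_def inner_diff_left algebra_simps)
    obtain s where s: "0 < s" "s < t" and mvt: "\<phi> t - \<phi> 0 = t * \<phi>' s"
      using MVT2[of 0 t \<phi> \<phi>'] D t by auto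
    let ?a = "x + s *\<^sub>R h + t *\<^sub>R k" and ?b = "x + s *\<^sub>R h"
    have na: "norm (?a - x) \<le> t * (norm h + norm k)"
    proof -
      have "norm (?a - x) \<le> norm (s *\<^sub>R h) + norm (t *\<^sub>R k)"
        using norm_triangle_ineq[of "s *\<^sub>R h" "t *\<^sub>R k"] by (simp add: add.assoc)
      also have "\<dots> \<le> t * norm h + t * norm k" using s t by (simp add: mult_right_mono)
      finally show ?thesis by (simp add: distrib_left)
    qed
    have nb: "norm (?b - x) \<le> t * norm h" using s by (simp add: mult_right_mono)
    have "t * norm h \<le> t * (norm h + norm k + 1)" "t * (norm h + norm k) \<le> t * (norm h + norm k + 1)"
      using t by (auto intro: mult_left_mono)
    with na nb td have "norm (?a - x) < r" "norm (?b - x) < r" by linarith+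
    then have ga: "norm (g ?a - g x - H (?a - x)) \<le> e * (t * (norm h + norm k))"
      and gb: "norm (g ?b - g x - H (?b - x)) \<le> e * (t * norm h)"
      using gr[of ?a] gr[of ?b] na nb e by (auto intro: order_trans mult_left_mono)
    have "H (?a - x) - H (?b - x) = t *\<^sub>R H k"
      by (simp add: linear_add[OF lin] linear_scale[OF lin] linear_diff[OF lin] flip: linear_diff[OF lin])
    then have eq: "g ?a - g ?b - t *\<^sub>R H k = (g ?a - g x - H (?a - x)) - (g ?b - g x - H (?b - x))"
      by (simp add: algebra_simps)
    have "norm (g ?a - g ?b - t *\<^sub>R H k) \<le> e * (t * (norm h + norm k)) + e * (t * norm h)"
      unfolding eq
      using norm_triangle_ineq4[of "g ?a - g x - H (?a - x)" "g ?b - g x - H (?b - x)"] ga gb by linarith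
    then have "norm (g ?a - g ?b - t *\<^sub>R H k) * norm h \<le> (e * (t * (norm h + norm k)) + e * (t * norm h)) * norm h"
      by (rule mult_right_mono) simp
    then have "\<bar>(g ?a - g ?b - t *\<^sub>R H k) \<bullet> h\<bar> \<le> (e * (t * (norm h + norm k)) + e * (t * norm h)) * norm h"
      using Cauchy_Schwarz_ineq2[of "g ?a - g ?b - t *\<^sub>R H k" h] by linarith
    then have "\<bar>\<phi>' s - t * (H k \<bullet> h)\<bar> \<le> e * t * ((2 * norm h + norm k) * norm h)"
      by (simp add: \<phi>'_def inner_diff_left algebra_simps)
    then have "t * \<bar>\<phi>' s - t * (H k \<bullet> h)\<bar> \<le> t * (e * t * ((2 * norm h + norm k) * norm h))"
      using t by (intro mult_left_mono) auto
    then have "\<bar>t * \<phi>' s - t\<^sup>2 * (H k \<bullet> h)\<bar> \<le> e * t\<^sup>2 * ((2 * norm h + norm k) * norm h)"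
      using t abs_mult[of t "\<phi>' s - t * (H k \<bullet> h)"] by (simp add: power2_eq_square algebra_simps)
    moreover have "V (x + t *\<^sub>R h + t *\<^sub>R k) - V (x + t *\<^sub>R h) - V (x + t *\<^sub>R k) + V x = t * \<phi>' s"
      using mvt by (simp add: \<phi>_def)
    ultimately show "\<bar>V (x + t *\<^sub>R h + t *\<^sub>R k) - V (x + t *\<^sub>R h) - V (x + t *\<^sub>R k) + V x - t\<^sup>2 * (H k \<bullet> h)\<bar>
      \<le> e * t\<^sup>2 * ((2 * norm h + norm k) * norm h)" by simp
  qed
qed

text \<open>The second difference is unchanged when \<open>h\<close> and \<open>k\<close> are
  swapped, so both bilinear values are limits of the same quotient. \<open>psd_mat\<close> includes
  symmetry, which therefore has to be derived for the Hessian.\<close>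

lemma hessian_symmetric:
  fixes V :: "'a::real_inner \<Rightarrow> real" and g :: "'a \<Rightarrow> 'a"
  assumes grad: "\<And>x. (V has_derivative (\<lambda>h. g x \<bullet> h)) (at x)"
    and hess: "(g has_derivative H) (at x)"
  shows "H k \<bullet> h = H h \<bullet> k"
proof -
  define c where "c = (2 * norm h + norm k) * norm h + (2 * norm k + norm h) * norm k"
  have c: "0 \<le> c" by (simp add: c_def)
  have "\<bar>H k \<bullet> h - H h \<bullet> k\<bar> \<le> 0 + e" if "0 < e" for e
  proof -
    define e' where "e' = e / (c + 1)"
    have e': "0 < e'" "e' * c \<le> e" using that c by (auto simp: e'_def field_simps)
    obtain d1 where d1: "0 < d1" "\<And>t. 0 < t \<Longrightarrow> t < d1 \<Longrightarrow>
      \<bar>V (x + t *\<^sub>R h + t *\<^sub>R k) - V (x + t *\<^sub>R h) - V (x + t *\<^sub>R k) + V x - t\<^sup>2 * (H k \<bullet> h)\<bar>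
      \<le> e' * t\<^sup>2 * ((2 * norm h + norm k) * norm h)"
      using second_difference_estimate[OF grad hess e'(1)] by blast
    obtain d2 where d2: "0 < d2" "\<And>t. 0 < t \<Longrightarrow> t < d2 \<Longrightarrow>
      \<bar>V (x + t *\<^sub>R k + t *\<^sub>R h) - V (x + t *\<^sub>R k) - V (x + t *\<^sub>R h) + V x - t\<^sup>2 * (H h \<bullet> k)\<bar>
      \<le> e' * t\<^sup>2 * ((2 * norm k + norm h) * norm k)"
      using second_difference_estimate[OF grad hess e'(1)] by blast
    define t where "t = min d1 d2 / 2"
    have t: "0 < t" "t < d1" "t < d2" using d1(1) d2(1) by (auto simp: t_def)
    have swap: "x + t *\<^sub>R k + t *\<^sub>R h = x + t *\<^sub>R h + t *\<^sub>R k" by simp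
    from d1(2)[OF t(1,2)] d2(2)[OF t(1,3), unfolded swap]
    have "\<bar>t\<^sup>2 * (H k \<bullet> h) - t\<^sup>2 * (H h \<bullet> k)\<bar> \<le> e' * t\<^sup>2 * ((2 * norm h + norm k) * norm h) + e' * t\<^sup>2 * ((2 * norm k + norm h) * norm k)"
      by linarith
    also have "\<dots> = t\<^sup>2 * (e' * c)" by (simp add: c_def algebra_simps)
    finally have "t\<^sup>2 * \<bar>H k \<bullet> h - H h \<bullet> k\<bar> \<le> t\<^sup>2 * (e' * c)"
      by (simp add: abs_mult flip: right_diff_distrib)
    then have "\<bar>H k \<bullet> h - H h \<bullet> k\<bar> \<le> e' * c" using t(1) by simp
    with e'(2) show ?thesis by simp
  qed
  then have "\<bar>H k \<bullet> h - H h \<bullet> k\<bar> \<le> 0" by (rule field_le_epsilon)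
  then show ?thesis by simp
qed

text \<open>The eigenvalues lie in [0, \<beta>], so \<beta> A - A^2 is positive semidefinite; this
  gives |A v|^2 \<le> \<beta> (v . A v).\<close>

lemma psd_mat_norm_bound:
  fixes A :: "real^'n^'n"
  assumes A: "psd_mat A" and le: "\<And>v. v \<bullet> (A *v v) \<le> \<beta> * (v \<bullet> v)" and \<beta>: "0 \<le> \<beta>"
  shows "norm (A *v v) \<le> \<beta> * norm v"
proof -
  obtain Q d where Q: "orthogonal_matrix Q" "A = conj_diag Q d" and d: "\<And>i. 0 \<le> d i"
    using psd_mat_spectral[OF A] by blast
  have "d i \<le> \<beta>" for i
  proof -
    have "d i \<le> \<beta> * ((Q *v axis i 1) \<bullet> (Q *v axis i 1))"
      using le[of "Q *v axis i 1"] conj_diag_eigenvalue(1)[OF Q(1), of i d] Q(2) by simp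
    then show ?thesis
      using orthogonal_matrix_norm[OF Q(1), of "axis i 1"] by (simp add: dot_square_norm norm_axis_1)
  qed
  then have "psd_mat (conj_diag Q (\<lambda>i. d i * (\<beta> - d i)))"
    using d by (simp add: conj_diag_psd_iff[OF Q(1)])
  moreover have "conj_diag Q (\<lambda>i. d i * (\<beta> - d i)) = \<beta> *\<^sub>R A - A ** A"
    using Q(1) by (simp add: Q(2) conj_diag_mult conj_diag_scaleR conj_diag_diff algebra_simps)
  ultimately have "0 \<le> v \<bullet> ((\<beta> *\<^sub>R A - A ** A) *v v)" by (simp add: psd_mat_def)
  also have "\<dots> = \<beta> * (v \<bullet> (A *v v)) - (A *v v) \<bullet> (A *v v)"
    using A sym_mat_inner[of A v "A *v v"]
    by (simp add: matrix_vector_mult_diff_rdistrib inner_diff_right scaleR_matrix_vector_assoc[symmetric]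
        matrix_vector_mul_assoc psd_mat_def)
  finally have "(norm (A *v v))\<^sup>2 \<le> \<beta> * (v \<bullet> (A *v v))" by (simp add: dot_square_norm)
  also have "\<dots> \<le> \<beta> * (\<beta> * (v \<bullet> v))" by (intro mult_left_mono le \<beta>)
  also have "\<dots> = (\<beta> * norm v)\<^sup>2" by (simp add: dot_square_norm power_mult_distrib power2_eq_square)
  finally show ?thesis by (rule power2_le_imp_le) (simp add: \<beta>)
qed

locale convex_smooth_potential =
  fixes V :: "real^'n \<Rightarrow> real"
    and gradV :: "real^'n \<Rightarrow> real^'n"
    and HV :: "real^'n \<Rightarrow> real^'n^'n"
    and \<beta> :: real
  assumes grad: "\<And>x. (V has_derivative (\<lambda>h. gradV x \<bullet> h)) (at x)"
    and hess: "\<And>x. (gradV has_derivative (\<lambda>h. HV x *v h)) (at x)"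
    and hess_cont: "continuous_on UNIV HV"
    and convex: "\<And>x v. 0 \<le> v \<bullet> (HV x *v v)"
    and smooth: "\<And>x v. v \<bullet> (HV x *v v) \<le> \<beta> * (v \<bullet> v)"
    and beta_pos: "\<beta> > 0"
begin

lemma HV_psd: "psd_mat (HV x)"
proof -
  have "HV x $ i $ j = HV x $ j $ i" for i j
    using hessian_symmetric[OF grad hess, of x "axis j 1" "axis i 1"]
    by (simp add: inner_axis matrix_vector_mult_basis column_def)
  then show ?thesis
    using convex by (simp add: psd_mat_def sym_mat_def transpose_def vec_eq_iff)
qed

lemma HV_norm: "norm (HV x *v v) \<le> \<beta> * norm v"
  using HV_psd smooth beta_pos by (intro psd_mat_norm_bound) auto

lemma gradV_lipschitz: "norm (gradV x - gradV y) \<le> \<beta> * norm (x - y)"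
proof (rule differentiable_bound[of UNIV])
  show "onorm ((*v) (HV z)) \<le> \<beta>" for z
    by (intro onorm_le HV_norm)
qed (auto intro: hess has_derivative_at_withinI)

text \<open>Taylor's formula along the segment from \<open>x\<close> to \<open>y\<close>, with
  Lagrange remainder bounded by convexity below and by smoothness above.\<close>

lemma second_order_bounds:
  "V x + gradV x \<bullet> (y - x) \<le> V y"
  "V y \<le> V x + gradV x \<bullet> (y - x) + \<beta> / 2 * (norm (y - x))\<^sup>2"
proof -
  let ?v = "y - x"
  \<comment> \<open>\<open>D m\<close> is the m-th derivative of \<open>V\<close> along the segment
    for m = 0, 1, 2; larger indices share the last branch and never occur in the expansion.\<close>
  define D where "D m t = (if m = 0 then V (x + t *\<^sub>R ?v) else if m = 1 then gradV (x + t *\<^sub>R ?v) \<bullet> ?v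
    else ?v \<bullet> (HV (x + t *\<^sub>R ?v) *v ?v))" for m :: nat and t :: real
  have line: "((\<lambda>s. x + s *\<^sub>R ?v) has_derivative (\<lambda>s. s *\<^sub>R ?v)) (at t)" for t
    by (auto intro!: derivative_eq_intros)
  have D0: "((\<lambda>s. V (x + s *\<^sub>R ?v)) has_real_derivative gradV (x + t *\<^sub>R ?v) \<bullet> ?v) (at t)" for t
    using has_derivative_compose[OF line grad, of t] by (simp add: has_field_derivative_def mult.commute[of _ "_ \<bullet> _"])
  have D1: "((\<lambda>s. gradV (x + s *\<^sub>R ?v) \<bullet> ?v) has_real_derivative ?v \<bullet> (HV (x + t *\<^sub>R ?v) *v ?v)) (at t)" for t
    using has_derivative_inner_left[OF has_derivative_compose[OF line hess, of t], of ?v]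
    by (simp add: has_field_derivative_def matrix_vector_mult_scaleR mult.commute[of _ "_ \<bullet> _"] inner_commute[of ?v])
  have "\<exists>t. 0 < t \<and> t < 1 \<and> V (x + 1 *\<^sub>R ?v) = (\<Sum>m<2. D m 0 / fact m * 1 ^ m) + D 2 t / fact 2 * 1 ^ 2"
  proof (rule Maclaurin)
    show "\<forall>m t. m < 2 \<and> 0 \<le> t \<and> t \<le> 1 \<longrightarrow> (D m has_real_derivative D (Suc m) t) (at t)"
      using D0 D1 by (auto simp: D_def[abs_def] less_2_cases_iff)
  qed (auto simp: D_def)
  then obtain t where "V y = V x + gradV x \<bullet> ?v + ?v \<bullet> (HV (x + t *\<^sub>R ?v) *v ?v) / 2"
    by (auto simp: D_def numeral_2_eq_2)
  then show "V x + gradV x \<bullet> (y - x) \<le> V y"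
    "V y \<le> V x + gradV x \<bullet> (y - x) + \<beta> / 2 * (norm (y - x))\<^sup>2"
    using convex[of ?v "x + t *\<^sub>R ?v"] smooth[of ?v "x + t *\<^sub>R ?v"] by (simp_all add: power2_norm_eq_inner)
qed

lemma continuous_V: "continuous_on UNIV V"
  using grad by (intro has_derivative_continuous_on) (auto intro: has_derivative_at_withinI)

lemma continuous_gradV: "continuous_on UNIV gradV"
  using hess by (intro has_derivative_continuous_on) (auto intro: has_derivative_at_withinI)

lemma measurable_potential [measurable]:
  "V \<in> borel_measurable borel" "gradV \<in> borel_measurable borel" "HV \<in> borel_measurable borel"
  using continuous_V continuous_gradV hess_cont by (auto intro: borel_measurable_continuous_onI)

lemma HV_bounded: "norm (HV x) \<le> real CARD('n) * \<beta>"
proof -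
  have "norm (HV x $ i) \<le> \<beta>" for i
  proof -
    have "HV x $ i = HV x *v axis i 1"
      using psd_mat_sym[OF HV_psd[of x]] by (metis matrix_vector_mult_basis row_def row_transpose vec_lambda_eta)
    then show ?thesis using HV_norm[of x "axis i 1"] by (simp add: norm_axis_1)
  qed
  then have "(\<Sum>i\<in>UNIV. norm (HV x $ i)) \<le> real CARD('n) * \<beta>"
    using sum_bounded_above[of UNIV "\<lambda>i. norm (HV x $ i)" \<beta>] by simp
  moreover have "norm (HV x) \<le> (\<Sum>i\<in>UNIV. norm (HV x $ i))"
    unfolding norm_vec_def[of "HV x"] by (rule L2_set_le_sum) simp
  ultimately show ?thesis by linarith
qed

lemma V_growth: "\<exists>K. \<forall>x. \<bar>V x\<bar> \<le> K * (1 + norm x)\<^sup>2"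
proof (intro exI allI)
  fix x
  let ?K = "\<bar>V 0\<bar> + norm (gradV 0) + \<beta>"
  have c: "\<bar>gradV 0 \<bullet> x\<bar> \<le> norm (gradV 0) * norm x" by (rule Cauchy_Schwarz_ineq2)
  have "\<bar>V x\<bar> \<le> \<bar>V 0\<bar> + norm (gradV 0) * norm x + \<beta> / 2 * (norm x)\<^sup>2"
    using second_order_bounds(1)[of 0 x] second_order_bounds(2)[of x 0] c beta_pos
      mult_nonneg_nonneg[of "\<beta> / 2" "(norm x)\<^sup>2", OF _ zero_le_power2]
    unfolding diff_zero by linarith
  also have "\<dots> \<le> ?K * (1 + norm x)\<^sup>2"
    using beta_pos by (simp add: power2_eq_square algebra_simps add_nonneg_nonneg add_increasing)
  finally show "\<bar>V x\<bar> \<le> ?K * (1 + norm x)\<^sup>2" .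
qed

end


section \<open>The one-step inequality\<close>

text \<open>Removes the perturbation \<open>d\<close> left over from
  \<open>forward_coupling_exists\<close>.\<close>

lemma le_of_le_add_mult:
  fixes x y c :: real
  assumes "\<And>d. 0 < d \<Longrightarrow> y \<le> x + d * c"
  shows "y \<le> x"
proof -
  have "((\<lambda>d. x + d * c) \<longlongrightarrow> x + 0 * c) (at_right 0)" by (intro tendsto_intros)
  then have "y \<le> x + 0 * c"
    by (rule tendsto_lowerbound) (auto simp: eventually_at_right_field intro: assms exI[of _ 1])
  then show ?thesis by simp
qed

lemma bounded_linear_matrix_mult_right: "bounded_linear (\<lambda>A :: real^'n^'n. A ** C)"
  unfolding linear_conv_bounded_linear[symmetric]
  by (rule linearI) (simp_all add: matrix_add_rdistrib scalar_matrix_assoc)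

lemma bounded_linear_quadratic_form: "bounded_linear (\<lambda>A :: real^'n^'n. v \<bullet> (A *v v))"
  unfolding linear_conv_bounded_linear[symmetric]
  by (rule linearI)
     (simp_all add: matrix_vector_mult_add_rdistrib inner_add_right scaleR_matrix_vector_assoc[symmetric])

context convex_smooth_potential
begin

abbreviation mean_grad :: "real^'n \<Rightarrow> real^'n^'n \<Rightarrow> real^'n" where
  "mean_grad m \<Sigma> \<equiv> (\<integral>x. gradV x \<partial>gaussian m \<Sigma>)"

abbreviation mean_hess :: "real^'n \<Rightarrow> real^'n^'n \<Rightarrow> real^'n^'n" where
  "mean_hess m \<Sigma> \<equiv> (\<integral>x. HV x \<partial>gaussian m \<Sigma>)"

lemma integrable_HV:
  assumes "pd_mat \<Sigma>"
  shows "integrable (gaussian m \<Sigma>) HV"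
proof -
  interpret prob_space "gaussian m \<Sigma>" by (rule prob_space_gaussian[OF assms])
  show ?thesis
    using HV_bounded by (intro integrable_const_bound[where B = "real CARD('n) * \<beta>"]) auto
qed

lemma mean_hess_psd:
  assumes "pd_mat \<Sigma>"
  shows "psd_mat (mean_hess m \<Sigma>)" and "v \<bullet> (mean_hess m \<Sigma> *v v) \<le> \<beta> * (v \<bullet> v)"
proof -
  interpret prob_space "gaussian m \<Sigma>" by (rule prob_space_gaussian[OF assms])
  note int = integrable_HV[OF assms, of m]
  have "HV x $ i $ j = HV x $ j $ i" for x i j
    using psd_mat_sym[OF HV_psd[of x]] by (simp add: transpose_def vec_eq_iff)
  then have sym: "sym_mat (mean_hess m \<Sigma>)"
    by (simp add: sym_mat_def transpose_def vec_eq_iff integral_matrix_entry[OF int])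
  have quad: "v \<bullet> (mean_hess m \<Sigma> *v v) = (\<integral>x. v \<bullet> (HV x *v v) \<partial>gaussian m \<Sigma>)" for v
    by (rule integral_bounded_linear[OF bounded_linear_quadratic_form int, symmetric])
  have intq: "integrable (gaussian m \<Sigma>) (\<lambda>x. v \<bullet> (HV x *v v))" for v
    by (rule integrable_bounded_linear[OF bounded_linear_quadratic_form int])
  show "psd_mat (mean_hess m \<Sigma>)"
    using sym convex unfolding psd_mat_def quad by (auto intro: integral_nonneg)
  have "(\<integral>x. v \<bullet> (HV x *v v) \<partial>gaussian m \<Sigma>) \<le> (\<integral>x. \<beta> * (v \<bullet> v) \<partial>gaussian m \<Sigma>)"
    using intq smooth by (intro integral_mono) auto
  then show "v \<bullet> (mean_hess m \<Sigma> *v v) \<le> \<beta> * (v \<bullet> v)"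
    unfolding quad using prob_space by simp
qed

text \<open>The displacement has a constant part, which pairs with the mean gradient, and a linear
  part. Stein's identity for the field \<open>gradV (m + C *v z)\<close>, with derivative
  \<open>HV (m + C *v z) ** C\<close>, turns the latter into a trace with the mean Hessian.\<close>

lemma
  fixes C B A :: "real^'n^'n"
  assumes CB: "C ** B = mat 1"
  defines "\<Sigma> \<equiv> C ** transpose C"
  shows integrable_grad_affine:
      "integrable std_gaussian (\<lambda>z. gradV (m + C *v z) \<bullet> (a + A *v (C *v z)))"
    and integral_grad_affine:
      "(\<integral>z. gradV (m + C *v z) \<bullet> (a + A *v (C *v z)) \<partial>std_gaussian)
        = mean_grad m \<Sigma> \<bullet> a + trace (mean_hess m \<Sigma> ** \<Sigma> ** transpose A)"
proof -
  let ?F = "\<lambda>z. gradV (m + C *v z)" and ?D = "\<lambda>z. HV (m + C *v z) ** C"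
  define L where "L = \<beta> * onorm ((*v) C)"
  have lip: "norm (?F x - ?F y) \<le> L * norm (x - y)" for x y
  proof -
    have "norm (?F x - ?F y) \<le> \<beta> * norm (C *v (x - y))"
      using gradV_lipschitz[of "m + C *v x" "m + C *v y"] by (simp add: matrix_vector_mult_diff_distrib)
    also have "\<dots> \<le> \<beta> * (onorm ((*v) C) * norm (x - y))"
      using beta_pos by (intro mult_left_mono onorm) auto
    finally show ?thesis by (simp add: L_def)
  qed
  have L: "0 \<le> L" using beta_pos by (simp add: L_def onorm_pos_le)
  have deriv: "(?F has_derivative (\<lambda>h. ?D x *v h)) (at x)" for x
  proof -
    have "((\<lambda>z. m + C *v z) has_derivative (\<lambda>h. C *v h)) (at x)"
      by (auto intro!: derivative_eq_intros bounded_linear_imp_has_derivative)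
    from has_derivative_compose[OF this hess] show ?thesis by (simp add: matrix_vector_mul_assoc)
  qed
  have intH: "integrable std_gaussian (\<lambda>z. HV (m + C *v z))"
    and S: "mean_hess m \<Sigma> = (\<integral>z. HV (m + C *v z) \<partial>std_gaussian)"
    and b: "mean_grad m \<Sigma> = (\<integral>z. ?F z \<partial>std_gaussian)"
  proof -
    show "integrable std_gaussian (\<lambda>z. HV (m + C *v z))"
      using HV_bounded
      by (intro finite_measure.integrable_const_bound[where B = "real CARD('n) * \<beta>"])
         (auto simp: prob_space.finite_measure[OF prob_space_std_gaussian])
  qed (simp_all add: \<Sigma>_def integral_gaussian[OF CB])
  have intD: "integrable std_gaussian ?D"
    by (rule integrable_bounded_linear[OF bounded_linear_matrix_mult_right intH])
  have intF: "integrable std_gaussian ?F"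
  proof (rule integrable_std_gaussian_quadratic_growth)
    fix z :: "real^'n"
    have "0 \<le> norm (?F 0) + L" using L by simp
    then have "(norm (?F 0) + L) * (1 + norm z) \<le> (norm (?F 0) + L) * (1 + norm z)\<^sup>2"
      using self_le_power[of "1 + norm z" 2] by (intro mult_left_mono) auto
    with lipschitz_growth[of ?F L z, OF lip L]
    show "norm (?F z) \<le> (norm (?F 0) + L) * (1 + norm z)\<^sup>2" by simp
  qed measurable
  have intFa: "integrable std_gaussian (\<lambda>z. ?F z \<bullet> a)" using intF by simp
  note stein = std_gaussian_stein_field[OF lip deriv intD, of "A ** C"]
  have split: "?F z \<bullet> (a + A *v (C *v z)) = ?F z \<bullet> a + ?F z \<bullet> ((A ** C) *v z)" for z
    by (simp add: inner_add_right matrix_vector_mul_assoc)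
  show "integrable std_gaussian (\<lambda>z. ?F z \<bullet> (a + A *v (C *v z)))"
    unfolding split using intFa stein(1) by (rule Bochner_Integration.integrable_add)
  have "(\<integral>z. ?F z \<bullet> (a + A *v (C *v z)) \<partial>std_gaussian)
      = mean_grad m \<Sigma> \<bullet> a + trace ((\<integral>z. ?D z \<partial>std_gaussian) ** transpose (A ** C))"
    unfolding split Bochner_Integration.integral_add[OF intFa stein(1)] stein(2) b using intF by simp
  also have "(\<integral>z. ?D z \<partial>std_gaussian) = mean_hess m \<Sigma> ** C"
    unfolding S by (rule integral_bounded_linear[OF bounded_linear_matrix_mult_right intH])
  also have "mean_hess m \<Sigma> ** C ** transpose (A ** C) = mean_hess m \<Sigma> ** \<Sigma> ** transpose A"
    by (simp add: \<Sigma>_def matrix_transpose_mul matrix_mul_assoc)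
  finally show "(\<integral>z. ?F z \<bullet> (a + A *v (C *v z)) \<partial>std_gaussian)
        = mean_grad m \<Sigma> \<bullet> a + trace (mean_hess m \<Sigma> ** \<Sigma> ** transpose A)" .
qed

lemma integrable_V_affine: "integrable std_gaussian (\<lambda>z. V (m + C *v z))"
proof -
  obtain K where K: "\<And>x. \<bar>V x\<bar> \<le> K * (1 + norm x)\<^sup>2" using V_growth by blast
  have K0: "0 \<le> K" using order_trans[OF abs_ge_zero K[of 0]] by simp
  define c where "c = 1 + norm m + onorm ((*v) C)"
  have c: "1 \<le> c" "0 \<le> onorm ((*v) C)" by (simp_all add: c_def onorm_pos_le)
  show ?thesis
  proof (rule integrable_std_gaussian_quadratic_growth)
    fix z
    have "norm (m + C *v z) \<le> norm m + onorm ((*v) C) * norm z"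
      using norm_triangle_ineq[of m "C *v z"] onorm[of "(*v) C" z] by simp
    moreover have "c * (1 + norm z) = 1 + norm m + onorm ((*v) C) + norm z + norm m * norm z + onorm ((*v) C) * norm z"
      by (simp add: c_def algebra_simps)
    moreover have "0 \<le> norm z" "0 \<le> norm m * norm z" by simp_all
    ultimately have "1 + norm (m + C *v z) \<le> c * (1 + norm z)"
      using c by linarith
    then have "(1 + norm (m + C *v z))\<^sup>2 \<le> (c * (1 + norm z))\<^sup>2" by (intro power_mono) auto
    then have "K * (1 + norm (m + C *v z))\<^sup>2 \<le> K * (c * (1 + norm z))\<^sup>2"
      using K0 by (rule mult_left_mono)
    with K[of "m + C *v z"]
    show "norm (V (m + C *v z)) \<le> K * c\<^sup>2 * (1 + norm z)\<^sup>2"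
      by (simp add: power_mult_distrib mult.assoc)
  qed measurable
qed

text \<open>Both potentials are integrals over one standard Gaussian \<open>z\<close>, with X = m +
  C z and Y = m' + J C z. Then Y - X = (m' - m) + (J - 1) C z, and the pointwise bounds are
  integrated term by term.\<close>

lemma
  fixes J \<Sigma> \<Sigma>' :: "real^'n^'n"
  assumes \<Sigma>: "pd_mat \<Sigma>" and \<Sigma>': "pd_mat \<Sigma>'" and J: "J ** \<Sigma> ** transpose J = \<Sigma>'"
  shows potential_convex: "potential V (gaussian m \<Sigma>) + mean_grad m \<Sigma> \<bullet> (m' - m)
      + trace (mean_hess m \<Sigma> ** \<Sigma> ** transpose (J - mat 1)) \<le> potential V (gaussian m' \<Sigma>')"
    and potential_smooth: "potential V (gaussian m' \<Sigma>') \<le> potential V (gaussian m \<Sigma>) + mean_grad m \<Sigma> \<bullet> (m' - m)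
      + trace (mean_hess m \<Sigma> ** \<Sigma> ** transpose (J - mat 1))
      + \<beta> / 2 * ((norm (m' - m))\<^sup>2 + trace ((J - mat 1) ** \<Sigma> ** transpose (J - mat 1)))"
proof -
  obtain C where C: "pd_mat C" "C ** transpose C = \<Sigma>" "C ** matrix_inv C = mat 1"
    using pd_mat_factor[OF \<Sigma>] by blast
  let ?K = "J - mat 1" and ?a = "m' - m"
  have JC: "J ** C ** transpose (J ** C) = \<Sigma>'"
    using J by (simp add: matrix_transpose_mul matrix_mul_assoc[symmetric] C(2)[symmetric])
  then have JCinv: "J ** C ** (transpose (J ** C) ** matrix_inv \<Sigma>') = mat 1"
    by (simp only: matrix_mul_assoc pd_mat_inverse(2)[OF \<Sigma>'])
  have pot: "potential V (gaussian m \<Sigma>) = (\<integral>z. V (m + C *v z) \<partial>std_gaussian)"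
    using integral_gaussian[OF C(3), of V m] by (simp add: C(2) potential_def)
  have pot': "potential V (gaussian m' \<Sigma>') = (\<integral>z. V (m' + (J ** C) *v z) \<partial>std_gaussian)"
    using integral_gaussian[OF JCinv, of V m'] by (simp add: JC potential_def)
  let ?dot = "\<lambda>z. gradV (m + C *v z) \<bullet> (?a + ?K *v (C *v z))"
  have diff: "m' + (J ** C) *v z - (m + C *v z) = ?a + ?K *v (C *v z)" for z
    by (simp add: matrix_vector_mult_diff_rdistrib matrix_vector_mul_assoc matrix_diff_rdistrib)
  note intdot = integrable_grad_affine[OF C(3), of m ?a ?K]
    and valdot = integral_grad_affine[OF C(3), of m ?a ?K, unfolded C(2)]
  have sq: "(norm (?a + ?K *v (C *v z)))\<^sup>2 = (?a + (?K ** C) *v z) \<bullet> (?a + (?K ** C) *v z)" for z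
    by (simp add: power2_norm_eq_inner matrix_vector_mul_assoc)
  have intsq: "integrable std_gaussian (\<lambda>z. (norm (?a + ?K *v (C *v z)))\<^sup>2)"
    unfolding sq by (rule integrable_std_gaussian_affine_inner)
  have "?K ** C ** transpose (?K ** C) = ?K ** \<Sigma> ** transpose ?K"
    by (simp only: matrix_transpose_mul matrix_mul_assoc C(2)[symmetric])
  then have valsq: "(\<integral>z. (norm (?a + ?K *v (C *v z)))\<^sup>2 \<partial>std_gaussian) = (norm ?a)\<^sup>2 + trace (?K ** \<Sigma> ** transpose ?K)"
    unfolding sq integral_std_gaussian_affine_inner by (simp add: power2_norm_eq_inner)
  have "(\<integral>z. V (m + C *v z) + ?dot z \<partial>std_gaussian) \<le> (\<integral>z. V (m' + (J ** C) *v z) \<partial>std_gaussian)"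
  proof (rule integral_mono)
    show "V (m + C *v z) + ?dot z \<le> V (m' + (J ** C) *v z)" for z
      using second_order_bounds(1)[of "m + C *v z" "m' + (J ** C) *v z"] unfolding diff .
  qed (intro Bochner_Integration.integrable_add integrable_V_affine intdot)+
  then show "potential V (gaussian m \<Sigma>) + mean_grad m \<Sigma> \<bullet> ?a + trace (mean_hess m \<Sigma> ** \<Sigma> ** transpose ?K)
      \<le> potential V (gaussian m' \<Sigma>')"
    unfolding Bochner_Integration.integral_add[OF integrable_V_affine intdot] valdot pot pot' by simp
  have "(\<integral>z. V (m' + (J ** C) *v z) \<partial>std_gaussian)
      \<le> (\<integral>z. V (m + C *v z) + ?dot z + \<beta> / 2 * (norm (?a + ?K *v (C *v z)))\<^sup>2 \<partial>std_gaussian)"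
  proof (rule integral_mono)
    show "V (m' + (J ** C) *v z) \<le> V (m + C *v z) + ?dot z + \<beta> / 2 * (norm (?a + ?K *v (C *v z)))\<^sup>2" for z
      using second_order_bounds(2)[of "m' + (J ** C) *v z" "m + C *v z"] unfolding diff .
  qed (intro Bochner_Integration.integrable_add integrable_V_affine intdot integrable_mult_right intsq)+
  also have "\<dots> = potential V (gaussian m \<Sigma>) + (mean_grad m \<Sigma> \<bullet> ?a + trace (mean_hess m \<Sigma> ** \<Sigma> ** transpose ?K))
      + \<beta> / 2 * ((norm ?a)\<^sup>2 + trace (?K ** \<Sigma> ** transpose ?K))"
    unfolding pot valdot[symmetric] valsq[symmetric]
    using integrable_V_affine[of m C] intdot intsq
    by (simp add: Bochner_Integration.integral_add)
  finally show "potential V (gaussian m' \<Sigma>') \<le> potential V (gaussian m \<Sigma>) + mean_grad m \<Sigma> \<bullet> ?a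
      + trace (mean_hess m \<Sigma> ** \<Sigma> ** transpose ?K)
      + \<beta> / 2 * ((norm ?a)\<^sup>2 + trace (?K ** \<Sigma> ** transpose ?K))"
    unfolding pot' by simp
qed

end

text \<open>The squared Bures-Wasserstein distance of two Gaussians, written with an optimal transport
  matrix \<open>T\<close>, i.e. a positive definite solution of \<open>T \<Sigma> T = \<Sigma>h\<close>.\<close>

definition gauss_cost :: "real^'n \<Rightarrow> real^'n^'n \<Rightarrow> real^'n \<Rightarrow> real^'n^'n \<Rightarrow> real^'n^'n \<Rightarrow> real" where
  "gauss_cost m \<Sigma> mh \<Sigma>h T = (norm (m - mh))\<^sup>2 + trace \<Sigma> + trace \<Sigma>h - 2 * trace (T ** \<Sigma>)"

context convex_smooth_potential
begin

text \<open>Written with traces against \<open>M\<close>, the three estimates fit together exactly: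
  tr (M \<Sigma>), tr (M \<Sigma> T) and 2 \<eta> n cancel in the sum. \<open>T\<close> and
  \<open>T'\<close> are arbitrary solutions of the transport equations, so that a caller can fix one
  per iterate. Positive definiteness of the new covariance is a separate conclusion, needed to
  iterate.\<close>

lemma fbgvi_step_inequality:
  fixes \<Sigma> \<Sigma>h T T' :: "real^'n^'n"
  assumes \<Sigma>: "pd_mat \<Sigma>" and \<Sigma>h: "pd_mat \<Sigma>h" and \<eta>: "0 < \<eta>" "\<eta> \<le> 1 / \<beta>"
    and step: "fbgvi_step gradV HV \<eta> (m, \<Sigma>) = (m', \<Sigma>')"
  shows "pd_mat \<Sigma>'"
    and "\<lbrakk>pd_mat T; T ** \<Sigma> ** T = \<Sigma>h; pd_mat T'; T' ** \<Sigma>' ** T' = \<Sigma>h\<rbrakk> \<Longrightarrow>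
      2 * \<eta> * (FF V m' \<Sigma>' - FF V mh \<Sigma>h) \<le> gauss_cost m \<Sigma> mh \<Sigma>h T - gauss_cost m' \<Sigma>' mh \<Sigma>h T'"
proof -
  let ?b = "mean_grad m \<Sigma>" and ?S = "mean_hess m \<Sigma>"
  define M where "M = mat 1 - \<eta> *\<^sub>R ?S"
  define H where "H = M ** \<Sigma> ** M"
  define G where "G = mat 1 - \<eta> *\<^sub>R matrix_inv \<Sigma>'"
  have m': "m' = m - \<eta> *\<^sub>R ?b"
    and \<Sigma>'_eq: "\<Sigma>' = (1/2) *\<^sub>R (H + (2 * \<eta>) *\<^sub>R mat 1 + psd_sqrt (H ** (H + (4 * \<eta>) *\<^sub>R mat 1)))"
    using step by (auto simp: fbgvi_step_def Let_def M_def H_def)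
  have symM: "transpose M = M"
    using psd_mat_sym[OF mean_hess_psd(1)[OF \<Sigma>, of m]] by (simp add: M_def transpose_diff transpose_scalar)
  \<comment> \<open>The eigenvalues of \<eta> S are at most \<eta> \<beta> \<le> 1.\<close>
  have "0 \<le> v \<bullet> (M *v v)" for v
  proof -
    have "\<eta> * (v \<bullet> (?S *v v)) \<le> \<eta> * (\<beta> * (v \<bullet> v))"
      using \<eta> mean_hess_psd(2)[OF \<Sigma>] by (intro mult_left_mono) auto
    also have "\<dots> \<le> 1 * (v \<bullet> v)"
      unfolding mult.assoc[symmetric] using \<eta> beta_pos by (intro mult_right_mono) (auto simp: field_simps)
    finally show ?thesis
      by (simp add: M_def matrix_vector_mult_diff_rdistrib inner_diff_right scaleR_matrix_vector_assoc[symmetric])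
  qed
  with symM have M: "psd_mat M" by (simp add: psd_mat_def sym_mat_def)
  have H: "psd_mat H"
    using psd_mat_congruence[OF pd_mat_psd[OF \<Sigma>], of M] by (simp add: H_def symM)
  note bwd = backward_step_covariance[OF H \<eta>(1), folded \<Sigma>'_eq, folded G_def]
  show \<Sigma>': "pd_mat \<Sigma>'" by (rule bwd(1))
  have G: "psd_mat G" "G ** \<Sigma>' ** G = M ** \<Sigma> ** M" using bwd by (auto simp: H_def)
  have "G ** \<Sigma>' = \<Sigma>' - \<eta> *\<^sub>R mat 1"
    using \<Sigma>' by (simp add: G_def matrix_ring_simps pd_mat_inverse)
  then have trG: "trace (G ** \<Sigma>') = trace \<Sigma>' - \<eta> * real CARD('n)"
    by (simp add: trace_sub trace_scaleR trace_I)
  \<comment> \<open>Trades the Hessian produced by Stein's identity for \<open>M\<close>, the matrix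
    in which the forward and backward steps are expressed.\<close>
  have \<eta>S: "\<eta> *\<^sub>R ?S = mat 1 - M" by (simp add: M_def)
  have lin: "\<eta> * trace (?S ** \<Sigma> ** transpose (J - mat 1))
      = trace (\<Sigma> ** transpose J) - trace \<Sigma> - trace (M ** \<Sigma> ** transpose J) + trace (M ** \<Sigma>)" for J
  proof -
    have "\<eta> * trace (?S ** \<Sigma> ** transpose (J - mat 1)) = trace ((\<eta> *\<^sub>R ?S) ** \<Sigma> ** transpose (J - mat 1))"
      by (simp add: trace_scaleR[symmetric] scalar_matrix_assoc)
    then show ?thesis
      unfolding \<eta>S by (simp add: transpose_diff matrix_ring_simps trace_sub)
  qed
  have smooth_part: "2 * \<eta> * (potential V (gaussian m' \<Sigma>') - potential V (gaussian m \<Sigma>))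
      \<le> - \<eta>\<^sup>2 * (?b \<bullet> ?b) - trace \<Sigma>' + 2 * \<eta> * real CARD('n) + 2 * trace (M ** \<Sigma>) - trace \<Sigma>"
  proof (rule le_of_le_add_mult)
    fix d :: real assume d: "0 < d"
    obtain J where J: "J ** \<Sigma> ** transpose J = \<Sigma>'"
      and trJ: "2 * trace (G ** \<Sigma>') - d * (trace \<Sigma>' + trace (matrix_inv \<Sigma>)) \<le> 2 * trace (M ** \<Sigma> ** transpose J)"
      using forward_coupling_exists[OF M \<Sigma> \<Sigma>' G d] by blast
    let ?K = "J - mat 1"
    define Q where "Q = (norm (m' - m))\<^sup>2 + trace (?K ** \<Sigma> ** transpose ?K)"
    have "0 \<le> Q"
      unfolding Q_def using psd_mat_trace_nonneg[OF psd_mat_congruence[OF pd_mat_psd[OF \<Sigma>], of ?K]] by simp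
    \<comment> \<open>\<open>Q\<close> is the mean squared displacement of the coupling; the
      step-size condition replaces its smoothness coefficient by 1.\<close>
    then have "\<eta> * \<beta> * Q \<le> 1 * Q"
      using \<eta> beta_pos by (intro mult_right_mono) (auto simp: field_simps)
    moreover have "2 * \<eta> * (potential V (gaussian m' \<Sigma>') - potential V (gaussian m \<Sigma>))
        \<le> 2 * \<eta> * (?b \<bullet> (m' - m) + trace (?S ** \<Sigma> ** transpose ?K) + \<beta> / 2 * Q)"
      unfolding Q_def using \<eta> potential_smooth[OF \<Sigma> \<Sigma>' J, of m' m] by (intro mult_left_mono) auto
    ultimately have 1: "2 * \<eta> * (potential V (gaussian m' \<Sigma>') - potential V (gaussian m \<Sigma>))
        \<le> 2 * \<eta> * (?b \<bullet> (m' - m)) + 2 * (\<eta> * trace (?S ** \<Sigma> ** transpose ?K)) + Q"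
      by (simp add: algebra_simps)
    have "trace (J ** \<Sigma>) = trace (\<Sigma> ** transpose J)"
      using trace_transpose[of "J ** \<Sigma>"] pd_mat_sym[OF \<Sigma>] by (simp add: matrix_transpose_mul)
    then have trK: "trace (?K ** \<Sigma> ** transpose ?K) = trace \<Sigma>' - 2 * trace (\<Sigma> ** transpose J) + trace \<Sigma>"
      unfolding J[symmetric] by (simp add: transpose_diff matrix_ring_simps trace_sub)
    have mm: "(norm (m' - m))\<^sup>2 = \<eta>\<^sup>2 * (?b \<bullet> ?b)" "?b \<bullet> (m' - m) = - \<eta> * (?b \<bullet> ?b)"
      unfolding power2_norm_eq_inner by (simp_all add: m' power2_eq_square)
    have "2 * \<eta> * (potential V (gaussian m' \<Sigma>') - potential V (gaussian m \<Sigma>))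
      \<le> - \<eta>\<^sup>2 * (?b \<bullet> ?b) - 2 * trace (M ** \<Sigma> ** transpose J) + trace \<Sigma>' - trace \<Sigma> + 2 * trace (M ** \<Sigma>)"
      using 1 unfolding lin Q_def trK mm by (simp add: power2_eq_square algebra_simps)
    with trJ trG show "2 * \<eta> * (potential V (gaussian m' \<Sigma>') - potential V (gaussian m \<Sigma>))
      \<le> - \<eta>\<^sup>2 * (?b \<bullet> ?b) - trace \<Sigma>' + 2 * \<eta> * real CARD('n) + 2 * trace (M ** \<Sigma>) - trace \<Sigma>
        + d * (trace \<Sigma>' + trace (matrix_inv \<Sigma>))"
      by simp
  qed
  assume T: "pd_mat T" "T ** \<Sigma> ** T = \<Sigma>h" and T': "pd_mat T'" "T' ** \<Sigma>' ** T' = \<Sigma>h"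
  have TT: "transpose T = T" using T by (simp add: pd_mat_sym)
  have "\<eta> * (potential V (gaussian m \<Sigma>) + ?b \<bullet> (mh - m) + trace (?S ** \<Sigma> ** transpose (T - mat 1)))
      \<le> \<eta> * potential V (gaussian mh \<Sigma>h)"
    using \<eta> T(2) TT by (intro mult_left_mono potential_convex[OF \<Sigma> \<Sigma>h]) auto
  then have convex_part: "2 * \<eta> * (potential V (gaussian m \<Sigma>) - potential V (gaussian mh \<Sigma>h))
      \<le> 2 * \<eta> * (?b \<bullet> (m - mh)) - 2 * (trace (\<Sigma> ** T) - trace \<Sigma> - trace (M ** \<Sigma> ** T) + trace (M ** \<Sigma>))"
    using lin[of T] unfolding TT by (simp add: algebra_simps inner_diff_right)
  have "\<eta> * (ln (det \<Sigma>h) - ln (det \<Sigma>'))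
    \<le> 2 * trace (T' ** \<Sigma>') - 2 * trace (M ** \<Sigma> ** T) - 2 * \<eta> * real CARD('n)"
    using symM by (intro backward_step_entropy[OF _ \<Sigma> \<Sigma>' \<Sigma>h G(1) G_def G(2) \<eta>(1) T T']) (simp add: sym_mat_def)
  then have entropy_part: "2 * \<eta> * (gauss_entropy m' \<Sigma>' - gauss_entropy mh \<Sigma>h)
    \<le> 2 * trace (T' ** \<Sigma>') - 2 * trace (M ** \<Sigma> ** T) - 2 * \<eta> * real CARD('n)"
    unfolding gauss_entropy_eq[OF \<Sigma>'] gauss_entropy_eq[OF \<Sigma>h] by (simp add: algebra_simps)
  have "(norm (m' - mh))\<^sup>2 = (norm (m - mh))\<^sup>2 - 2 * \<eta> * (?b \<bullet> (m - mh)) + \<eta>\<^sup>2 * (?b \<bullet> ?b)"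
    unfolding power2_norm_eq_inner
    by (simp add: m' inner_diff_left inner_diff_right inner_commute power2_eq_square algebra_simps)
  with smooth_part convex_part entropy_part trace_mul_sym[of \<Sigma> T]
  show "2 * \<eta> * (FF V m' \<Sigma>' - FF V mh \<Sigma>h) \<le> gauss_cost m \<Sigma> mh \<Sigma>h T - gauss_cost m' \<Sigma>' mh \<Sigma>h T'"
    unfolding FF_def gauss_cost_def by (simp add: algebra_simps)
qed

end


section \<open>The Wasserstein distance of Gaussians and the convergence rate\<close>

text \<open>Up to the squared distance of the means, the cost is tr ((1 - T) \<Sigma> (1 - T)), the
  mean squared displacement of the linear map \<open>T\<close>.\<close>

lemma gauss_cost_nonneg:
  assumes \<Sigma>: "pd_mat \<Sigma>" and T: "pd_mat T" "T ** \<Sigma> ** T = \<Sigma>h"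
  shows "0 \<le> gauss_cost m \<Sigma> mh \<Sigma>h T"
proof -
  have TT: "transpose (mat 1 - T) = mat 1 - T" using T by (simp add: transpose_diff pd_mat_sym)
  have "0 \<le> trace ((mat 1 - T) ** \<Sigma> ** transpose (mat 1 - T))"
    by (intro psd_mat_trace_nonneg psd_mat_congruence pd_mat_psd \<Sigma>)
  also have "\<dots> = trace \<Sigma> - trace (\<Sigma> ** T) - trace (T ** \<Sigma>) + trace \<Sigma>h"
    unfolding TT T(2)[symmetric] by (simp add: matrix_ring_simps trace_sub)
  finally show ?thesis
    using trace_mul_sym[of \<Sigma> T] zero_le_power2[of "norm (m - mh)"] unfolding gauss_cost_def by linarith
qed

lemma pd_mat_young:
  fixes T :: "real^'n^'n"
  assumes "pd_mat T"
  shows "2 * (u \<bullet> w) \<le> u \<bullet> (T *v u) + w \<bullet> (matrix_inv T *v w)"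
proof -
  let ?I = "matrix_inv T"
  have I: "psd_mat ?I" using pd_mat_inverse(1)[OF assms] by (rule pd_mat_psd)
  have IT: "?I *v (T *v u) = u"
    using pd_mat_inverse(3)[OF assms] by (simp add: matrix_vector_mul_assoc)
  have "(T *v u) \<bullet> (?I *v w) = (?I *v (T *v u)) \<bullet> w"
    using I by (intro sym_mat_inner) (simp add: psd_mat_def)
  then have cross: "(T *v u) \<bullet> (?I *v w) = u \<bullet> w" by (simp add: IT)
  have "0 \<le> (T *v u - w) \<bullet> (?I *v (T *v u - w))" using I by (simp add: psd_mat_def)
  also have "\<dots> = u \<bullet> (T *v u) - 2 * (u \<bullet> w) + w \<bullet> (?I *v w)"
    unfolding matrix_vector_mult_diff_distrib IT
    by (simp add: inner_diff_left inner_diff_right cross inner_commute)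
  finally show ?thesis by simp
qed

text \<open>Kantorovich duality, weak half: f(x) + g(y) \<le> |x - y|^2 pointwise, and the integral
  of the left side depends on the marginals alone, where it equals the cost.\<close>

lemma coupling_cost_ge_gauss_cost:
  fixes \<Sigma> \<Sigma>h T :: "real^'n^'n"
  assumes \<Sigma>: "pd_mat \<Sigma>" and \<Sigma>h: "pd_mat \<Sigma>h" and T: "pd_mat T" "T ** \<Sigma> ** T = \<Sigma>h"
    and \<gamma>: "\<gamma> \<in> couplings (gaussian m \<Sigma>) (gaussian mh \<Sigma>h)"
  shows "ennreal (gauss_cost m \<Sigma> mh \<Sigma>h T) \<le> (\<integral>\<^sup>+z. ennreal ((norm (fst z - snd z))\<^sup>2) \<partial>\<gamma>)"
proof -
  let ?d = "m - mh" and ?I = "matrix_inv T"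
  \<comment> \<open>With u = x - m and w = y - mh, the square |x - y|^2 splits into terms in
    \<open>u\<close>, terms in \<open>w\<close> and - 2 u . w. Replacing the last by its lower bound
    - u . T u - w . T^-1 w separates the variables; the constant is put into
    \<open>f\<close>.\<close>
  define f where "f x = (norm ?d)\<^sup>2 + (2 *\<^sub>R ?d) \<bullet> (x - m) + (x - m) \<bullet> ((mat 1 - T) *v (x - m))" for x
  define g where "g y = (- 2 *\<^sub>R ?d) \<bullet> (y - mh) + (y - mh) \<bullet> ((mat 1 - ?I) *v (y - mh))" for y
  have sets: "sets \<gamma> = sets (borel \<Otimes>\<^sub>M borel)" and fst: "distr \<gamma> borel fst = gaussian m \<Sigma>"
    and snd: "distr \<gamma> borel snd = gaussian mh \<Sigma>h" and "prob_space \<gamma>"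
    using \<gamma> by (auto simp: couplings_def)
  have fst_m [measurable]: "fst \<in> borel_measurable \<gamma>" and snd_m [measurable]: "snd \<in> borel_measurable \<gamma>"
    by (auto simp: measurable_cong_sets[OF sets refl])
  have [measurable]: "f \<in> borel_measurable borel" "g \<in> borel_measurable borel"
    unfolding f_def g_def by measurable
  interpret P: prob_space "gaussian m \<Sigma>" by (rule prob_space_gaussian[OF \<Sigma>])
  have f: "integrable (gaussian m \<Sigma>) f" "(\<integral>x. f x \<partial>gaussian m \<Sigma>) = (norm ?d)\<^sup>2 + trace ((mat 1 - T) ** \<Sigma>)"
  proof -
    note i = integrable_gaussian_linear[OF \<Sigma>, of m "2 *\<^sub>R ?d"] integrable_gaussian_quadratic[OF \<Sigma>, of m "mat 1 - T"]
    have c: "integrable (gaussian m \<Sigma>) (\<lambda>x. (norm ?d)\<^sup>2)" "(\<integral>x. (norm ?d)\<^sup>2 \<partial>gaussian m \<Sigma>) = (norm ?d)\<^sup>2"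
      using P.prob_space by simp_all
    show "integrable (gaussian m \<Sigma>) f" unfolding f_def
      by (intro Bochner_Integration.integrable_add i c)
    show "(\<integral>x. f x \<partial>gaussian m \<Sigma>) = (norm ?d)\<^sup>2 + trace ((mat 1 - T) ** \<Sigma>)"
      unfolding f_def Bochner_Integration.integral_add[OF Bochner_Integration.integrable_add[OF c(1) i(1)] i(2)]
        Bochner_Integration.integral_add[OF c(1) i(1)] c integral_gaussian_linear[OF \<Sigma>] integral_gaussian_quadratic[OF \<Sigma>]
      by simp
  qed
  have g: "integrable (gaussian mh \<Sigma>h) g" "(\<integral>x. g x \<partial>gaussian mh \<Sigma>h) = trace ((mat 1 - ?I) ** \<Sigma>h)"
  proof -
    note i = integrable_gaussian_linear[OF \<Sigma>h, of mh "- 2 *\<^sub>R ?d"] integrable_gaussian_quadratic[OF \<Sigma>h, of mh "mat 1 - ?I"]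
    show "integrable (gaussian mh \<Sigma>h) g" unfolding g_def
      by (intro Bochner_Integration.integrable_add i)
    show "(\<integral>x. g x \<partial>gaussian mh \<Sigma>h) = trace ((mat 1 - ?I) ** \<Sigma>h)"
      unfolding g_def Bochner_Integration.integral_add[OF i] integral_gaussian_linear[OF \<Sigma>h] integral_gaussian_quadratic[OF \<Sigma>h]
      by simp
  qed
  define l where "l z = f (fst z) + g (snd z)" for z
  have fz: "integrable \<gamma> (\<lambda>z. f (fst z))" "(\<integral>z. f (fst z) \<partial>\<gamma>) = (\<integral>x. f x \<partial>gaussian m \<Sigma>)"
    using f(1) unfolding fst[symmetric] by (simp_all add: integrable_distr_eq integral_distr)
  have gz: "integrable \<gamma> (\<lambda>z. g (snd z))" "(\<integral>z. g (snd z) \<partial>\<gamma>) = (\<integral>x. g x \<partial>gaussian mh \<Sigma>h)"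
    using g(1) unfolding snd[symmetric] by (simp_all add: integrable_distr_eq integral_distr)
  have "?I ** \<Sigma>h = \<Sigma> ** T"
    using T(1) by (simp add: T(2)[symmetric] matrix_mul_assoc[symmetric] pd_mat_inverse_cancel)
  then have "trace ((mat 1 - ?I) ** \<Sigma>h) = trace \<Sigma>h - trace (T ** \<Sigma>)"
    using trace_mul_sym[of \<Sigma> T] by (simp add: matrix_diff_rdistrib trace_sub)
  then have l: "integrable \<gamma> l" "(\<integral>z. l z \<partial>\<gamma>) = gauss_cost m \<Sigma> mh \<Sigma>h T"
    unfolding l_def using fz gz
    by (simp_all add: f(2) g(2) gauss_cost_def matrix_diff_rdistrib trace_sub)
  have le: "l z \<le> (norm (fst z - snd z))\<^sup>2" for z
  proof -
    obtain x y where z: "z = (x, y)" by (metis surj_pair)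
    define u w where "u = x - m" and "w = y - mh"
    have xy: "x - y = ?d + (u - w)" by (simp add: u_def w_def)
    have "(norm (d + (u - w)))\<^sup>2 = (norm d)\<^sup>2 + 2 * (d \<bullet> u) - 2 * (d \<bullet> w) + u \<bullet> u + w \<bullet> w - 2 * (u \<bullet> w)"
      for d unfolding power2_norm_eq_inner
      by (simp add: inner_add_left inner_add_right inner_diff_left inner_diff_right inner_commute)
    then have "(norm (x - y))\<^sup>2 = (norm ?d)\<^sup>2 + 2 * (?d \<bullet> u) - 2 * (?d \<bullet> w) + u \<bullet> u + w \<bullet> w - 2 * (u \<bullet> w)"
      unfolding xy by blast
    moreover have "l z = (norm ?d)\<^sup>2 + 2 * (?d \<bullet> u) - 2 * (?d \<bullet> w) + u \<bullet> u + w \<bullet> w - (u \<bullet> (T *v u) + w \<bullet> (?I *v w))"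
      by (simp add: l_def z f_def g_def u_def[symmetric] w_def[symmetric] matrix_vector_mult_diff_rdistrib inner_diff_right[of _ _ "_ *v _"])
    ultimately show ?thesis using pd_mat_young[OF T(1), of u w] by (simp add: z)
  qed
  \<comment> \<open>\<open>l\<close> may be negative while \<open>ennreal\<close> truncates at 0, so
    the comparison passes through the positive part.\<close>
  have "gauss_cost m \<Sigma> mh \<Sigma>h T \<le> (\<integral>z. max 0 (l z) \<partial>\<gamma>)"
    unfolding l(2)[symmetric] using l(1) by (intro integral_mono) auto
  then have "ennreal (gauss_cost m \<Sigma> mh \<Sigma>h T) \<le> ennreal (\<integral>z. max 0 (l z) \<partial>\<gamma>)" by (rule ennreal_leI)
  also have "\<dots> = (\<integral>\<^sup>+z. ennreal (max 0 (l z)) \<partial>\<gamma>)"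
    using l(1) by (intro nn_integral_eq_integral[symmetric]) auto
  also have "\<dots> \<le> (\<integral>\<^sup>+z. ennreal ((norm (fst z - snd z))\<^sup>2) \<partial>\<gamma>)"
    using le by (intro nn_integral_mono ennreal_leI) auto
  finally show ?thesis .
qed

text \<open>\<open>enn2real\<close> sends infinity to 0, so bounding \<open>W2sq\<close> from below
  requires a coupling of finite cost. Here both marginals are affine images of the same standard
  Gaussian vector.\<close>

lemma finite_cost_coupling_exists:
  fixes \<Sigma> \<Sigma>h :: "real^'n^'n"
  assumes \<Sigma>: "pd_mat \<Sigma>" and \<Sigma>h: "pd_mat \<Sigma>h"
  obtains \<gamma> where "\<gamma> \<in> couplings (gaussian m \<Sigma>) (gaussian mh \<Sigma>h)"
    "(\<integral>\<^sup>+z. ennreal ((norm (fst z - snd z))\<^sup>2) \<partial>\<gamma>) < \<top>"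
proof -
  obtain C where "pd_mat C" and C: "C ** transpose C = \<Sigma>" "C ** matrix_inv C = mat 1"
    using pd_mat_factor[OF \<Sigma>] by blast
  obtain D where "pd_mat D" and D: "D ** transpose D = \<Sigma>h" "D ** matrix_inv D = mat 1"
    using pd_mat_factor[OF \<Sigma>h] by blast
  let ?h = "\<lambda>z. (m + C *v z, mh + D *v z)"
  define \<gamma> where "\<gamma> = distr std_gaussian (borel \<Otimes>\<^sub>M borel) ?h"
  have h [measurable]: "?h \<in> measurable std_gaussian (borel \<Otimes>\<^sub>M borel)" by measurable
  have "distr \<gamma> borel fst = gaussian m \<Sigma>" "distr \<gamma> borel snd = gaussian mh \<Sigma>h"
    using gaussian_eq_distr[OF C(2), of m] gaussian_eq_distr[OF D(2), of mh]
    by (simp_all add: \<gamma>_def distr_distr comp_def C(1) D(1))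
  moreover have "prob_space \<gamma>"
    unfolding \<gamma>_def by (intro prob_space.prob_space_distr prob_space_std_gaussian h)
  ultimately have 1: "\<gamma> \<in> couplings (gaussian m \<Sigma>) (gaussian mh \<Sigma>h)"
    by (simp add: couplings_def \<gamma>_def)
  let ?q = "\<lambda>z. ((m - mh) + (C - D) *v z) \<bullet> ((m - mh) + (C - D) *v z)"
  have "(\<integral>\<^sup>+z. ennreal ((norm (fst z - snd z))\<^sup>2) \<partial>\<gamma>) = (\<integral>\<^sup>+z. ennreal ((norm ((m + C *v z) - (mh + D *v z)))\<^sup>2) \<partial>std_gaussian)"
    unfolding \<gamma>_def by (subst nn_integral_distr) simp_all
  also have "\<dots> = (\<integral>\<^sup>+z. ennreal (?q z) \<partial>std_gaussian)"
    by (intro nn_integral_cong) (simp add: power2_norm_eq_inner matrix_vector_mult_diff_rdistrib algebra_simps)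
  also have "\<dots> = ennreal (\<integral>z. ?q z \<partial>std_gaussian)"
    by (intro nn_integral_eq_integral integrable_std_gaussian_affine_inner) simp
  finally have "(\<integral>\<^sup>+z. ennreal ((norm (fst z - snd z))\<^sup>2) \<partial>\<gamma>) < \<top>" by simp
  with 1 show thesis by (rule that)
qed

lemma gauss_cost_le_W2sq:
  fixes \<Sigma> \<Sigma>h T :: "real^'n^'n"
  assumes \<Sigma>: "pd_mat \<Sigma>" and \<Sigma>h: "pd_mat \<Sigma>h" and T: "pd_mat T" "T ** \<Sigma> ** T = \<Sigma>h"
  shows "gauss_cost m \<Sigma> mh \<Sigma>h T \<le> W2sq (gaussian m \<Sigma>) (gaussian mh \<Sigma>h)"
proof -
  let ?c = "\<lambda>\<gamma>. \<integral>\<^sup>+z. ennreal ((norm (fst z - snd z))\<^sup>2) \<partial>\<gamma>"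
  let ?W = "INF \<gamma>\<in>couplings (gaussian m \<Sigma>) (gaussian mh \<Sigma>h). ?c \<gamma>"
  obtain \<gamma> where "\<gamma> \<in> couplings (gaussian m \<Sigma>) (gaussian mh \<Sigma>h)" "?c \<gamma> < \<top>"
    using finite_cost_coupling_exists[OF \<Sigma> \<Sigma>h] by blast
  then have fin: "?W < \<top>" by (meson INF_lower le_less_trans)
  have "ennreal (gauss_cost m \<Sigma> mh \<Sigma>h T) \<le> ?W"
    by (intro INF_greatest coupling_cost_ge_gauss_cost[OF \<Sigma> \<Sigma>h T])
  then have "enn2real (ennreal (gauss_cost m \<Sigma> mh \<Sigma>h T)) \<le> enn2real ?W"
    using fin by (rule enn2real_mono)
  then show ?thesis
    using gauss_cost_nonneg[OF \<Sigma> T, of m mh] by (simp add: W2sq_def)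
qed

context convex_smooth_potential
begin

lemma fbgvi_convergence:
  fixes m0 mh :: "real^'n" and \<Sigma>0 \<Sigma>h :: "real^'n^'n"
  assumes init: "pd_mat \<Sigma>0" and \<Sigma>h: "pd_mat \<Sigma>h" and \<eta>: "0 < \<eta>" "\<eta> \<le> 1 / \<beta>" and N: "1 \<le> N"
  shows "FF V (fst (fbgvi gradV HV \<eta> m0 \<Sigma>0 N)) (snd (fbgvi gradV HV \<eta> m0 \<Sigma>0 N)) - FF V mh \<Sigma>h
    \<le> W2sq (gaussian m0 \<Sigma>0) (gaussian mh \<Sigma>h) / (2 * real N * \<eta>)"
proof -
  define m where "m k = fst (fbgvi gradV HV \<eta> m0 \<Sigma>0 k)" for k
  define \<Sigma> where "\<Sigma> k = snd (fbgvi gradV HV \<eta> m0 \<Sigma>0 k)" for k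
  define F where "F k = FF V (m k) (\<Sigma> k)" for k
  have step: "fbgvi_step gradV HV \<eta> (m k, \<Sigma> k) = (m (Suc k), \<Sigma> (Suc k))" for k
    by (simp add: m_def \<Sigma>_def)
  have pd: "pd_mat (\<Sigma> k)" for k
  proof (induction k)
    case 0
    show ?case using init by (simp add: \<Sigma>_def)
  next
    case (Suc k)
    show ?case by (rule fbgvi_step_inequality(1)[OF Suc \<Sigma>h \<eta> step])
  qed
  have "\<exists>T. pd_mat T \<and> T ** \<Sigma> k ** T = \<Sigma>h" for k
    using pd_mat_transport_exists[OF pd \<Sigma>h] by blast
  \<comment> \<open>One transport matrix is fixed per index, so the cost after step k is literally
    the cost before step k + 1 and the differences telescope.\<close>
  then obtain T where T: "\<And>k. pd_mat (T k)" "\<And>k. T k ** \<Sigma> k ** T k = \<Sigma>h" by metis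
  define D where "D k = gauss_cost (m k) (\<Sigma> k) mh \<Sigma>h (T k)" for k
  have descent: "2 * \<eta> * (F (Suc k) - FF V mh \<Sigma>h) \<le> D k - D (Suc k)" for k
    unfolding F_def D_def by (rule fbgvi_step_inequality(2)[OF pd \<Sigma>h \<eta> step T T])
  have mono: "F (Suc k) \<le> F k" for k
  proof -
    obtain R where R: "pd_mat R" "R ** \<Sigma> (Suc k) ** R = \<Sigma> k"
      using pd_mat_transport_exists[OF pd pd] by blast
    \<comment> \<open>The target is the current iterate; \<open>mat 1\<close> transports it to
      itself at cost 0, and the subtracted cost is nonnegative.\<close>
    have "2 * \<eta> * (F (Suc k) - F k)
        \<le> gauss_cost (m k) (\<Sigma> k) (m k) (\<Sigma> k) (mat 1) - gauss_cost (m (Suc k)) (\<Sigma> (Suc k)) (m k) (\<Sigma> k) R"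
      unfolding F_def by (rule fbgvi_step_inequality(2)[OF pd pd \<eta> step pd_mat_id _ R]) simp
    also have "\<dots> \<le> 0"
      using gauss_cost_nonneg[OF pd R, of "m (Suc k)" "m k"] by (simp add: gauss_cost_def[of "m k" _ "m k"])
    finally show ?thesis using \<eta>(1) by (simp add: mult_le_0_iff)
  qed
  \<comment> \<open>Monotonicity allows every term of the telescoped sum to be replaced by the last
    gap; keeping \<open>D n\<close> on the left makes the statement inductive.\<close>
  have sum: "real n * (2 * \<eta> * (F n - FF V mh \<Sigma>h)) + D n \<le> D 0" for n
  proof (induction n)
    case (Suc n)
    have "2 * \<eta> * (F (Suc n) - FF V mh \<Sigma>h) \<le> 2 * \<eta> * (F n - FF V mh \<Sigma>h)"
      using mono[of n] \<eta>(1) by (intro mult_left_mono) auto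
    then have "real n * (2 * \<eta> * (F (Suc n) - FF V mh \<Sigma>h)) \<le> real n * (2 * \<eta> * (F n - FF V mh \<Sigma>h))"
      by (rule mult_left_mono) simp
    moreover have "real (Suc n) * (2 * \<eta> * (F (Suc n) - FF V mh \<Sigma>h))
        = real n * (2 * \<eta> * (F (Suc n) - FF V mh \<Sigma>h)) + 2 * \<eta> * (F (Suc n) - FF V mh \<Sigma>h)"
      by (simp add: distrib_right)
    ultimately show ?case using Suc descent[of n] by linarith
  qed simp
  have "D 0 \<le> W2sq (gaussian m0 \<Sigma>0) (gaussian mh \<Sigma>h)"
    using gauss_cost_le_W2sq[OF init \<Sigma>h, of "T 0" m0 mh] T[of 0] by (simp add: D_def m_def \<Sigma>_def)
  moreover have "0 \<le> D N" unfolding D_def by (rule gauss_cost_nonneg[OF pd T])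
  ultimately have "real N * (2 * \<eta> * (F N - FF V mh \<Sigma>h)) \<le> W2sq (gaussian m0 \<Sigma>0) (gaussian mh \<Sigma>h)"
    using sum[of N] by linarith
  then have "F N - FF V mh \<Sigma>h \<le> W2sq (gaussian m0 \<Sigma>0) (gaussian mh \<Sigma>h) / (2 * real N * \<eta>)"
    using N \<eta>(1) by (simp add: pos_le_divide_eq mult_ac)
  then show ?thesis by (simp add: F_def m_def \<Sigma>_def)
qed

end

theorem mainTheorem1:
  fixes V :: "real^'n \<Rightarrow> real"
    and gradV :: "real^'n \<Rightarrow> real^'n"
    and HV :: "real^'n \<Rightarrow> real^'n^'n"
    and \<beta> :: real
    and m0 mh :: "real^'n" and \<Sigma>0 \<Sigma>h :: "real^'n^'n"
  assumes grad: "\<And>x. (V has_derivative (\<lambda>h. gradV x \<bullet> h)) (at x)"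
    and hess: "\<And>x. (gradV has_derivative (\<lambda>h. HV x *v h)) (at x)"
    and hess_cont: "continuous_on UNIV HV"
    and convex: "\<And>x v. 0 \<le> v \<bullet> (HV x *v v)"
    and smooth: "\<And>x v. - \<beta> * (v \<bullet> v) \<le> v \<bullet> (HV x *v v) \<and> v \<bullet> (HV x *v v) \<le> \<beta> * (v \<bullet> v)"
    and beta_pos: "\<beta> > 0"
    and init: "pd_mat \<Sigma>0"
    and min_pd: "pd_mat \<Sigma>h"
    and minimizer: "\<And>m \<Sigma>. pd_mat \<Sigma> \<Longrightarrow> FF V mh \<Sigma>h \<le> FF V m \<Sigma>"
  shows "(\<forall>\<eta> N. 0 < \<eta> \<and> \<eta> \<le> 1 / \<beta> \<and> N \<ge> 1 \<longrightarrow>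
            FF V (fst (fbgvi gradV HV \<eta> m0 \<Sigma>0 N)) (snd (fbgvi gradV HV \<eta> m0 \<Sigma>0 N)) - FF V mh \<Sigma>h
              \<le> W2sq (gaussian m0 \<Sigma>0) (gaussian mh \<Sigma>h) / (2 * real N * \<eta>))
       \<and> (\<forall>\<epsilon> N. \<epsilon> > 0 \<and> N \<ge> 1 \<and> real N \<ge> \<beta> * W2sq (gaussian m0 \<Sigma>0) (gaussian mh \<Sigma>h) / (2 * \<epsilon>\<^sup>2) \<longrightarrow>
            FF V (fst (fbgvi gradV HV (1 / \<beta>) m0 \<Sigma>0 N)) (snd (fbgvi gradV HV (1 / \<beta>) m0 \<Sigma>0 N)) - FF V mh \<Sigma>h
              \<le> \<epsilon>\<^sup>2)"
proof -
  interpret convex_smooth_potential V gradV HV \<beta>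
    using grad hess hess_cont convex smooth beta_pos by unfold_locales auto
  let ?W = "W2sq (gaussian m0 \<Sigma>0) (gaussian mh \<Sigma>h)"
  have rate: "FF V (fst (fbgvi gradV HV \<eta> m0 \<Sigma>0 N)) (snd (fbgvi gradV HV \<eta> m0 \<Sigma>0 N)) - FF V mh \<Sigma>h
      \<le> ?W / (2 * real N * \<eta>)" if "0 < \<eta>" "\<eta> \<le> 1 / \<beta>" "1 \<le> N" for \<eta> N
    using that by (rule fbgvi_convergence[OF init min_pd])
  \<comment> \<open>At \<eta> = 1/\<beta> the rate is \<beta> W / (2 N), and the lower bound on
    \<open>N\<close> is this inequality solved for \<open>N\<close>.\<close>
  have "?W / (2 * real N * (1 / \<beta>)) \<le> \<epsilon>\<^sup>2"
    if "0 < \<epsilon>" "1 \<le> N" "\<beta> * ?W / (2 * \<epsilon>\<^sup>2) \<le> real N" for \<epsilon> N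
  proof -
    have "\<beta> * ?W \<le> real N * (2 * \<epsilon>\<^sup>2)" using that by (simp add: pos_divide_le_eq)
    then show ?thesis using that beta_pos by (simp add: pos_divide_le_eq mult_ac)
  qed
  then show ?thesis
    using rate beta_pos by (auto intro: order_trans[OF rate])
qed

end
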